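(* Let $k>0$, and let $K$, $K_{-\circ}$, $K_{+\circ}$, the contours $\mathcal{A}_1,\mathcal{A}_2$ (copies of $\mathcal{A}$), the shifted contours $\mathcal{A}^a_\varepsilon,\mathcal{A}^b_\varepsilon$ and the sets $\mathcal{D},\mathcal{D}_{\pm\circ},\mathcal{D}_{\pm\pm}$ be as defined in the context. Define $$K_{-+}(\alpha_1,\alpha_2)=\frac{1}{\sqrt[\downarrow]{\sqrt[\downarrow]{k+\alpha_2}}}\exp\left\{\frac{-1}{4i\pi}\int_{\mathcal{A}^b_\varepsilon}\frac{\overset{\swarrow}{\log}\left(1-\frac{\alpha_1}{\kappa(k,z)}\right)}{z-\alpha_2}\,dz\right\},\quad(\alpha_1,\alpha_2)\in\mathcal{D}_{-+},$$ $$K_{--}(\alpha_1,\alpha_2)=\frac{1}{\sqrt[\downarrow]{\sqrt[\downarrow]{k-\alpha_2}}}\exp\left\{\frac{1}{4i\pi}\int_{\mathcal{A}^a_\varepsilon}\frac{\overset{\swarrow}{\log}\left(1-\frac{\alpha_1}{\kappa(k,z)}\right)}{z-\alpha_2}\,dz\right\},\quad(\alpha_1,\alpha_2)\in\mathcal{D}_{--},$$ $$K_{++}(\alpha_1,\alpha_2)=\frac{1}{\sqrt[\downarrow]{\sqrt[\downarrow]{k+\alpha_2}}}\exp\left\{\frac{-1}{4i\pi}\int_{\mathcal{A}^b_\varepsilon}\frac{\overset{\swarrow}{\log}\left(1+\frac{\alpha_1}{\kappa(k,z)}\right)}{z-\alpha_2}\,dz\right\},\quad(\alpha_1,\alpha_2)\in\mathcal{D}_{++},$$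 $$K_{+-}(\alpha_1,\alpha_2)=\frac{1}{\sqrt[\downarrow]{\sqrt[\downarrow]{k-\alpha_2}}}\exp\left\{\frac{1}{4i\pi}\int_{\mathcal{A}^a_\varepsilon}\frac{\overset{\swarrow}{\log}\left(1+\frac{\alpha_1}{\kappa(k,z)}\right)}{z-\alpha_2}\,dz\right\},\quad(\alpha_1,\alpha_2)\in\mathcal{D}_{+-}.$$ Then $K_{++},K_{+-},K_{-+},K_{--}$ are analytic on $\mathcal{D}_{++},\mathcal{D}_{+-},\mathcal{D}_{-+},\mathcal{D}_{--}$ respectively. Moreover $K_{-\circ}=K_{-+}K_{--}$ on $\mathcal{D}_{-\circ}$ and $K_{+\circ}=K_{++}K_{+-}$ on $\mathcal{D}_{+\circ}$. Consequently, for all $(\alpha_1,\alpha_2)\in\mathcal{D}$, $$K(\alpha_1,\alpha_2)=K_{++}(\alpha_1,\alpha_2)\,K_{+-}(\alpha_1,\alpha_2)\,K_{-+}(\alpha_1,\alpha_2)\,K_{--}(\alpha_1,\alpha_2).$$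
   Context: **Special functions.** $\log$ and $\sqrt{\cdot}$ are the principal branches (cut on the negative real axis). Set $\overset{\swarrow}{\log}(z)=\log(e^{-i\pi/4}z)+\frac{i\pi}{4}$, a logarithm whose branch cut runs diagonally down and to the left from $z=0$. Set $\sqrt[\downarrow]{z}=e^{i\pi/4}\sqrt{-iz}$, a square root with branch cut on the negative imaginary axis that agrees with the usual root on the positive reals. For $\mathrm{Im}(\mathfrak{K})\ge0$, $\mathrm{Re}(\mathfrak{K})>0$ set $\kappa(\mathfrak{K},z)=\sqrt[\downarrow]{\mathfrak{K}-z}\,\sqrt[\downarrow]{\mathfrak{K}+z}$, so that $\kappa(\mathfrak{K},z)^2=\mathfrak{K}^2-z^2$ and $\kappa(\mathfrak{K},0)=\mathfrak{K}$; its cuts run vertically upwards from $\mathfrak{K}$ and vertically downwards from $-\mathfrak{K}$. Set $$K(\alpha_1,\alpha_2)=\frac{1}{\kappa(\kappa(k,\alpha_2),\alpha_1)}=\frac{1}{\sqrt[\downarrow]{\kappa(k,\alpha_2)-\alpha_1}\,\sqrt[\downarrow]{\kappa(k,\alpha_2)+\alpha_1}},$$ where $\kappa(\mathfrak K,z)$ is given by the same formula for all $\mathfrak K$ that occur, and $$K_{-\circ}(\alpha_1,\alpha_2)=\frac{1}{\sqrt[\downarrow]{\kappa(k,\alpha_2)-\alpha_1}},\qquad K_{+\circ}(\alpha_1,\alpha_2)=\frac{1}{\sqrt[\downarrow]{\kappa(k,\alpha_2)+\alpha_1}}.$$ **Contours.** $\mathcal{A}_1$ and $\mathcal{A}_2$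 are copies, in the $\alpha_1$- and $\alpha_2$-planes, of one smooth contour $\mathcal{A}$ running from $-\infty$ to $+\infty$, passing through the origin, above $-k$ and below $k$ (e.g. parametrised by $s\mapsto s+\frac{s}{a(s^4+c)}$, $s\in\mathbb{R}$, for suitable complex constants $a,c$; for $k=3$ the paper uses $a=0.0012+0.0006i$, $c=1000i$). It is chosen so that: - for each fixed $\alpha_2^\star\in\mathcal{A}_2$, $K(\cdot,\alpha_2^\star)$ is analytic on $\mathcal{A}_1$, and $\mathcal{A}_1$ passes above $-\kappa(k,\alpha_2^\star)$ and below $\kappa(k,\alpha_2^\star)$ (and does not meet the vertical branch cuts issuing from these points); - for each fixed $\alpha_1^\star\in\mathcal{A}_1$, $K(\alpha_1^\star,\cdot)$ is analytic on $\mathcal{A}_2$, and $\mathcal{A}_2$ passes above $-k$ and $-\kappa(k,\alpha_1^\star)$ and below $k$ and $\kappa(k,\alpha_1^\star)$ (and does not meet the branch cuts); - $\mathrm{Im}(1/K)\ge0$ on $\mathcal{A}_1\times\mathcal{A}_2$. The shifted contours, oriented from left to right, are $\mathcal{A}^b_\varepsilon=\mathcal{A}-i\varepsilon$ and $\mathcal{A}^a_\varepsilon=\mathcal{A}+i\varepsilon$. Here $\varepsilon>0$ is any number such that they lie in a (curved) strip around $\mathcal{A}$ in which, for the value of $\alpha_1$ considered, the function $z\mapsto\overset{\swarrow}{\log}\left(1\mp\frac{\alpha_1}{\kappa(k,z)}\right)$ occurring in the integrand is analytic. **Sets.** $\mathrm{UHP}_j$ (resp. $\mathrm{LHP}_j$)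 is the set of points lying on or above (resp. on or below) $\mathcal{A}_j$. Set $\mathcal{D}=\mathcal{A}_1\times\mathcal{A}_2$, $\mathcal{D}_{++}=\mathrm{UHP}_1\times\mathrm{UHP}_2$, $\mathcal{D}_{-+}=\mathrm{LHP}_1\times\mathrm{UHP}_2$, $\mathcal{D}_{--}=\mathrm{LHP}_1\times\mathrm{LHP}_2$, $\mathcal{D}_{+-}=\mathrm{UHP}_1\times\mathrm{LHP}_2$, $\mathcal{D}_{+\circ}=\mathrm{UHP}_1\times\mathcal{A}_2$, $\mathcal{D}_{-\circ}=\mathrm{LHP}_1\times\mathcal{A}_2$. *)

theory Defs
  imports "HOL-Analysis.Analysis"
begin

definition log_sw :: "complex \<Rightarrow> complex" where
  "log_sw z = Ln (exp (- \<i> * pi / 4) * z) + \<i> * pi / 4"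

definition sqrt_dn :: "complex \<Rightarrow> complex" where
  "sqrt_dn z = exp (\<i> * pi / 4) * csqrt (- \<i> * z)"

definition kappa :: "complex \<Rightarrow> complex \<Rightarrow> complex" where
  "kappa KK z = sqrt_dn (KK - z) * sqrt_dn (KK + z)"

definition K :: "real \<Rightarrow> complex \<times> complex \<Rightarrow> complex" where
  "K k = (\<lambda>(\<alpha>1, \<alpha>2). 1 / kappa (kappa k \<alpha>2) \<alpha>1)"

definition K_mo :: "real \<Rightarrow> complex \<times> complex \<Rightarrow> complex" where
  "K_mo k = (\<lambda>(\<alpha>1, \<alpha>2). 1 / sqrt_dn (kappa k \<alpha>2 - \<alpha>1))"

definition K_po :: "real \<Rightarrow> complex \<times> complex \<Rightarrow> complex" where
  "K_po k = (\<lambda>(\<alpha>1, \<alpha>2). 1 / sqrt_dn (kappa k \<alpha>2 + \<alpha>1))"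

text \<open>The cut of \<open>sqrt_dn\<close>, and the resulting cuts of \<open>kappa KK\<close>: vertically upwards from
  \<open>KK\<close> and vertically downwards from \<open>-KK\<close>, branch points included.\<close>

definition dn_cut :: "complex set" where
  "dn_cut = {- \<i> * of_real t | t. t \<ge> 0}"

definition kappa_cuts :: "complex \<Rightarrow> complex set" where
  "kappa_cuts KK = {z. KK - z \<in> dn_cut \<or> KK + z \<in> dn_cut}"

text \<open>A contour is represented by a parametrisation \<open>\<gamma> :: real \<Rightarrow> complex\<close>; the associated set is
  \<open>range \<gamma>\<close>. The following sides are meaningful for a curve whose real part runs from
  \<open>-\<infinity>\<close> to \<open>+\<infinity>\<close>: it meets the imaginary axis in a bounded set, so both ends of that axis
  lie off the curve.\<close>

definition above :: "complex set \<Rightarrow> complex set" where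
  "above A = {z. \<exists>Y. \<forall>y\<ge>Y. connected_component (- A) z (Complex 0 y)}"

definition below :: "complex set \<Rightarrow> complex set" where
  "below A = {z. \<exists>Y. \<forall>y\<le>Y. connected_component (- A) z (Complex 0 y)}"

definition UHP :: "(real \<Rightarrow> complex) \<Rightarrow> complex set" where
  "UHP \<gamma> = range \<gamma> \<union> above (range \<gamma>)"

definition LHP :: "(real \<Rightarrow> complex) \<Rightarrow> complex set" where
  "LHP \<gamma> = range \<gamma> \<union> below (range \<gamma>)"

definition smooth_line :: "(real \<Rightarrow> complex) \<Rightarrow> bool" where
  "smooth_line \<gamma> \<longleftrightarrow>
     \<gamma> C1_differentiable_on UNIV \<and> (\<forall>s. vector_derivative \<gamma> (at s) \<noteq> 0) \<and> inj \<gamma> \<and>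
     filterlim (\<lambda>s. Re (\<gamma> s)) at_top at_top \<and> filterlim (\<lambda>s. Re (\<gamma> s)) at_bot at_bot"

text \<open>In the second group of conditions, the cuts of \<open>K(\<alpha>1, \<cdot>)\<close> are those of \<open>kappa k\<close>
  together with the set of \<open>\<alpha>2\<close> for which \<open>\<alpha>1\<close> lies on a cut of \<open>kappa (kappa k \<alpha>2)\<close>.\<close>

definition good_contour :: "real \<Rightarrow> (real \<Rightarrow> complex) \<Rightarrow> bool" where
  "good_contour k \<gamma> \<longleftrightarrow>
     smooth_line \<gamma> \<and> 0 \<in> range \<gamma> \<and>
     complex_of_real (- k) \<in> below (range \<gamma>) \<and> complex_of_real k \<in> above (range \<gamma>) \<and>
     (\<forall>\<alpha>2\<in>range \<gamma>.
        (\<lambda>\<alpha>1. K k (\<alpha>1, \<alpha>2)) analytic_on range \<gamma> \<and>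
        - kappa k \<alpha>2 \<in> below (range \<gamma>) \<and> kappa k \<alpha>2 \<in> above (range \<gamma>) \<and>
        range \<gamma> \<inter> kappa_cuts (kappa k \<alpha>2) = {}) \<and>
     (\<forall>\<alpha>1\<in>range \<gamma>.
        (\<lambda>\<alpha>2. K k (\<alpha>1, \<alpha>2)) analytic_on range \<gamma> \<and>
        - kappa k \<alpha>1 \<in> below (range \<gamma>) \<and> kappa k \<alpha>1 \<in> above (range \<gamma>) \<and>
        range \<gamma> \<inter> (kappa_cuts k \<union> {\<alpha>2. \<alpha>1 \<in> kappa_cuts (kappa k \<alpha>2)}) = {}) \<and>
     (\<forall>\<alpha>1\<in>range \<gamma>. \<forall>\<alpha>2\<in>range \<gamma>. Im (1 / K k (\<alpha>1, \<alpha>2)) \<ge> 0)"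

definition shift_a :: "(real \<Rightarrow> complex) \<Rightarrow> real \<Rightarrow> real \<Rightarrow> complex" where
  "shift_a \<gamma> \<epsilon> = (\<lambda>s. \<gamma> s + \<i> * \<epsilon>)"

definition shift_b :: "(real \<Rightarrow> complex) \<Rightarrow> real \<Rightarrow> real \<Rightarrow> complex" where
  "shift_b \<gamma> \<epsilon> = (\<lambda>s. \<gamma> s - \<i> * \<epsilon>)"

text \<open>The Henstock--Kurzweil integral over \<open>UNIV\<close> is the improper integral, i.e. the limit of the
  contour integrals over the arcs \<open>s \<in> {a..b}\<close> as \<open>a\<close> and \<open>b\<close> tend independently to
  \<open>-\<infinity>\<close> and \<open>+\<infinity>\<close>. No absolute convergence is required.\<close>

definition line_integral :: "(real \<Rightarrow> complex) \<Rightarrow> (complex \<Rightarrow> complex) \<Rightarrow> complex" where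
  "line_integral \<gamma> f = integral UNIV (\<lambda>s. f (\<gamma> s) * vector_derivative \<gamma> (at s))"

text \<open>The strip is swept out by the vertical translates of the contour. The translates must lie on
  the proper sides of the contour, since otherwise a point of \<open>UHP\<close> or \<open>LHP\<close> could lie on
  a contour of integration.\<close>

definition admissible_shift :: "(real \<Rightarrow> complex) \<Rightarrow> (complex \<Rightarrow> complex) \<Rightarrow> real \<Rightarrow> bool" where
  "admissible_shift \<gamma> f \<epsilon> \<longleftrightarrow>
     \<epsilon> > 0 \<and>
     (\<forall>t. 0 < t \<and> t \<le> \<epsilon> \<longrightarrow>
        range (shift_a \<gamma> t) \<subseteq> above (range \<gamma>) \<and> range (shift_b \<gamma> t) \<subseteq> below (range \<gamma>)) \<and>
     f analytic_on {\<gamma> s + \<i> * of_real t | s t. \<bar>t\<bar> \<le> \<epsilon>}"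

definition log_m :: "real \<Rightarrow> complex \<Rightarrow> complex \<Rightarrow> complex" where
  "log_m k \<alpha>1 = (\<lambda>z. log_sw (1 - \<alpha>1 / kappa k z))"

definition log_p :: "real \<Rightarrow> complex \<Rightarrow> complex \<Rightarrow> complex" where
  "log_p k \<alpha>1 = (\<lambda>z. log_sw (1 + \<alpha>1 / kappa k z))"

text \<open>The shift \<open>\<epsilon>\<close> may be chosen anew at every point \<open>(\<alpha>1, \<alpha>2)\<close>.\<close>

definition K_mp ::
  "real \<Rightarrow> (real \<Rightarrow> complex) \<Rightarrow> (complex \<times> complex \<Rightarrow> real) \<Rightarrow> complex \<times> complex \<Rightarrow> complex" where
  "K_mp k \<gamma> \<epsilon> = (\<lambda>(\<alpha>1, \<alpha>2). 1 / sqrt_dn (sqrt_dn (k + \<alpha>2)) *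
     exp (- 1 / (4 * \<i> * pi) *
       line_integral (shift_b \<gamma> (\<epsilon> (\<alpha>1, \<alpha>2))) (\<lambda>z. log_m k \<alpha>1 z / (z - \<alpha>2))))"

definition K_mm ::
  "real \<Rightarrow> (real \<Rightarrow> complex) \<Rightarrow> (complex \<times> complex \<Rightarrow> real) \<Rightarrow> complex \<times> complex \<Rightarrow> complex" where
  "K_mm k \<gamma> \<epsilon> = (\<lambda>(\<alpha>1, \<alpha>2). 1 / sqrt_dn (sqrt_dn (k - \<alpha>2)) *
     exp (1 / (4 * \<i> * pi) *
       line_integral (shift_a \<gamma> (\<epsilon> (\<alpha>1, \<alpha>2))) (\<lambda>z. log_m k \<alpha>1 z / (z - \<alpha>2))))"

definition K_pp ::
  "real \<Rightarrow> (real \<Rightarrow> complex) \<Rightarrow> (complex \<times> complex \<Rightarrow> real) \<Rightarrow> complex \<times> complex \<Rightarrow> complex" where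
  "K_pp k \<gamma> \<epsilon> = (\<lambda>(\<alpha>1, \<alpha>2). 1 / sqrt_dn (sqrt_dn (k + \<alpha>2)) *
     exp (- 1 / (4 * \<i> * pi) *
       line_integral (shift_b \<gamma> (\<epsilon> (\<alpha>1, \<alpha>2))) (\<lambda>z. log_p k \<alpha>1 z / (z - \<alpha>2))))"

definition K_pm ::
  "real \<Rightarrow> (real \<Rightarrow> complex) \<Rightarrow> (complex \<times> complex \<Rightarrow> real) \<Rightarrow> complex \<times> complex \<Rightarrow> complex" where
  "K_pm k \<gamma> \<epsilon> = (\<lambda>(\<alpha>1, \<alpha>2). 1 / sqrt_dn (sqrt_dn (k - \<alpha>2)) *
     exp (1 / (4 * \<i> * pi) *
       line_integral (shift_a \<gamma> (\<epsilon> (\<alpha>1, \<alpha>2))) (\<lambda>z. log_p k \<alpha>1 z / (z - \<alpha>2))))"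

definition holomorphic2_on ::
  "(complex \<times> complex \<Rightarrow> complex) \<Rightarrow> (complex \<times> complex) set \<Rightarrow> bool" where
  "holomorphic2_on f U \<longleftrightarrow>
     open U \<and> (\<forall>p\<in>U. \<exists>a b. (f has_derivative (\<lambda>h. a * fst h + b * snd h)) (at p))"

text \<open>For a function given on a set \<open>S\<close> that need not be open, only its values on \<open>S\<close> matter:
  it has to be the restriction of a function holomorphic on a neighbourhood of \<open>S\<close>.\<close>

definition analytic2_on ::
  "(complex \<times> complex \<Rightarrow> complex) \<Rightarrow> (complex \<times> complex) set \<Rightarrow> bool" where
  "analytic2_on f S \<longleftrightarrow> (\<exists>U F. S \<subseteq> U \<and> holomorphic2_on F U \<and> (\<forall>p\<in>S. F p = f p))"

end

theory Submission
  imports Defs "HOL-Complex_Analysis.Conformal_Mappings"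
begin

text \<open>Write \<open>\<kappa>(z) = kappa k z\<close> and \<open>f\<^sub>\<beta>(z) = log_sw (1 + \<beta> / \<kappa>(z))\<close>, so that the integrands are
\<open>f\<^sub>\<beta>(z) / (z - \<alpha>)\<close> with \<open>\<beta> = \<alpha>1\<close> for the factors with index \<open>p\<close> in first place and \<open>\<beta> = - \<alpha>1\<close> for those
with index \<open>m\<close>. Since \<open>f\<^sub>\<beta>\<close> is even, the reflection \<open>z \<mapsto> - z\<close> exchanges the two shifted contours, and
all four factors become instances of \<open>K_pp\<close> for the contour or for its reflection. Only two things
have to be proved: that the Cauchy integral over \<open>\<gamma> - i\<epsilon>\<close> is holomorphic in \<open>(\<beta>, \<alpha>)\<close>, and that it jumps
by \<open>2\<pi>i f\<^sub>\<beta>(\<alpha>)\<close> across \<open>\<gamma>\<close>.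

The jump gives the product formula up to a sign: \<open>exp (- f\<^sub>\<beta>(\<alpha>) / 2)\<close> and the prefactors multiply to a
square root of \<open>1 / (\<kappa>(\<alpha>) + \<beta>)\<close>. The sign is a continuous function with values \<open>\<plusminus>1\<close>, which equals \<open>1\<close> at
\<open>\<beta> = 0\<close>, \<open>\<alpha> = 0\<close>. It stays \<open>1\<close> while \<open>\<alpha>\<close> runs along \<open>\<gamma>\<close> (\<open>sqrt_dn_kappa\<close>) and then while \<open>\<beta>\<close> runs through
the connected set of admissible values (\<open>one_over_sqrt_dn_factor\<close>).

The length of the line over \<open>{z. R < Re z < R + 1}\<close> may grow arbitrarily fast with \<open>R\<close>, so that absolute
convergence is not available. What replaces it is that the
integrands are holomorphic for large \<open>\<bar>Re z\<bar>\<close> and of size \<open>O(1 / z\<^sup>2)\<close> there: in a half plane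
they have a primitive of size \<open>O(1 / Re z)\<close>, which gives convergence of the improper integral with a
bound that does not see the shape of the tails (\<open>improper_line_integral\<close>). Deformations are carried
out by differentiating along the translation, which turns the integral into a boundary term at the
two ends (\<open>integral_translate_bound\<close>).

The same device takes care of the topology. The integral of \<open>1 / (z - w)\<close> along \<open>\<gamma>\<close> is, in the limit,
constant while \<open>w\<close> moves in the complement, and its values at \<open>iY\<close> and \<open>- iY\<close> differ by \<open>2\<pi>i\<close>. Hence the
upper and the lower side of \<open>\<gamma>\<close> are disjoint (\<open>above_below_disjoint\<close>), and the winding of the two
shifted contours around a point of \<open>\<gamma>\<close> is the expected one (\<open>cauchy_arc_tendsto_across\<close>).

Finally, analyticity of \<open>f\<^sub>\<beta>\<close> on a strip is turned into a statement about cuts: for \<open>\<beta> \<noteq> 0\<close> the strip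
misses the cuts of \<open>\<kappa>\<close>, and \<open>1 + \<beta> / \<kappa>\<close> misses the cut of the logarithm
(\<open>log_p_analytic_imp_off_cuts\<close>). In this form the condition is open in \<open>\<beta>\<close>, which produces a
neighbourhood on which the factors extend (\<open>K_pp_analytic\<close>).\<close>

section \<open>Smooth lines\<close>

lemma smooth_line_has_vector_derivative:
  assumes "smooth_line \<gamma>"
  shows "(\<gamma> has_vector_derivative vector_derivative \<gamma> (at s)) (at s within S)"
  using assms unfolding smooth_line_def C1_differentiable_on_eq
  by (auto intro: has_vector_derivative_at_within simp: vector_derivative_works)

lemma smooth_line_continuous_vector_derivative:
  assumes "smooth_line \<gamma>"
  shows "continuous_on S (\<lambda>s. vector_derivative \<gamma> (at s))"
  using assms unfolding smooth_line_def C1_differentiable_on_eq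
  by (auto intro: continuous_on_subset)

lemma smooth_line_continuous:
  assumes "smooth_line \<gamma>"
  shows "continuous_on S \<gamma>"
  using smooth_line_has_vector_derivative[OF assms]
  by (meson continuous_on_vector_derivative)

lemma smooth_line_add:
  assumes "smooth_line \<gamma>"
  shows "smooth_line (\<lambda>s. \<gamma> s + c)" "vector_derivative (\<lambda>s. \<gamma> s + c) (at s) = vector_derivative \<gamma> (at s)"
proof -
  have vd: "vector_derivative (\<lambda>s. \<gamma> s + c) (at s) = vector_derivative \<gamma> (at s)" for s
    by (rule vector_derivative_at)
      (use smooth_line_has_vector_derivative[OF assms] in \<open>auto intro!: derivative_eq_intros\<close>)
  then show "vector_derivative (\<lambda>s. \<gamma> s + c) (at s) = vector_derivative \<gamma> (at s)" .
  have top: "filterlim (\<lambda>s. Re (\<gamma> s + c)) at_top at_top"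
    using assms filterlim_tendsto_add_at_top[OF tendsto_const[of "Re c"], of "\<lambda>s. Re (\<gamma> s)"]
    unfolding smooth_line_def by (simp add: add.commute)
  have bot: "filterlim (\<lambda>s. Re (\<gamma> s + c)) at_bot at_bot"
    using assms filterlim_tendsto_add_at_top[OF tendsto_const[of "- Re c"], of "\<lambda>s. - Re (\<gamma> s)" at_bot]
    unfolding smooth_line_def by (simp add: add.commute filterlim_uminus_at_bot)
  show "smooth_line (\<lambda>s. \<gamma> s + c)"
    using assms top bot unfolding smooth_line_def vd
    by (auto simp: inj_def intro!: C1_differentiable_on_add)
qed

lemma smooth_line_reflect:
  assumes "smooth_line \<gamma>"
  shows "smooth_line (\<lambda>s. - \<gamma> (- s))"
    "vector_derivative (\<lambda>s. - \<gamma> (- s)) (at s) = vector_derivative \<gamma> (at (- s))"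
proof -
  have vd: "((\<lambda>s. - \<gamma> (- s)) has_vector_derivative vector_derivative \<gamma> (at (- s))) (at s)" for s
  proof -
    have "((\<gamma> \<circ> uminus) has_vector_derivative (-1) *\<^sub>R vector_derivative \<gamma> (at (- s))) (at s)"
      by (rule vector_diff_chain_at)
        (auto intro!: derivative_eq_intros smooth_line_has_vector_derivative[OF assms])
    then show ?thesis
      by (auto intro!: derivative_eq_intros simp: o_def)
  qed
  then show vd': "vector_derivative (\<lambda>s. - \<gamma> (- s)) (at s) = vector_derivative \<gamma> (at (- s))" for s
    by (rule vector_derivative_at)
  have "continuous_on UNIV (\<lambda>s. vector_derivative \<gamma> (at (- s)))"
    by (rule continuous_on_compose2[OF smooth_line_continuous_vector_derivative[OF assms, of UNIV]])
      (auto intro!: continuous_intros)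
  then have C1: "(\<lambda>s. - \<gamma> (- s)) C1_differentiable_on UNIV"
    unfolding C1_differentiable_on_eq vd'
    by (auto intro: differentiableI_vector vd)
  have top: "filterlim (\<lambda>s. Re (- \<gamma> (- s))) at_top at_top"
  proof -
    have "filterlim (\<lambda>s. Re (\<gamma> (- s))) at_bot at_top"
      by (rule filterlim_compose[of _ _ at_bot])
        (use assms in \<open>auto simp: smooth_line_def filterlim_uminus_at_bot_at_top\<close>)
    then show ?thesis by (simp add: filterlim_uminus_at_bot)
  qed
  have bot: "filterlim (\<lambda>s. Re (- \<gamma> (- s))) at_bot at_bot"
  proof -
    have "filterlim (\<lambda>s. Re (\<gamma> (- s))) at_top at_bot"
      by (rule filterlim_compose[of _ _ at_top])
        (use assms in \<open>auto simp: smooth_line_def filterlim_uminus_at_top_at_bot\<close>)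
    then show ?thesis by (simp add: filterlim_uminus_at_top)
  qed
  have "inj (\<lambda>s. - \<gamma> (- s))"
    using assms unfolding smooth_line_def inj_def by (metis neg_equal_iff_equal)
  then show "smooth_line (\<lambda>s. - \<gamma> (- s))"
    using assms C1 top bot unfolding smooth_line_def vd' by auto
qed

lemma smooth_line_tails:
  assumes "smooth_line \<gamma>"
  shows "\<exists>T>0. (\<forall>s\<ge>T. Re (\<gamma> s) > R) \<and> (\<forall>s\<le>-T. Re (\<gamma> s) < - R)"
proof -
  have "eventually (\<lambda>s. Re (\<gamma> s) > R) at_top" "eventually (\<lambda>s. Re (\<gamma> s) < - R) at_bot"
    using assms by (auto simp: smooth_line_def filterlim_at_top_dense filterlim_at_bot_dense)
  then obtain T1 T2 where T: "\<forall>s\<ge>T1. Re (\<gamma> s) > R" "\<forall>s\<le>T2. Re (\<gamma> s) < - R"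
    by (auto simp: eventually_at_top_linorder eventually_at_bot_linorder)
  show ?thesis
    by (rule exI[of _ "max 1 (max T1 (- T2))"]) (use T in auto)
qed

lemma closed_range_smooth_line:
  assumes "smooth_line \<gamma>"
  shows "closed (range \<gamma>)"
proof -
  have "\<exists>e>0. ball z e \<subseteq> - range \<gamma>" if z: "z \<notin> range \<gamma>" for z
  proof -
    obtain T where T: "T > 0" "\<forall>s\<ge>T. Re (\<gamma> s) > \<bar>Re z\<bar> + 1" "\<forall>s\<le>-T. Re (\<gamma> s) < - (\<bar>Re z\<bar> + 1)"
      using smooth_line_tails[OF assms] by blast
    have "compact (\<gamma> ` {-T..T})"
      by (intro compact_continuous_image smooth_line_continuous[OF assms]) auto
    then have "open (- \<gamma> ` {-T..T})" by (simp add: compact_imp_closed open_Compl)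
    moreover have "z \<in> - \<gamma> ` {-T..T}" using z by auto
    ultimately obtain e where e: "e > 0" "ball z e \<subseteq> - \<gamma> ` {-T..T}"
      by (meson open_contains_ball)
    have "\<gamma> s \<notin> ball z (min e 1)" for s
    proof
      assume s: "\<gamma> s \<in> ball z (min e 1)"
      then have "\<bar>Re (\<gamma> s) - Re z\<bar> < 1"
        using abs_Re_le_cmod[of "\<gamma> s - z"] by (simp add: dist_norm norm_minus_commute)
      then have "\<not> T \<le> s" "\<not> s \<le> -T" using T by force+
      then have "\<gamma> s \<in> \<gamma> ` {-T..T}" by auto
      then show False using e s by auto
    qed
    then show ?thesis using e by (intro exI[of _ "min e 1"]) auto
  qed
  then show ?thesis unfolding closed_def by (intro openI) auto
qed

section \<open>Improper integrals along a line\<close>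

text \<open>The derivative of the integrand along the translation \<open>\<gamma> + \<tau> v\<close> is \<open>h'(\<gamma> + \<tau> v) v\<close>, and the integral of
\<open>h'(\<gamma> + \<tau> v) \<gamma>'\<close> over the parameter interval is the difference of the values of \<open>h\<close> at the two ends. It
takes the place of a homotopy form of Cauchy's theorem.\<close>

lemma integral_translate_bound:
  assumes \<gamma>: "smooth_line \<gamma>" and "a \<le> b" and h: "h holomorphic_on W" "open W"
    and W: "\<And>s \<tau>. s \<in> {a..b} \<Longrightarrow> \<tau> \<in> {0..1} \<Longrightarrow> \<gamma> s + of_real \<tau> * v \<in> W"
    and B: "\<And>\<tau>. \<tau> \<in> {0..1} \<Longrightarrow> norm (h (\<gamma> b + of_real \<tau> * v) - h (\<gamma> a + of_real \<tau> * v)) \<le> B"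
  shows "norm (integral {a..b} (\<lambda>s. h (\<gamma> s + v) * vector_derivative \<gamma> (at s))
             - integral {a..b} (\<lambda>s. h (\<gamma> s) * vector_derivative \<gamma> (at s))) \<le> norm v * B"
proof -
  define I where "I \<tau> = integral (cbox a b) (\<lambda>s. h (\<gamma> s + of_real \<tau> * v) * vector_derivative \<gamma> (at s))" for \<tau> :: real
  note cont = smooth_line_continuous[OF \<gamma>] smooth_line_continuous_vector_derivative[OF \<gamma>]
  have hd: "(h has_field_derivative deriv h z) (at z)" if "z \<in> W" for z
    using h that holomorphic_derivI by blast
  have dh: "continuous_on W (deriv h)"
    using h by (intro holomorphic_on_imp_continuous_on holomorphic_deriv)
  have hc: "continuous_on W h" using h by (intro holomorphic_on_imp_continuous_on)
  have I': "(I has_vector_derivative v * (h (\<gamma> b + of_real x * v) - h (\<gamma> a + of_real x * v))) (at x within {0..1})"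
    if x: "x \<in> {0..1}" for x
  proof -
    have "(I has_vector_derivative integral (cbox a b)
            (\<lambda>s. deriv h (\<gamma> s + of_real x * v) * v * vector_derivative \<gamma> (at s))) (at x within {0..1})"
      unfolding I_def
    proof (rule leibniz_rule_vector_derivative[where fx="\<lambda>x s. deriv h (\<gamma> s + of_real x * v) * v * vector_derivative \<gamma> (at s)"])
      show "((\<lambda>x. h (\<gamma> s + of_real x * v) * vector_derivative \<gamma> (at s)) has_vector_derivative
            deriv h (\<gamma> s + of_real x * v) * v * vector_derivative \<gamma> (at s)) (at x within {0..1})"
        if "x \<in> {0..1}" "s \<in> cbox a b" for x s
      proof -
        have "((h \<circ> (\<lambda>x. \<gamma> s + of_real x * v)) has_vector_derivative
               v * deriv h (\<gamma> s + of_real x * v)) (at x within {0..1})"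
        proof (rule field_vector_diff_chain_within)
          show "((\<lambda>x. \<gamma> s + of_real x * v) has_vector_derivative v) (at x within {0..1})"
            by (auto intro!: derivative_eq_intros)
          show "(h has_field_derivative deriv h (\<gamma> s + of_real x * v)) (at (\<gamma> s + of_real x * v) within (\<lambda>x. \<gamma> s + complex_of_real x * v) ` {0..1})"
            by (rule has_field_derivative_at_within, rule hd, rule W) (use that in auto)
        qed
        then show ?thesis
          by (auto intro!: derivative_eq_intros simp: o_def mult.commute)
      qed
      show "(\<lambda>s. h (\<gamma> s + of_real x * v) * vector_derivative \<gamma> (at s)) integrable_on cbox a b"
        if "x \<in> {0..1}" for x
        by (intro integrable_continuous continuous_intros cont continuous_on_compose2[OF hc])
          (use W that in auto)
      show "continuous_on ({0..1} \<times> cbox a b) (\<lambda>(x, s). deriv h (\<gamma> s + of_real x * v) * v * vector_derivative \<gamma> (at s))"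
        unfolding split_beta
        by (intro continuous_intros continuous_on_compose2[OF dh]
              continuous_on_compose2[OF cont(1)[of UNIV]] continuous_on_compose2[OF cont(2)[of UNIV]])
          (use W in auto)
    qed (use x in auto)
    moreover have "integral (cbox a b) (\<lambda>s. deriv h (\<gamma> s + of_real x * v) * v * vector_derivative \<gamma> (at s))
        = v * (h (\<gamma> b + of_real x * v) - h (\<gamma> a + of_real x * v))"
    proof -
      have "((\<lambda>s. deriv h (\<gamma> s + of_real x * v) * v * vector_derivative \<gamma> (at s)) has_integral
          v * h (\<gamma> b + of_real x * v) - v * h (\<gamma> a + of_real x * v)) {a..b}"
      proof (rule fundamental_theorem_of_calculus[OF \<open>a \<le> b\<close>])
        fix s assume s: "s \<in> {a..b}"
        have "((h \<circ> (\<lambda>s. \<gamma> s + of_real x * v)) has_vector_derivative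
               vector_derivative \<gamma> (at s) * deriv h (\<gamma> s + of_real x * v)) (at s within {a..b})"
        proof (rule field_vector_diff_chain_within)
          show "((\<lambda>s. \<gamma> s + of_real x * v) has_vector_derivative vector_derivative \<gamma> (at s)) (at s within {a..b})"
            by (auto intro!: derivative_eq_intros smooth_line_has_vector_derivative[OF \<gamma>])
          show "(h has_field_derivative deriv h (\<gamma> s + of_real x * v)) (at (\<gamma> s + of_real x * v) within (\<lambda>s. \<gamma> s + complex_of_real x * v) ` {a..b})"
            by (rule has_field_derivative_at_within, rule hd, rule W) (use s x in auto)
        qed
        then show "((\<lambda>s. v * h (\<gamma> s + of_real x * v)) has_vector_derivative
            deriv h (\<gamma> s + of_real x * v) * v * vector_derivative \<gamma> (at s)) (at s within {a..b})"
          by (auto intro!: derivative_eq_intros simp: o_def mult_ac)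
      qed
      then show ?thesis by (simp add: integral_unique right_diff_distrib)
    qed
    ultimately show ?thesis by simp
  qed
  have "norm (I 1 - I 0) \<le> (norm v * B) * norm (1 - 0 :: real)"
  proof (rule differentiable_bound[OF _ I'[unfolded has_vector_derivative_def]])
    show "onorm (\<lambda>y. y *\<^sub>R (v * (h (\<gamma> b + of_real x * v) - h (\<gamma> a + of_real x * v)))) \<le> norm v * B"
      if "x \<in> {0..1}" for x
    proof (rule onorm_le)
      show "norm (y *\<^sub>R (v * (h (\<gamma> b + of_real x * v) - h (\<gamma> a + of_real x * v)))) \<le> norm v * B * norm y" for y :: real
      proof -
        have "norm (v * (h (\<gamma> b + of_real x * v) - h (\<gamma> a + of_real x * v))) \<le> norm v * B"
          unfolding norm_mult using B[OF that] by (intro mult_left_mono) auto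
        from mult_left_mono[OF this, of "\<bar>y\<bar>"] show ?thesis by (simp add: mult_ac)
      qed
    qed
  qed auto
  then show ?thesis by (simp add: I_def)
qed

text \<open>Any primitive on the half plane has a limit as \<open>Re z\<close> tends to infinity, and subtracting it gives \<open>F\<close>.
Two points are compared by moving both far to the right along horizontal rays: the rays contribute
at most \<open>C / Re z\<close> each, and the segment between the far ends contributes nothing in the limit.\<close>

lemma half_plane_primitive:
  assumes R: "R > 0" and h: "h holomorphic_on {z. Re z > R}"
    and C: "\<And>z. Re z > R \<Longrightarrow> norm (h z) \<le> C / (Re z)\<^sup>2"
  obtains F where "\<And>z. Re z > R \<Longrightarrow> (F has_field_derivative h z) (at z)"
    "\<And>z. Re z > R \<Longrightarrow> norm (F z) \<le> C / Re z"
proof -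
  have op: "open {z. Re z > R}" by (rule open_halfspace_Re_gt)
  have conv: "convex {z. Re z > R}" by (rule convex_halfspace_Re_gt)
  obtain G where G0: "\<And>z. z \<in> {z. Re z > R} \<Longrightarrow> (G has_field_derivative h z) (at z within {z. Re z > R})"
    using holomorphic_convex_primitive'[OF conv op h] by metis
  have G: "(G has_field_derivative h z) (at z)" if "Re z > R" for z
    using G0[of z] that at_within_open[OF _ op, of z] by simp
  have C0: "C \<ge> 0"
  proof -
    have "0 \<le> C / (Re (of_real (R+1)))\<^sup>2" using C[of "of_real (R+1)"] norm_ge_zero order_trans by (metis Re_complex_of_real less_add_one)
    then show ?thesis using R by (simp add: zero_le_divide_iff)
  qed
  have ray: "norm (G (z + of_real t) - G z) \<le> C / Re z" if z: "Re z > R" and t: "t > 0" for z t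
  proof -
    have "norm (G (z + of_real t) - G (z + of_real 0)) \<le> - C / (Re z + t) - (- C / (Re z + 0))"
    proof (rule differentiable_bound_general[OF t, where f="\<lambda>x. G (z + of_real x)" and f'="\<lambda>x. h (z + of_real x)"
         and \<phi>="\<lambda>x. - C / (Re z + x)" and \<phi>'="\<lambda>x. C / (Re z + x)\<^sup>2"])
      have *: "((\<lambda>x. G (z + of_real x)) has_vector_derivative h (z + of_real x)) (at x)" if "x \<ge> 0" for x
      proof -
        have "((G \<circ> (\<lambda>x. z + of_real x)) has_vector_derivative 1 * h (z + of_real x)) (at x)"
          by (rule field_vector_diff_chain_at[OF _ G]) (use that z in \<open>auto intro!: derivative_eq_intros\<close>)
        then show ?thesis by (simp add: o_def)
      qed
      then show "((\<lambda>x. G (z + of_real x)) has_vector_derivative h (z + of_real x)) (at x)" if "0 < x" for x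
        using that by auto
      show "continuous_on {0..t} (\<lambda>x. G (z + complex_of_real x))"
        by (rule continuous_on_vector_derivative[OF has_vector_derivative_at_within[OF *]]) auto
      show "continuous_on {0..t} (\<lambda>x. - C / (Re z + x))"
        using z R by (intro continuous_intros) auto
      show "((\<lambda>x. - C / (Re z + x)) has_vector_derivative C / (Re z + x)\<^sup>2) (at x)" if "0 < x" for x
        using z R that unfolding has_real_derivative_iff_has_vector_derivative[symmetric]
        by (auto intro!: derivative_eq_intros simp: power2_eq_square)
      show "cmod (h (z + complex_of_real x)) \<le> C / (Re z + x)\<^sup>2" if "0 < x" for x
        using C[of "z + of_real x"] that z by simp
    qed
    also have "\<dots> \<le> C / Re z" using C0 z R t by simp
    finally show ?thesis by simp
  qed
  have diff: "norm (G z - G w) \<le> C / Re z + C / Re w" if z: "Re z > R" and w: "Re w > R" for z w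
  proof -
    define r where "r = min (Re z) (Re w)"
    have r: "r > R" using z w by (simp add: r_def)
    have le: "norm (G z - G w) \<le> C / Re z + C / Re w + C / (r + t)\<^sup>2 * norm (z - w)" if t: "t > 0" for t
    proof -
      have "norm (G (z + of_real t) - G (w + of_real t)) \<le> C / (r + t)\<^sup>2 * norm ((z + of_real t) - (w + of_real t))"
      proof (rule field_differentiable_bound[where S="{u. Re u \<ge> r + t}" and f'=h])
        show "convex {u. r + t \<le> Re u}" by (rule convex_halfspace_Re_ge)
        show "(G has_field_derivative h u) (at u within {u. r + t \<le> Re u})" if "u \<in> {u. r + t \<le> Re u}" for u
          using G[of u] that r t by (auto intro: has_field_derivative_at_within)
        show "norm (h u) \<le> C / (r + t)\<^sup>2" if "u \<in> {u. r + t \<le> Re u}" for u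
        proof -
          have "norm (h u) \<le> C / (Re u)\<^sup>2" using that r t by (intro C) auto
          also have "\<dots> \<le> C / (r + t)\<^sup>2"
            using that r t C0 R by (intro divide_left_mono power_mono) (auto intro!: mult_pos_pos)
          finally show ?thesis .
        qed
      qed (auto simp: r_def)
      moreover have "norm (G z - G w) \<le> norm (G (z + of_real t) - G z) + norm (G (z + of_real t) - G (w + of_real t))
         + norm (G (w + of_real t) - G w)" by norm
      ultimately show ?thesis using ray[OF z t] ray[OF w t] by simp
    qed
    have "((\<lambda>t. C / Re z + C / Re w + C / (r + t)\<^sup>2 * norm (z - w)) \<longlongrightarrow> C / Re z + C / Re w + 0 * norm (z - w)) at_top"
      by (intro tendsto_intros tendsto_divide_0[OF tendsto_const] filterlim_at_top_imp_at_infinity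
           filterlim_pow_at_top filterlim_tendsto_add_at_top[OF tendsto_const] filterlim_ident) auto
    from tendsto_lowerbound[OF this eventually_mono[OF eventually_gt_at_top[of 0] le]]
    show ?thesis by simp
  qed
  define x where "x n = complex_of_real (real n + R + 1)" for n
  have x: "Re (x n) > R" "Re (x n) = real n + R + 1" for n using R by (auto simp: x_def)
  have lim0: "(\<lambda>n. C / Re (x n)) \<longlonglongrightarrow> 0"
    unfolding x by (intro tendsto_divide_0[OF tendsto_const] filterlim_at_top_imp_at_infinity)
      (auto simp: add.assoc add.commute intro!: filterlim_tendsto_add_at_top[OF tendsto_const] filterlim_real_sequentially)
  have "Cauchy (\<lambda>n. G (x n))"
  proof (rule CauchyI)
    fix e :: real assume "e > 0"
    then have "eventually (\<lambda>n. C / Re (x n) < e/2) sequentially"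
      using order_tendstoD(2)[OF lim0, of "e/2"] by auto
    then obtain N where N: "\<forall>n\<ge>N. C / Re (x n) < e/2" by (auto simp: eventually_sequentially)
    have "norm (G (x m) - G (x n)) < e" if "m \<ge> N" "n \<ge> N" for m n
      using diff[OF x(1) x(1), of m n] N[rule_format, OF that(1)] N[rule_format, OF that(2)] by linarith
    then show "\<exists>M. \<forall>m\<ge>M. \<forall>n\<ge>M. cmod (G (x m) - G (x n)) < e" by blast
  qed
  then obtain l where l: "(\<lambda>n. G (x n)) \<longlonglongrightarrow> l" by (meson Cauchy_convergent convergent_def)
  show ?thesis
  proof
    show "((\<lambda>z. G z - l) has_field_derivative h z) (at z)" if "Re z > R" for z
      using G[OF that] by (auto intro!: derivative_eq_intros)
    show "norm (G z - l) \<le> C / Re z" if z: "Re z > R" for z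
    proof (rule tendsto_le[OF _ _ tendsto_norm[OF tendsto_diff[OF tendsto_const l]]])
      show "(\<lambda>n. C / Re z + C / Re (x n)) \<longlonglongrightarrow> C / Re z"
        using tendsto_add[OF tendsto_const lim0, of "C / Re z"] by simp
    qed (auto intro!: always_eventually diff z x)
  qed
qed

text \<open>The tails are evaluated by primitives, so that the bound depends on the line only through its
compact part. The factor \<open>2 / R\<close> bounds the two tails together.\<close>

lemma improper_line_integral:
  assumes \<gamma>: "smooth_line \<gamma>" and R: "R > 0" and C: "C \<ge> 0"
    and h: "h holomorphic_on {z. R < \<bar>Re z\<bar>}" "continuous_on (range \<gamma>) h"
    and hC: "\<And>z. R < \<bar>Re z\<bar> \<Longrightarrow> norm (h z) \<le> C / (Re z)\<^sup>2"
    and T: "T > 0" "\<forall>s\<ge>T. Re (\<gamma> s) > R" "\<forall>s\<le>-T. Re (\<gamma> s) < - R"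
    and hT: "\<And>s. \<bar>s\<bar> \<le> T \<Longrightarrow> norm (h (\<gamma> s)) \<le> C"
  shows "\<exists>I. ((\<lambda>s. h (\<gamma> s) * vector_derivative \<gamma> (at s)) has_integral I) UNIV \<and>
      norm I \<le> C * (integral {-T..T} (\<lambda>s. norm (vector_derivative \<gamma> (at s))) + 2 / R) \<and>
      ((\<lambda>T. integral {-T..T} (\<lambda>s. h (\<gamma> s) * vector_derivative \<gamma> (at s))) \<longlongrightarrow> I) at_top"
proof -
  note cont = smooth_line_continuous[OF \<gamma>] smooth_line_continuous_vector_derivative[OF \<gamma>]
  define g where "g s = h (\<gamma> s) * vector_derivative \<gamma> (at s)" for s
  have gc: "continuous_on S g" for S
    unfolding g_def by (intro continuous_intros cont continuous_on_compose2[OF h(2)]) auto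
  obtain F where F: "\<And>z. Re z > R \<Longrightarrow> (F has_field_derivative h z) (at z)"
    "\<And>z. Re z > R \<Longrightarrow> norm (F z) \<le> C / Re z"
  proof (rule half_plane_primitive[OF R, of h C])
    show "h holomorphic_on {z. R < Re z}"
      by (rule holomorphic_on_subset[OF h(1)]) auto
    show "norm (h z) \<le> C / (Re z)\<^sup>2" if "R < Re z" for z
      using hC[of z] that by simp
  qed auto
  obtain G where G: "\<And>z. Re z > R \<Longrightarrow> (G has_field_derivative h (- z)) (at z)"
    "\<And>z. Re z > R \<Longrightarrow> norm (G z) \<le> C / Re z"
  proof (rule half_plane_primitive[OF R, of "\<lambda>z. h (- z)" C])
    show "(\<lambda>z. h (- z)) holomorphic_on {z. R < Re z}"
      by (rule holomorphic_on_compose_gen[OF _ h(1), of uminus, unfolded o_def])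
        (auto intro!: holomorphic_intros)
    show "norm (h (- z)) \<le> C / (Re z)\<^sup>2" if "R < Re z" for z
      using hC[of "- z"] that by simp
  qed auto
  have right: "(g has_integral F (\<gamma> b) - F (\<gamma> T)) {T..b}" if "b \<ge> T" for b
  proof (rule fundamental_theorem_of_calculus[OF that])
    fix s assume s: "s \<in> {T..b}"
    have "((F \<circ> \<gamma>) has_vector_derivative vector_derivative \<gamma> (at s) * h (\<gamma> s)) (at s)"
      by (rule field_vector_diff_chain_at[OF smooth_line_has_vector_derivative[OF \<gamma>] F(1)])
        (use T s in auto)
    then show "((\<lambda>s. F (\<gamma> s)) has_vector_derivative g s) (at s within {T..b})"
      by (auto simp: o_def g_def mult.commute intro: has_vector_derivative_at_within)
  qed
  have left: "(g has_integral - G (- \<gamma> (- T)) - (- G (- \<gamma> a))) {a..-T}" if "a \<le> - T" for a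
  proof (rule fundamental_theorem_of_calculus[OF that])
    fix s assume s: "s \<in> {a..-T}"
    have "((G \<circ> (\<lambda>s. - \<gamma> s)) has_vector_derivative - vector_derivative \<gamma> (at s) * h (- (- \<gamma> s))) (at s)"
      by (rule field_vector_diff_chain_at
          [OF has_vector_derivative_minus[OF smooth_line_has_vector_derivative[OF \<gamma>]] G(1)])
        (use T(3)[rule_format, of s] s in simp)
    from has_vector_derivative_minus[OF this]
    show "((\<lambda>s. - G (- \<gamma> s)) has_vector_derivative g s) (at s within {a..-T})"
      by (auto simp: o_def g_def mult.commute intro: has_vector_derivative_at_within)
  qed
  define I where "I = integral {-T..T} g - F (\<gamma> T) - G (- \<gamma> (- T))"
  have int: "integral {a..b} g = I + F (\<gamma> b) + G (- \<gamma> a)" if ab: "a \<le> -T" "b \<ge> T" for a b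
  proof -
    have "(g has_integral (- G (- \<gamma> (- T)) - (- G (- \<gamma> a)) + integral {-T..T} g + (F (\<gamma> b) - F (\<gamma> T)))) {a..b}"
    proof (rule has_integral_combine[of a T b])
      show "(g has_integral (- G (- \<gamma> (- T)) - (- G (- \<gamma> a)) + integral {-T..T} g)) {a..T}"
        by (rule has_integral_combine[of a "-T" T, OF _ _ left])
          (use ab T gc in \<open>auto intro!: integrable_integral integrable_continuous_interval\<close>)
    qed (use right ab T in auto)
    then show ?thesis by (simp add: integral_unique I_def)
  qed
  have cc: "((\<lambda>s. C / Re (\<gamma> s)) \<longlongrightarrow> 0) at_top" "((\<lambda>s. C / Re (\<gamma> s)) \<longlongrightarrow> 0) at_bot"
    using \<gamma> unfolding smooth_line_def
    by (simp_all add: tendsto_divide_0[OF tendsto_const filterlim_at_top_imp_at_infinity]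
        tendsto_divide_0[OF tendsto_const filterlim_at_bot_imp_at_infinity])
  have conv: "\<exists>B>0. \<forall>a b. a < -B \<longrightarrow> b > B \<longrightarrow> norm (integral {a..b} g - I) < e" if e: "e > 0" for e
  proof -
    have "eventually (\<lambda>s. C / Re (\<gamma> s) < e/2) at_top" "eventually (\<lambda>s. C / Re (\<gamma> s) > -e/2) at_bot"
      using order_tendstoD(2)[OF cc(1), of "e/2"] order_tendstoD(1)[OF cc(2), of "-e/2"] e by auto
    then obtain T1 T2 where T': "\<forall>s\<ge>T1. C / Re (\<gamma> s) < e/2" "\<forall>s\<le>T2. C / Re (\<gamma> s) > -e/2"
      by (auto simp: eventually_at_top_linorder eventually_at_bot_linorder)
    define B where "B = max T (max T1 (-T2))"
    have "norm (integral {a..b} g - I) < e" if ab: "a < -B" "b > B" for a b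
    proof -
      have ab': "a \<le> - T" "b \<ge> T" "a \<le> T2" "b \<ge> T1" using ab unfolding B_def by linarith+
      have "integral {a..b} g - I = F (\<gamma> b) + G (- \<gamma> a)"
        using int[of a b] ab' by simp
      also have "norm \<dots> \<le> C / Re (\<gamma> b) + C / Re (- \<gamma> a)"
        by (rule norm_triangle_le, intro add_mono F G)
          (use T(2)[rule_format, of b] T(3)[rule_format, of a] ab' in auto)
      also have "\<dots> < e/2 + e/2" using T'(1)[rule_format, of b] T'(2)[rule_format, of a] ab'
        by (intro add_strict_mono) auto
      finally show ?thesis by simp
    qed
    moreover have "B > 0" using T by (simp add: B_def)
    ultimately show ?thesis by blast
  qed
  have "(g has_integral I) UNIV"
    unfolding has_integral_alt'
  proof (intro conjI allI impI)
    show "(\<lambda>x. if x \<in> UNIV then g x else 0) integrable_on cbox a b" for a b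
      using gc by (auto intro: integrable_continuous_interval)
    fix e :: real assume "e > 0"
    then obtain B where B: "B > 0" "\<And>a b. a < -B \<Longrightarrow> b > B \<Longrightarrow> norm (integral {a..b} g - I) < e"
      using conv by metis
    have "norm (integral {a..b} g - I) < e" if "ball 0 (B + 1) \<subseteq> cbox a b" for a b
    proof (rule B)
      have "- (B + 1/2) \<in> ball 0 (B + 1)" "B + 1/2 \<in> ball 0 (B + 1)" using B(1) by (auto simp: dist_real_def)
      then have "- (B + 1/2) \<in> cbox a b" "B + 1/2 \<in> cbox a b" using that by blast+
      then show "a < -B" "b > B" by auto
    qed
    then show "\<exists>B>0. \<forall>a b. ball 0 B \<subseteq> cbox a b \<longrightarrow>
           norm (integral (cbox a b) (\<lambda>x. if x \<in> UNIV then g x else 0) - I) < e"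
      using B(1) by (intro exI[of _ "B + 1"]) auto
  qed
  moreover have "norm I \<le> C * (integral {-T..T} (\<lambda>s. norm (vector_derivative \<gamma> (at s))) + 2 / R)"
  proof -
    have 1: "norm (integral {-T..T} g) \<le> integral {-T..T} (\<lambda>s. C * norm (vector_derivative \<gamma> (at s)))"
    proof (rule integral_norm_bound_integral)
      show "g integrable_on {-T..T}" using gc by (auto intro: integrable_continuous_interval)
      show "(\<lambda>s. C * norm (vector_derivative \<gamma> (at s))) integrable_on {-T..T}"
        by (intro integrable_continuous_interval continuous_intros cont)
      show "norm (g s) \<le> C * norm (vector_derivative \<gamma> (at s))" if "s \<in> {-T..T}" for s
        unfolding g_def norm_mult using that by (intro mult_right_mono hT) auto
    qed
    have R': "Re (\<gamma> T) > R" "Re (- \<gamma> (- T)) > R" using T(2)[rule_format, of T] T(3)[rule_format, of "-T"] by auto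
    have 2: "norm (F (\<gamma> T)) \<le> C / R"
      by (rule order_trans[OF F(2)[OF R'(1)] frac_le]) (use R' R C in auto)
    have 3: "norm (G (- \<gamma> (- T))) \<le> C / R"
      by (rule order_trans[OF G(2)[OF R'(2)] frac_le]) (use R' R C in auto)
    have "norm I \<le> norm (integral {-T..T} g) + norm (F (\<gamma> T)) + norm (G (- \<gamma> (- T)))"
      unfolding I_def by norm
    also have "\<dots> \<le> C * integral {-T..T} (\<lambda>s. norm (vector_derivative \<gamma> (at s))) + C / R + C / R"
      using 1 2 3 by simp
    finally show ?thesis by (simp add: algebra_simps)
  qed
  moreover have "((\<lambda>T. integral {-T..T} g) \<longlongrightarrow> I) at_top"
  proof (rule tendstoI)
    fix e :: real assume "e > 0"
    then obtain B where B: "B > 0" "\<And>a b. a < -B \<Longrightarrow> b > B \<Longrightarrow> norm (integral {a..b} g - I) < e"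
      using conv by metis
    show "eventually (\<lambda>T. dist (integral {-T..T} g) I < e) at_top"
      using eventually_gt_at_top[of B] by eventually_elim (use B in \<open>auto simp: dist_norm\<close>)
  qed
  ultimately show ?thesis unfolding g_def by blast
qed

section \<open>The two sides of a line\<close>

text \<open>For a point off the line the limit of this expression plays the role of a winding number, but it need
not exist: the arguments of the two ends relative to \<open>w\<close> may oscillate. Only differences for two
values of \<open>w\<close> are considered in the limit.\<close>

definition cauchy_arc :: "(real \<Rightarrow> complex) \<Rightarrow> complex \<Rightarrow> real \<Rightarrow> complex" where
  "cauchy_arc \<gamma> w T = integral {-T..T} (\<lambda>s. 1 / (\<gamma> s - w) * vector_derivative \<gamma> (at s))"

text \<open>The limit version of Cauchy's theorem for a line and its translate: the boundary terms vanish
because the integrand vanishes at infinity. No rate is required, which matters for integrands that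
are only \<open>O(1 / z)\<close>.\<close>

lemma integral_translate_tendsto:
  assumes \<gamma>: "smooth_line \<gamma>" and h: "h holomorphic_on W" "open W" "(h \<longlongrightarrow> 0) at_infinity"
    and W: "\<And>s \<tau>. \<tau> \<in> {0..1} \<Longrightarrow> \<gamma> s + of_real \<tau> * v \<in> W"
  shows "((\<lambda>T. integral {-T..T} (\<lambda>s. h (\<gamma> s + v) * vector_derivative \<gamma> (at s))
             - integral {-T..T} (\<lambda>s. h (\<gamma> s) * vector_derivative \<gamma> (at s))) \<longlongrightarrow> 0) at_top"
proof (rule tendstoI)
  fix e :: real assume e: "e > 0"
  \<comment> \<open>Chosen so that the two boundary terms, of total size at most \<open>2 M \<bar>v\<bar>\<close>, stay below \<open>e\<close> also for
    \<open>v = 0\<close>.\<close>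
  define M where "M = e / (2 * norm v + 1)"
  have M: "M > 0" using e by (simp add: M_def add_nonneg_pos)
  have "eventually (\<lambda>z. norm (h z) < M) at_infinity"
    using tendstoD[OF h(3) M] by simp
  then obtain B where B: "\<And>z. B \<le> norm z \<Longrightarrow> norm (h z) < M"
    by (auto simp: eventually_at_infinity)
  obtain T0 where T0: "T0 > 0" "\<forall>s\<ge>T0. Re (\<gamma> s) > B + norm v" "\<forall>s\<le>-T0. Re (\<gamma> s) < - (B + norm v)"
    using smooth_line_tails[OF \<gamma>] by blast
  have far: "norm (h (\<gamma> s + of_real \<tau> * v)) \<le> M" if s: "T0 \<le> \<bar>s\<bar>" and \<tau>: "\<tau> \<in> {0..1}" for s \<tau>
  proof -
    have "\<bar>Re (\<gamma> s)\<bar> > B + norm v"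
      using T0(2)[rule_format, of s] T0(3)[rule_format, of s] s by (cases "s \<ge> 0") auto
    then have 1: "norm (\<gamma> s) > B + norm v" using abs_Re_le_cmod[of "\<gamma> s"] by linarith
    have 2: "norm (of_real \<tau> * v) \<le> norm v" using \<tau> by (simp add: norm_mult mult_left_le_one_le)
    have "norm (\<gamma> s) \<le> norm (\<gamma> s + of_real \<tau> * v) + norm (of_real \<tau> * v)" by norm
    with 1 2 have "B \<le> norm (\<gamma> s + of_real \<tau> * v)" by linarith
    then show ?thesis using B by (simp add: less_imp_le)
  qed
  have "dist (integral {-T..T} (\<lambda>s. h (\<gamma> s + v) * vector_derivative \<gamma> (at s))
       - integral {-T..T} (\<lambda>s. h (\<gamma> s) * vector_derivative \<gamma> (at s))) 0 < e" if T: "T \<ge> T0" for T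
  proof -
    have "norm (integral {-T..T} (\<lambda>s. h (\<gamma> s + v) * vector_derivative \<gamma> (at s))
       - integral {-T..T} (\<lambda>s. h (\<gamma> s) * vector_derivative \<gamma> (at s))) \<le> norm v * (M + M)"
    proof (rule integral_translate_bound[OF \<gamma> _ h(1,2) W])
      show "norm (h (\<gamma> T + of_real \<tau> * v) - h (\<gamma> (-T) + of_real \<tau> * v)) \<le> M + M"
        if "\<tau> \<in> {0..1}" for \<tau>
        by (rule norm_triangle_le_diff, intro add_mono far) (use that T T0 in auto)
    qed (use T T0 in auto)
    also have "\<dots> = 2 * norm v / (2 * norm v + 1) * e" by (simp add: M_def)
    also have "\<dots> < 1 * e" using e by (intro mult_strict_right_mono) (auto simp: divide_less_eq add_nonneg_pos)
    finally show ?thesis by simp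
  qed
  then show "eventually (\<lambda>T. dist (integral {-T..T} (\<lambda>s. h (\<gamma> s + v) * vector_derivative \<gamma> (at s))
       - integral {-T..T} (\<lambda>s. h (\<gamma> s) * vector_derivative \<gamma> (at s))) 0 < e) at_top"
    by (auto simp: eventually_at_top_linorder)
qed

lemma inverse_diff_tendsto_0: "((\<lambda>z::complex. 1 / (z - w)) \<longlongrightarrow> 0) at_infinity"
proof -
  have "filterlim (\<lambda>z. - w + z) at_infinity at_infinity"
    by (rule tendsto_add_filterlim_at_infinity[OF tendsto_const filterlim_ident])
  from tendsto_divide_0[OF tendsto_const this] show ?thesis by simp
qed

text \<open>Moving the pole from \<open>w\<close> to \<open>w'\<close> amounts to translating the line by \<open>w - w'\<close>.\<close>

lemma cauchy_arc_tendsto_segment: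
  assumes \<gamma>: "smooth_line \<gamma>" and w: "closed_segment w w' \<subseteq> - range \<gamma>"
  shows "((\<lambda>T. cauchy_arc \<gamma> w' T - cauchy_arc \<gamma> w T) \<longlongrightarrow> 0) at_top"
proof -
  define v where "v = w - w'"
  have "((\<lambda>T. integral {-T..T} (\<lambda>s. 1 / (\<gamma> s + v - w) * vector_derivative \<gamma> (at s))
      - integral {-T..T} (\<lambda>s. 1 / (\<gamma> s - w) * vector_derivative \<gamma> (at s))) \<longlongrightarrow> 0) at_top"
  proof (rule integral_translate_tendsto[OF \<gamma>, where h="\<lambda>z. 1 / (z - w)" and W="- {w}"])
    show "(\<lambda>z. 1 / (z - w)) holomorphic_on - {w}" by (intro holomorphic_intros) auto
    show "\<gamma> s + of_real \<tau> * v \<in> - {w}" if "\<tau> \<in> {0..1}" for s \<tau>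
    proof
      assume "\<gamma> s + of_real \<tau> * v \<in> {w}"
      then have "\<gamma> s = w + of_real \<tau> * (w' - w)" by (simp add: v_def algebra_simps)
      moreover have "w + of_real \<tau> * (w' - w) \<in> closed_segment w w'"
        unfolding in_segment using that by (intro exI[of _ \<tau>]) (auto simp: scaleR_conv_of_real algebra_simps)
      ultimately show False using w by (metis ComplD rangeI subsetD)
    qed
  qed (auto intro: inverse_diff_tendsto_0)
  then show ?thesis by (simp add: cauchy_arc_def v_def algebra_simps)
qed

lemma cauchy_arc_tendsto_connected:
  assumes \<gamma>: "smooth_line \<gamma>" and S: "connected S" "S \<inter> range \<gamma> = {}" "w \<in> S" "w' \<in> S"
  shows "((\<lambda>T. cauchy_arc \<gamma> w' T - cauchy_arc \<gamma> w T) \<longlongrightarrow> 0) at_top"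
proof (rule connected_equivalence_relation[OF S(1,3,4), where R="\<lambda>w w'. ((\<lambda>T. cauchy_arc \<gamma> w' T - cauchy_arc \<gamma> w T) \<longlongrightarrow> 0) at_top"])
  show "((\<lambda>T. cauchy_arc \<gamma> x T - cauchy_arc \<gamma> y T) \<longlongrightarrow> 0) at_top"
    if "((\<lambda>T. cauchy_arc \<gamma> y T - cauchy_arc \<gamma> x T) \<longlongrightarrow> 0) at_top" for x y
    using tendsto_minus[OF that] by simp
  show "((\<lambda>T. cauchy_arc \<gamma> z T - cauchy_arc \<gamma> x T) \<longlongrightarrow> 0) at_top"
    if "((\<lambda>T. cauchy_arc \<gamma> y T - cauchy_arc \<gamma> x T) \<longlongrightarrow> 0) at_top"
       "((\<lambda>T. cauchy_arc \<gamma> z T - cauchy_arc \<gamma> y T) \<longlongrightarrow> 0) at_top" for x y z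
    using tendsto_add[OF that] by simp
  fix a assume a: "a \<in> S"
  have "open (- range \<gamma>)" using closed_range_smooth_line[OF \<gamma>] by auto
  then obtain e where e: "e > 0" "ball a e \<subseteq> - range \<gamma>"
    using a S(2) by (meson disjoint_eq_subset_Compl open_contains_ball subsetD)
  show "\<exists>T. openin (top_of_set S) T \<and> a \<in> T \<and>
      (\<forall>x\<in>T. ((\<lambda>T. cauchy_arc \<gamma> x T - cauchy_arc \<gamma> a T) \<longlongrightarrow> 0) at_top)"
  proof (intro exI[of _ "S \<inter> ball a e"] conjI ballI)
    show "openin (top_of_set S) (S \<inter> ball a e)" by (simp add: openin_open_Int)
    show "((\<lambda>T. cauchy_arc \<gamma> x T - cauchy_arc \<gamma> a T) \<longlongrightarrow> 0) at_top" if "x \<in> S \<inter> ball a e" for x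
    proof (rule cauchy_arc_tendsto_segment[OF \<gamma>])
      have "closed_segment a x \<subseteq> ball a e"
        using that e by (intro closed_segment_subset) auto
      then show "closed_segment a x \<subseteq> - range \<gamma>" using e by blast
    qed
  qed (use a e in auto)
qed

lemma smooth_line_imaginary_axis_bounded:
  assumes "smooth_line \<gamma>"
  shows "\<exists>Y>0. \<forall>s. Re (\<gamma> s) = 0 \<longrightarrow> \<bar>Im (\<gamma> s)\<bar> < Y"
proof -
  obtain T where T: "T > 0" "\<forall>s\<ge>T. Re (\<gamma> s) > 0" "\<forall>s\<le>-T. Re (\<gamma> s) < - 0"
    using smooth_line_tails[OF assms] by blast
  have "compact (\<gamma> ` {-T..T})"
    by (intro compact_continuous_image smooth_line_continuous[OF assms]) auto
  then obtain B where B: "B > 0" "\<forall>z \<in> \<gamma> ` {-T..T}. norm z < B"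
    using bounded_pos_less compact_imp_bounded by blast
  have "\<bar>Im (\<gamma> s)\<bar> < B" if "Re (\<gamma> s) = 0" for s
  proof -
    have "s \<in> {-T..T}" using T(2)[rule_format, of s] T(3)[rule_format, of s] that by force
    then have "norm (\<gamma> s) < B" using B(2) by blast
    then show ?thesis using abs_Im_le_cmod[of "\<gamma> s"] by linarith
  qed
  then show ?thesis using B(1) by blast
qed

text \<open>In \<open>Arctan z = (i/2) Ln ((1 - iz) / (1 + iz))\<close> the argument of \<open>Ln\<close> tends to \<open>-1\<close>, a point of the cut, from
the side determined by the sign of \<open>Re z\<close>. Negating the argument moves the limit to \<open>1\<close>, where \<open>Ln\<close> is
continuous, at the price of \<open>\<plusminus>i\<pi>\<close>.\<close>

lemma Arctan_tendsto_half_pi: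
  assumes "filterlim f at_infinity F" and pos: "eventually (\<lambda>x. 0 < \<sigma> * Re (f x)) F" and \<sigma>: "\<sigma> = 1 \<or> \<sigma> = -1"
  shows "((\<lambda>x. Arctan (f x)) \<longlongrightarrow> of_real \<sigma> * pi / 2) F"
proof -
  define q where "q z = (\<i> * z - 1) / (\<i> * z + 1)" for z
  have inf: "filterlim (\<lambda>x. \<i> * f x + 1) at_infinity F"
    using assms(1) by (intro tendsto_add_filterlim_at_infinity' tendsto_mult_filterlim_at_infinity[OF tendsto_const] tendsto_const) auto
  have "((\<lambda>x. 1 - 2 / (\<i> * f x + 1)) \<longlongrightarrow> 1 - 0) F"
    by (intro tendsto_intros tendsto_divide_0[OF tendsto_const] inf)
  moreover have "eventually (\<lambda>x. 1 - 2 / (\<i> * f x + 1) = q (f x)) F"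
    using filterlim_at_infinity_imp_eventually_ne[OF inf, of 0]
    by eventually_elim (simp add: q_def field_simps)
  ultimately have q1: "((\<lambda>x. q (f x)) \<longlongrightarrow> 1) F"
    by (simp add: Lim_transform_eventually)
  have "((\<lambda>x. \<i> / 2 * (Ln (q (f x)) - of_real \<sigma> * (\<i> * pi))) \<longlongrightarrow> \<i> / 2 * (Ln 1 - of_real \<sigma> * (\<i> * pi))) F"
    by (intro tendsto_intros tendsto_Ln q1) auto
  moreover have "eventually (\<lambda>x. \<i> / 2 * (Ln (q (f x)) - of_real \<sigma> * (\<i> * pi)) = Arctan (f x)) F"
    using pos
  proof eventually_elim
    case (elim x)
    let ?z = "f x"
    have "Im ((\<i> * ?z - 1) * cnj (\<i> * ?z + 1)) = 2 * Re ?z" by (simp add: algebra_simps)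
    then have im: "\<sigma> * Im (q ?z) > 0"
      unfolding q_def using elim \<sigma> by (auto simp: Im_complex_div_gt_0 Im_complex_div_lt_0)
    then have q0: "q ?z \<noteq> 0" by auto
    have "Arctan ?z = \<i> / 2 * Ln (- q ?z)"
      unfolding Arctan_def q_def minus_divide_left by (simp add: add.commute)
    also have "Ln (- q ?z) = Ln (q ?z) - of_real \<sigma> * (\<i> * pi)"
      using im \<sigma> Ln_minus[OF q0] by auto
    finally show ?case by simp
  qed
  ultimately have "((\<lambda>x. Arctan (f x)) \<longlongrightarrow> \<i> / 2 * (Ln 1 - of_real \<sigma> * (\<i> * pi))) F"
    by (rule Lim_transform_eventually)
  then show ?thesis by (simp add: algebra_simps)
qed

text \<open>The difference of the two integrands is \<open>2iY / (z\<^sup>2 + Y\<^sup>2)\<close>, with primitive \<open>2i Arctan (z / Y)\<close> off the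
two rays \<open>{iy | \<bar>y\<bar> \<ge> Y}\<close>, which the line does not meet.\<close>

lemma cauchy_arc_tendsto_axis:
  assumes \<gamma>: "smooth_line \<gamma>" and Y: "Y > 0" "\<forall>s. Re (\<gamma> s) = 0 \<longrightarrow> \<bar>Im (\<gamma> s)\<bar> < Y"
  shows "((\<lambda>T. cauchy_arc \<gamma> (Complex 0 Y) T - cauchy_arc \<gamma> (Complex 0 (-Y)) T) \<longlongrightarrow> 2 * pi * \<i>) at_top"
proof -
  note cont = smooth_line_continuous[OF \<gamma>] smooth_line_continuous_vector_derivative[OF \<gamma>]
  have ne: "\<gamma> s \<noteq> Complex 0 Y" "\<gamma> s \<noteq> Complex 0 (-Y)" for s
    using Y(2)[rule_format, of s] Y(1) by (auto simp: complex_eq_iff)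
  have int: "(\<lambda>s. 1 / (\<gamma> s - Complex 0 y) * vector_derivative \<gamma> (at s)) integrable_on {-T..T}"
    if "y = Y \<or> y = -Y" for y T
    by (intro integrable_continuous_interval continuous_intros cont) (use ne that in auto)
  have eq: "cauchy_arc \<gamma> (Complex 0 Y) T - cauchy_arc \<gamma> (Complex 0 (-Y)) T =
     2 * \<i> * (Arctan (\<gamma> T / Y) - Arctan (\<gamma> (- T) / Y))" if T: "T \<ge> 0" for T
  proof -
    have "cauchy_arc \<gamma> (Complex 0 Y) T - cauchy_arc \<gamma> (Complex 0 (-Y)) T =
       integral {-T..T} (\<lambda>s. 1 / (\<gamma> s - Complex 0 Y) * vector_derivative \<gamma> (at s)
           - 1 / (\<gamma> s - Complex 0 (-Y)) * vector_derivative \<gamma> (at s))"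
      unfolding cauchy_arc_def by (rule integral_diff[symmetric]; rule int; simp)
    also have "\<dots> = 2 * \<i> * Arctan (\<gamma> T / Y) - 2 * \<i> * Arctan (\<gamma> (- T) / Y)"
    proof (rule integral_unique, rule fundamental_theorem_of_calculus)
      fix s assume "s \<in> {-T..T}"
      have A: "((\<lambda>z. 2 * \<i> * Arctan (z / Y)) has_field_derivative 2 * \<i> * (inverse (1 + (\<gamma> s / Y)\<^sup>2) / Y)) (at (\<gamma> s))"
      proof -
        have A0: "(Arctan has_field_derivative inverse (1 + (\<gamma> s / Y)\<^sup>2)) (at (\<gamma> s / Y))"
          by (rule has_field_derivative_Arctan)
            (use Y(2)[rule_format, of s] Y(1) in \<open>auto simp: Re_divide_of_real Im_divide_of_real\<close>)
        have "((\<lambda>z. z / complex_of_real Y) has_field_derivative 1 / Y) (at (\<gamma> s))"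
          using Y by (auto intro!: derivative_eq_intros)
        from DERIV_chain[where g="\<lambda>z. z / complex_of_real Y", OF A0 this]
        show ?thesis using Y(1) Y(2)[rule_format, of s] by (auto intro!: derivative_eq_intros simp: o_def)
      qed
      have E: "2 * \<i> * (inverse (1 + (\<gamma> s / Y)\<^sup>2) / Y) = 1 / (\<gamma> s - Complex 0 Y) - 1 / (\<gamma> s - Complex 0 (-Y))"
      proof -
        have Cy: "Complex 0 Y = \<i> * Y" "Complex 0 (-Y) = - (\<i> * Y)" by (auto simp: complex_eq_iff)
        have n: "\<gamma> s - \<i> * Y \<noteq> 0" "\<gamma> s + \<i> * Y \<noteq> 0" using ne[of s] unfolding Cy by (auto simp: add_eq_0_iff)
        have f: "(\<gamma> s - \<i> * Y) * (\<gamma> s + \<i> * Y) = (\<gamma> s)\<^sup>2 + Y\<^sup>2" by (simp add: algebra_simps power2_eq_square)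
        then have n': "(\<gamma> s)\<^sup>2 + Y\<^sup>2 \<noteq> 0" using n by (metis mult_eq_0_iff)
        have "1 / (\<gamma> s - \<i> * Y) - 1 / (\<gamma> s + \<i> * Y) = 2 * \<i> * Y / ((\<gamma> s - \<i> * Y) * (\<gamma> s + \<i> * Y))"
          using n by (simp add: field_simps)
        also have "\<dots> = 2 * \<i> * Y / ((\<gamma> s)\<^sup>2 + Y\<^sup>2)" unfolding f ..
        also have "\<dots> = 2 * \<i> * (inverse (1 + (\<gamma> s / Y)\<^sup>2) / Y)"
        proof -
          have "1 + (\<gamma> s / Y)\<^sup>2 = ((\<gamma> s)\<^sup>2 + Y\<^sup>2) / Y\<^sup>2" using Y(1) by (simp add: field_simps)
          then show ?thesis using n' Y(1) by (simp add: power2_eq_square)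
        qed
        finally show ?thesis by (simp add: Cy)
      qed
      have "((\<lambda>x. 2 * \<i> * Arctan (\<gamma> x / Y)) has_vector_derivative
          vector_derivative \<gamma> (at s) * (1 / (\<gamma> s - Complex 0 Y) - 1 / (\<gamma> s - Complex 0 (- Y)))) (at s)"
        using field_vector_diff_chain_at[OF smooth_line_has_vector_derivative[OF \<gamma>] A[unfolded E]]
        by (simp only: o_def)
      moreover have "v * (a - b) = a * v - b * v" for a b v :: complex by (simp add: algebra_simps)
      ultimately show "((\<lambda>x. 2 * \<i> * Arctan (\<gamma> x / Y)) has_vector_derivative
          1 / (\<gamma> s - Complex 0 Y) * vector_derivative \<gamma> (at s) -
          1 / (\<gamma> s - Complex 0 (- Y)) * vector_derivative \<gamma> (at s)) (at s within {-T..T})"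
        by (metis has_vector_derivative_at_within)
    qed (use T in auto)
    finally show ?thesis by (simp add: right_diff_distrib)
  qed
  have Reinf: "filterlim f at_infinity F"
    if "filterlim (\<lambda>s. Re (f s)) at_infinity F" for f :: "real \<Rightarrow> complex" and F
    using that unfolding filterlim_at_infinity_conv_norm_at_top
    by (rule filterlim_at_top_mono) (simp add: abs_Re_le_cmod)
  have lim: "((\<lambda>T. Arctan (\<gamma> T / Y)) \<longlongrightarrow> of_real 1 * pi / 2) at_top"
    "((\<lambda>T. Arctan (\<gamma> T / Y)) \<longlongrightarrow> of_real (-1) * pi / 2) at_bot"
  proof -
    have top: "filterlim (\<lambda>s. Re (\<gamma> s)) at_top at_top" and bot: "filterlim (\<lambda>s. Re (\<gamma> s)) at_bot at_bot"
      using \<gamma> by (auto simp: smooth_line_def)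
    have div: "filterlim (\<lambda>s. \<gamma> s / Y) at_infinity F" if "filterlim \<gamma> at_infinity F" for F
      using tendsto_mult_filterlim_at_infinity[OF tendsto_const _ that, of "1 / complex_of_real Y"] Y by simp
    have p: "eventually (\<lambda>s. 0 < 1 * Re (\<gamma> s / Y)) at_top"
      using filterlim_at_top_dense[THEN iffD1, OF top, rule_format, of 0]
      by eventually_elim (use Y in \<open>simp add: Re_divide_of_real\<close>)
    have n: "eventually (\<lambda>s. 0 < -1 * Re (\<gamma> s / Y)) at_bot"
      using filterlim_at_bot_dense[THEN iffD1, OF bot, rule_format, of 0]
      by eventually_elim (use Y in \<open>simp add: Re_divide_of_real divide_less_0_iff\<close>)
    show "((\<lambda>T. Arctan (\<gamma> T / Y)) \<longlongrightarrow> of_real 1 * pi / 2) at_top"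
      by (rule Arctan_tendsto_half_pi[OF div[OF Reinf[OF filterlim_at_top_imp_at_infinity[OF top]]] p]) auto
    show "((\<lambda>T. Arctan (\<gamma> T / Y)) \<longlongrightarrow> of_real (-1) * pi / 2) at_bot"
      by (rule Arctan_tendsto_half_pi[OF div[OF Reinf[OF filterlim_at_bot_imp_at_infinity[OF bot]]] n]) auto
  qed
  have lim2: "((\<lambda>T. Arctan (\<gamma> (- T) / Y)) \<longlongrightarrow> of_real (-1) * pi / 2) at_top"
    by (rule filterlim_compose[OF lim(2) filterlim_uminus_at_bot_at_top])
  from tendsto_mult[OF tendsto_const tendsto_diff[OF lim(1) lim2], of "2 * \<i>"]
  have "((\<lambda>T. 2 * \<i> * (Arctan (\<gamma> T / Y) - Arctan (\<gamma> (- T) / Y))) \<longlongrightarrow> 2 * pi * \<i>) at_top"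
    by (simp add: mult_ac)
  then show ?thesis
    by (rule Lim_transform_eventually) (auto intro: eventually_mono[OF eventually_ge_at_top[of 0]] simp: eq)
qed

lemma connected_component_image:
  assumes "connected_component S x y" "continuous_on S f" "f ` S \<subseteq> T"
  shows "connected_component T (f x) (f y)"
proof -
  obtain C where C: "connected C" "C \<subseteq> S" "x \<in> C" "y \<in> C"
    using assms(1) by (auto simp: connected_component_def)
  show ?thesis unfolding connected_component_def
    using C assms by (intro exI[of _ "f ` C"]) (auto intro!: connected_continuous_image intro: continuous_on_subset)
qed

lemma above_uminus: "above (uminus ` A) = uminus ` below A"
proof -
  have *: "connected_component (- uminus ` A) (- z) (Complex 0 (- y)) \<longleftrightarrow> connected_component (- A) z (Complex 0 y)" for z :: complex and y and A
  proof
    assume "connected_component (- A) z (Complex 0 y)"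
    then have "connected_component (- uminus ` A) (- z) (- Complex 0 y)"
      by (rule connected_component_image) (auto simp: continuous_on_minus)
    then show "connected_component (- uminus ` A) (- z) (Complex 0 (- y))"
      by (simp add: Complex_eq)
  next
    assume "connected_component (- uminus ` A) (- z) (Complex 0 (- y))"
    then have "connected_component (- A) (- (- z)) (- Complex 0 (- y))"
      by (rule connected_component_image) (auto simp: continuous_on_minus, metis image_eqI minus_minus)
    then show "connected_component (- A) z (Complex 0 y)"
      by (simp add: Complex_eq)
  qed
  have "z \<in> above (uminus ` A) \<longleftrightarrow> - z \<in> below A" for z
    unfolding above_def below_def mem_Collect_eq
    using *[of A "- z"] by (metis le_minus_iff minus_minus minus_le_iff)
  then show ?thesis by (force simp: image_iff)
qed

lemma below_uminus: "below (uminus ` A) = uminus ` above A"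
  using above_uminus[of "uminus ` A"] by (simp add: image_image)

lemma above_translate: "z \<in> above A \<Longrightarrow> z + \<i> * of_real t \<in> above ((\<lambda>z. z + \<i> * of_real t) ` A)"
proof -
  assume "z \<in> above A"
  then obtain Y where Y: "\<And>y. y \<ge> Y \<Longrightarrow> connected_component (- A) z (Complex 0 y)" by (auto simp: above_def)
  have "connected_component (- (\<lambda>z. z + \<i> * of_real t) ` A) (z + \<i> * of_real t) (Complex 0 y)" if y: "y \<ge> Y + t" for y
  proof -
    have "connected_component (- A) z (Complex 0 (y - t))" using y by (intro Y) auto
    then have "connected_component (- (\<lambda>z. z + \<i> * of_real t) ` A) (z + \<i> * of_real t) (Complex 0 (y - t) + \<i> * of_real t)"
      by (rule connected_component_image) (auto intro!: continuous_intros)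
    then show ?thesis by (simp add: Complex_eq right_diff_distrib)
  qed
  then show ?thesis unfolding above_def by blast
qed

lemma below_translate: "z \<in> below A \<Longrightarrow> z + \<i> * of_real t \<in> below ((\<lambda>z. z + \<i> * of_real t) ` A)"
proof -
  assume "z \<in> below A"
  then have "- z \<in> above (uminus ` A)" by (simp add: above_uminus)
  from above_translate[OF this, of "- t"]
  have "- (z + \<i> * of_real t) \<in> above (uminus ` (\<lambda>z. z + \<i> * of_real t) ` A)"
    by (simp add: image_image)
  then show ?thesis by (simp only: above_uminus inj_image_mem_iff[OF inj_uminus])
qed

text \<open>A line meets the imaginary axis in a bounded set, so the end of that axis beyond height \<open>Y0\<close> lies in
one component of the complement.\<close>

lemma above_eq_component:
  assumes "smooth_line \<gamma>"
  shows "\<exists>Y0>0. \<forall>Y\<ge>Y0. (\<forall>s. Re (\<gamma> s) = 0 \<longrightarrow> \<bar>Im (\<gamma> s)\<bar> < Y) \<and>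
     above (range \<gamma>) = connected_component_set (- range \<gamma>) (Complex 0 Y) \<and>
     below (range \<gamma>) = connected_component_set (- range \<gamma>) (Complex 0 (- Y))"
proof -
  obtain Y0 where Y0: "Y0 > 0" "\<And>s. Re (\<gamma> s) = 0 \<Longrightarrow> \<bar>Im (\<gamma> s)\<bar> < Y0"
    using smooth_line_imaginary_axis_bounded[OF assms] by blast
  have up: "connected_component (- range \<gamma>) (Complex 0 y) (Complex 0 y')" if "y \<ge> Y0" "y' \<ge> Y0" for y y'
    unfolding connected_component_def
  proof (intro exI conjI)
    show "connected (Complex 0 ` {Y0..})"
      by (intro connected_continuous_image) (auto simp: Complex_eq intro!: continuous_intros)
    show "Complex 0 ` {Y0..} \<subseteq> - range \<gamma>"
      using Y0 by (force dest: Y0(2) simp: complex_eq_iff)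
  qed (use that in auto)
  have dn: "connected_component (- range \<gamma>) (Complex 0 y) (Complex 0 y')" if "y \<le> - Y0" "y' \<le> - Y0" for y y'
    unfolding connected_component_def
  proof (intro exI conjI)
    show "connected (Complex 0 ` {..- Y0})"
      by (intro connected_continuous_image) (auto simp: Complex_eq intro!: continuous_intros)
    show "Complex 0 ` {..- Y0} \<subseteq> - range \<gamma>"
      using Y0 by (force dest: Y0(2) simp: complex_eq_iff)
  qed (use that in auto)
  have "above (range \<gamma>) = connected_component_set (- range \<gamma>) (Complex 0 Y)" if "Y \<ge> Y0" for Y
  proof (rule set_eqI, unfold above_def mem_Collect_eq, rule iffI)
    fix z assume "\<exists>Y. \<forall>y\<ge>Y. connected_component (- range \<gamma>) z (Complex 0 y)"
    then obtain Y1 where "\<forall>y\<ge>Y1. connected_component (- range \<gamma>) z (Complex 0 y)" by blast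
    then have "connected_component (- range \<gamma>) z (Complex 0 (max Y1 Y0))" by simp
    from connected_component_trans[OF this up[of "max Y1 Y0" Y]]
    show "connected_component (- range \<gamma>) (Complex 0 Y) z"
      using that by (simp add: connected_component_sym)
  next
    fix z assume "connected_component (- range \<gamma>) (Complex 0 Y) z"
    then have "connected_component (- range \<gamma>) z (Complex 0 y)" if "y \<ge> Y0" for y
      using up[of y Y] that \<open>Y \<ge> Y0\<close> by (meson connected_component_sym connected_component_trans)
    then show "\<exists>Y. \<forall>y\<ge>Y. connected_component (- range \<gamma>) z (Complex 0 y)" by blast
  qed
  moreover have "below (range \<gamma>) = connected_component_set (- range \<gamma>) (Complex 0 (- Y))" if "Y \<ge> Y0" for Y
  proof (rule set_eqI, unfold below_def mem_Collect_eq, rule iffI)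
    fix z assume "\<exists>Y. \<forall>y\<le>Y. connected_component (- range \<gamma>) z (Complex 0 y)"
    then obtain Y1 where "\<forall>y\<le>Y1. connected_component (- range \<gamma>) z (Complex 0 y)" by blast
    then have "connected_component (- range \<gamma>) z (Complex 0 (min Y1 (- Y0)))" by simp
    from connected_component_trans[OF this dn[of "min Y1 (- Y0)" "- Y"]]
    show "connected_component (- range \<gamma>) (Complex 0 (- Y)) z"
      using that by (simp add: connected_component_sym)
  next
    fix z assume "connected_component (- range \<gamma>) (Complex 0 (- Y)) z"
    then have "connected_component (- range \<gamma>) z (Complex 0 y)" if "y \<le> - Y0" for y
      using dn[of y "- Y"] that \<open>Y \<ge> Y0\<close> by (meson connected_component_sym connected_component_trans le_imp_neg_le)
    then show "\<exists>Y. \<forall>y\<le>Y. connected_component (- range \<gamma>) z (Complex 0 y)" by blast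
  qed
  ultimately show ?thesis using Y0 by (meson less_le_trans)
qed

lemma cauchy_arc_tendsto_across:
  assumes \<gamma>: "smooth_line \<gamma>" and w: "w1 \<in> above (range \<gamma>)" "w2 \<in> below (range \<gamma>)"
  shows "((\<lambda>T. cauchy_arc \<gamma> w1 T - cauchy_arc \<gamma> w2 T) \<longlongrightarrow> 2 * pi * \<i>) at_top"
proof -
  obtain Y where Y: "Y > 0" "\<forall>s. Re (\<gamma> s) = 0 \<longrightarrow> \<bar>Im (\<gamma> s)\<bar> < Y"
     "above (range \<gamma>) = connected_component_set (- range \<gamma>) (Complex 0 Y)"
     "below (range \<gamma>) = connected_component_set (- range \<gamma>) (Complex 0 (- Y))"
    using above_eq_component[OF \<gamma>] by blast
  have c: "((\<lambda>T. cauchy_arc \<gamma> b T - cauchy_arc \<gamma> a T) \<longlongrightarrow> 0) at_top"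
    if "connected_component (- range \<gamma>) a b" for a b
  proof (rule cauchy_arc_tendsto_connected[OF \<gamma>, of "connected_component_set (- range \<gamma>) a"])
    show "connected_component_set (- range \<gamma>) a \<inter> range \<gamma> = {}"
      using connected_component_subset by blast
    show "a \<in> connected_component_set (- range \<gamma>) a"
      using connected_component_in(1)[OF that] by simp
  qed (use that in auto)
  have 1: "connected_component (- range \<gamma>) (Complex 0 Y) w1" "connected_component (- range \<gamma>) w2 (Complex 0 (- Y))"
    using w unfolding Y(3,4) by (auto simp: connected_component_sym)
  have "((\<lambda>T. (cauchy_arc \<gamma> w1 T - cauchy_arc \<gamma> (Complex 0 Y) T)
     + (cauchy_arc \<gamma> (Complex 0 Y) T - cauchy_arc \<gamma> (Complex 0 (- Y)) T)
     + (cauchy_arc \<gamma> (Complex 0 (- Y)) T - cauchy_arc \<gamma> w2 T)) \<longlongrightarrow> 0 + 2 * pi * \<i> + 0) at_top"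
    by (intro tendsto_add c 1 cauchy_arc_tendsto_axis[OF \<gamma>] Y)
  then show ?thesis by simp
qed

text \<open>The separation theorem for lines, obtained without the Jordan curve theorem: a point on both sides
would give the limit \<open>2\<pi>i\<close> to the constant function \<open>0\<close>.\<close>

lemma above_below_disjoint:
  assumes "smooth_line \<gamma>"
  shows "above (range \<gamma>) \<inter> below (range \<gamma>) = {}"
proof (rule ccontr)
  assume "\<not> ?thesis"
  then obtain w where "w \<in> above (range \<gamma>)" "w \<in> below (range \<gamma>)" by blast
  from cauchy_arc_tendsto_across[OF assms this]
  have "((\<lambda>T::real. 0::complex) \<longlongrightarrow> 2 * pi * \<i>) at_top" by simp
  then show False by (simp add: tendsto_const_iff)
qed

lemma above_below_range_disjoint:
  shows "above A \<inter> A = {}" "below A \<inter> A = {}"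
  by (auto simp: above_def below_def dest!: connected_component_in)

lemma above_subset:
  assumes "connected C" "C \<inter> A = {}" "C \<inter> above A \<noteq> {}"
  shows "C \<subseteq> above A"
proof
  fix z assume z: "z \<in> C"
  obtain w Y where w: "w \<in> C" "\<forall>y\<ge>Y. connected_component (- A) w (Complex 0 y)"
    using assms(3) by (auto simp: above_def)
  have "connected_component (- A) z w"
    using assms z w unfolding connected_component_def by blast
  then show "z \<in> above A" using w unfolding above_def
    by (auto intro: connected_component_trans)
qed

lemma below_subset:
  assumes "connected C" "C \<inter> A = {}" "C \<inter> below A \<noteq> {}"
  shows "C \<subseteq> below A"
proof -
  have "uminus ` C \<subseteq> above (uminus ` A)"
    by (rule above_subset)
      (use assms in \<open>auto simp: above_uminus connected_continuous_image continuous_on_minus\<close>)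
  then show ?thesis by (auto simp: above_uminus)
qed

lemma above_connected_open:
  assumes "smooth_line \<gamma>"
  shows "connected (above (range \<gamma>))" "open (above (range \<gamma>))" 
     "connected (below (range \<gamma>))" "open (below (range \<gamma>))"
proof -
  have "open (- range \<gamma>)" using closed_range_smooth_line[OF assms] by auto
  then show "connected (above (range \<gamma>))" "open (above (range \<gamma>))" 
     "connected (below (range \<gamma>))" "open (below (range \<gamma>))"
    using above_eq_component[OF assms] by (auto simp: connected_connected_component open_connected_component)
qed

lemma LHP_uminus: "LHP (\<lambda>s. - \<gamma> (- s)) = uminus ` UHP \<gamma>" "UHP (\<lambda>s. - \<gamma> (- s)) = uminus ` LHP \<gamma>"
  and range_uminus: "range (\<lambda>s. - \<gamma> (- s)) = uminus ` range \<gamma>"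
proof -
  show r: "range (\<lambda>s. - \<gamma> (- s)) = uminus ` range \<gamma>"
  proof -
    have "range (\<lambda>s. - \<gamma> (- s)) = (\<lambda>s. - \<gamma> s) ` range uminus" unfolding image_image ..
    also have "range (uminus :: real \<Rightarrow> real) = UNIV" by (metis surj_def minus_minus)
    finally show ?thesis by (simp add: image_image)
  qed
  show "LHP (\<lambda>s. - \<gamma> (- s)) = uminus ` UHP \<gamma>" "UHP (\<lambda>s. - \<gamma> (- s)) = uminus ` LHP \<gamma>"
    unfolding LHP_def UHP_def r above_uminus below_uminus by (auto simp: image_Un)
qed

section \<open>Branch cuts\<close>

text \<open>The cut of \<open>log_sw\<close>, including the branch point: the ray from \<open>0\<close> down and to the left.\<close>

definition sw_cut :: "complex set" where
  "sw_cut = {z. exp (- \<i> * pi / 4) * z \<in> \<real>\<^sub>\<le>\<^sub>0}"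

lemma dn_cut_iff: "z \<in> dn_cut \<longleftrightarrow> - \<i> * z \<in> \<real>\<^sub>\<le>\<^sub>0"
proof -
  have "z \<in> dn_cut \<longleftrightarrow> Re z = 0 \<and> Im z \<le> 0"
  proof
    assume "Re z = 0 \<and> Im z \<le> 0"
    then have "z = - \<i> * of_real (- Im z) \<and> - Im z \<ge> 0" by (simp add: complex_eq_iff)
    then show "z \<in> dn_cut" unfolding dn_cut_def by blast
  qed (auto simp: dn_cut_def)
  then show ?thesis by (auto simp: complex_nonpos_Reals_iff)
qed

lemma dn_cut_Re_Im: "z \<in> dn_cut \<longleftrightarrow> Re z = 0 \<and> Im z \<le> 0"
  by (auto simp: dn_cut_iff complex_nonpos_Reals_iff)

lemma closed_dn_cut: "closed dn_cut"
proof -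
  have "dn_cut = {z. Re z = 0} \<inter> {z. Im z \<le> 0}" by (auto simp: dn_cut_Re_Im)
  show ?thesis unfolding \<open>dn_cut = _\<close> by (intro closed_Int closed_Collect_eq closed_Collect_le continuous_intros)
qed

lemma sqrt_dn_square: "(sqrt_dn z)\<^sup>2 = z"
proof -
  have "(exp (\<i> * pi / 4))\<^sup>2 = exp (\<i> * pi / 2)"
    by (simp add: exp_double[symmetric] mult.commute)
  then have "(exp (\<i> * pi / 4))\<^sup>2 = \<i>" by (simp add: exp_eq_polar cis_pi_half mult.commute[of \<i>] flip: cis_conv_exp)
  then show ?thesis by (simp add: sqrt_dn_def power_mult_distrib)
qed

lemma sqrt_dn_eq_0: "sqrt_dn z = 0 \<longleftrightarrow> z = 0"
  by (simp add: sqrt_dn_def)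

lemma sqrt_dn_holomorphic: "sqrt_dn holomorphic_on - dn_cut"
  unfolding sqrt_dn_def[abs_def] by (intro holomorphic_intros) (auto simp: dn_cut_iff)

lemma holomorphic_on_sqrt_dn:
  assumes "f holomorphic_on S" "\<And>z. z \<in> S \<Longrightarrow> f z \<notin> dn_cut"
  shows "(\<lambda>z. sqrt_dn (f z)) holomorphic_on S"
  using holomorphic_on_compose_gen[OF assms(1) sqrt_dn_holomorphic] assms(2) by (auto simp: o_def)

lemma exp_pi_4: "exp (\<i> * pi / 4) = (1 + \<i>) / sqrt 2" "exp (- \<i> * pi / 4) = (1 - \<i>) / sqrt 2"
proof -
  have "exp (\<i> * of_real (pi / 4)) = (1 + \<i>) / sqrt 2" "exp (\<i> * of_real (- pi / 4)) = (1 - \<i>) / sqrt 2"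
    unfolding cis_conv_exp[symmetric]
    by (simp_all add: complex_eq_iff cos_45 sin_45 Re_divide_of_real Im_divide_of_real field_simps)
  then show "exp (\<i> * pi / 4) = (1 + \<i>) / sqrt 2" "exp (- \<i> * pi / 4) = (1 - \<i>) / sqrt 2" by simp_all
qed

text \<open>The values of \<open>sqrt_dn\<close> have arguments between \<open>- \<pi>/4\<close> and \<open>3\<pi>/4\<close>, so that iterated roots such as
\<open>sqrt_dn (sqrt_dn w)\<close> only have the cut of the inner root.\<close>

lemma sqrt_dn_notin_dn_cut:
  assumes "z \<noteq> 0"
  shows "sqrt_dn z \<notin> dn_cut"
proof
  let ?c = "csqrt (- \<i> * z)"
  assume "sqrt_dn z \<in> dn_cut"
  then have "Re ((1 + \<i>) / sqrt 2 * ?c) = 0" "Im ((1 + \<i>) / sqrt 2 * ?c) \<le> 0"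
    by (auto simp: dn_cut_Re_Im sqrt_dn_def exp_pi_4)
  then have "Re ?c = Im ?c" "Re ?c + Im ?c \<le> 0"
    by (simp_all add: Re_divide_of_real Im_divide_of_real divide_le_0_iff del: csqrt.sel)
  moreover have "Re ?c \<ge> 0" by (rule Re_csqrt)
  ultimately have "?c = 0" by (simp add: complex_eq_iff del: csqrt.sel)
  then show False using assms by simp
qed

lemma kappa_square: "(kappa KK z)\<^sup>2 = KK\<^sup>2 - z\<^sup>2"
  unfolding kappa_def power_mult_distrib sqrt_dn_square by (simp add: power2_eq_square algebra_simps)

lemma kappa_uminus: "kappa KK (- z) = kappa KK z"
  by (simp add: kappa_def mult.commute)

lemma kappa_cuts_uminus: "- z \<in> kappa_cuts KK \<longleftrightarrow> z \<in> kappa_cuts KK"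
  by (auto simp: kappa_cuts_def)

lemma kappa_holomorphic: "kappa KK holomorphic_on - kappa_cuts KK"
  unfolding kappa_def[abs_def]
  by (intro holomorphic_intros holomorphic_on_sqrt_dn) (auto simp: kappa_cuts_def)

lemma kappa_ne_0: "z \<notin> kappa_cuts KK \<Longrightarrow> kappa KK z \<noteq> 0"
  by (auto simp: kappa_def kappa_cuts_def sqrt_dn_eq_0 dn_cut_iff)

lemma closed_kappa_cuts: "closed (kappa_cuts KK)"
proof -
  have "kappa_cuts KK = (\<lambda>z. KK - z) -` dn_cut \<union> (\<lambda>z. KK + z) -` dn_cut"
    by (auto simp: kappa_cuts_def)
  then show ?thesis
    by (auto intro!: closed_Un continuous_closed_vimage closed_dn_cut continuous_intros)
qed

lemma kappa_cuts_Re: "z \<in> kappa_cuts (complex_of_real k) \<Longrightarrow> \<bar>Re z\<bar> = \<bar>k\<bar>"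
  by (auto simp: kappa_cuts_def dn_cut_Re_Im)

lemma norm_kappa_ge:
  assumes "norm z \<ge> 2 * \<bar>k\<bar>"
  shows "norm (kappa (complex_of_real k) z) \<ge> norm z / 2"
proof -
  have "(norm z)\<^sup>2 \<ge> (2 * \<bar>k\<bar>)\<^sup>2" using assms by (intro power_mono) auto
  then have "(norm z)\<^sup>2 \<ge> 4 * k\<^sup>2" by simp
  moreover have "(norm z)\<^sup>2 \<le> norm (k\<^sup>2 - z\<^sup>2) + k\<^sup>2"
    using norm_triangle_ineq2[of "z\<^sup>2" "complex_of_real (k\<^sup>2)"] by (simp add: norm_power norm_minus_commute)
  ultimately have "(norm z)\<^sup>2 \<le> 4 * norm (k\<^sup>2 - z\<^sup>2)"
    using zero_le_power2[of "norm z"] by linarith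
  then have "(norm z / 2)\<^sup>2 \<le> norm (k\<^sup>2 - z\<^sup>2)" by (simp add: power_divide)
  also have "\<dots> = (norm (kappa k z))\<^sup>2" by (simp add: kappa_square norm_power[symmetric])
  finally show ?thesis by (rule power2_le_imp_le) simp
qed

lemma sw_cut_0: "0 \<in> sw_cut" by (simp add: sw_cut_def)

lemma closed_sw_cut: "closed sw_cut"
proof -
  have "sw_cut = (\<lambda>z. exp (- \<i> * pi / 4) * z) -` \<real>\<^sub>\<le>\<^sub>0" by (auto simp: sw_cut_def)
  show ?thesis unfolding \<open>sw_cut = _\<close>
    by (rule continuous_closed_vimage[OF closed_nonpos_Reals_complex]) (auto intro!: continuous_intros)
qed

lemma sw_cut_Re_nonpos: "z \<in> sw_cut \<Longrightarrow> Re z \<le> 0"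
proof -
  assume "z \<in> sw_cut"
  then have "Re ((1 - \<i>) / sqrt 2 * z) \<le> 0" "Im ((1 - \<i>) / sqrt 2 * z) = 0"
    unfolding sw_cut_def exp_pi_4 by (auto simp: complex_nonpos_Reals_iff)
  then show ?thesis by (simp add: Re_divide_of_real Im_divide_of_real divide_le_0_iff)
qed

lemma exp_log_sw: "z \<noteq> 0 \<Longrightarrow> exp (log_sw z) = z"
  by (simp add: log_sw_def exp_add exp_minus)

lemma log_sw_1: "log_sw 1 = 0"
proof -
  have "- (pi / 4) \<le> pi" using pi_gt_zero by linarith
  then have "Ln (exp (- \<i> * pi / 4)) = - \<i> * pi / 4" by (intro Ln_exp) auto
  then show ?thesis by (simp add: log_sw_def)
qed

lemma log_sw_has_field_derivative:
  assumes "z \<notin> sw_cut"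
  shows "(log_sw has_field_derivative 1 / z) (at z within S)"
proof -
  have "z \<noteq> 0" using assms sw_cut_0 by auto
  moreover have "exp (- \<i> * pi / 4) * z \<notin> \<real>\<^sub>\<le>\<^sub>0" using assms by (simp add: sw_cut_def)
  ultimately show ?thesis unfolding log_sw_def[abs_def]
    by (auto intro!: derivative_eq_intros simp: field_simps)
qed

lemma log_sw_holomorphic: "log_sw holomorphic_on - sw_cut"
  unfolding holomorphic_on_def field_differentiable_def using log_sw_has_field_derivative by blast

lemma Im_log_sw_le: "z \<noteq> 0 \<Longrightarrow> Im (log_sw z) \<le> pi + pi / 4"
  by (simp add: log_sw_def Im_Ln_le_pi)

lemma Im_log_sw_cut: "z \<in> sw_cut \<Longrightarrow> z \<noteq> 0 \<Longrightarrow> Im (log_sw z) = pi + pi / 4"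
proof -
  assume z: "z \<in> sw_cut" "z \<noteq> 0"
  define w where "w = exp (- \<i> * pi / 4) * z"
  have "w \<noteq> 0" "Re w \<le> 0" "Im w = 0" using z by (auto simp: sw_cut_def w_def complex_nonpos_Reals_iff)
  then have "Im (Ln w) = pi" by (auto simp: Im_Ln_eq_pi complex_eq_iff less_le)
  then show ?thesis by (simp add: log_sw_def w_def)
qed

lemma log_p_uminus: "log_p k \<beta> (- z) = log_p k \<beta> z"
  by (simp add: log_p_def kappa_uminus)

section \<open>Points of analyticity of the logarithm\<close>

text \<open>The imaginary part has opposite signs on the two sides of the negative axis, whereas a limit \<open>L\<close>
would satisfy \<open>L\<^sup>2 = - t\<close>.\<close>

lemma csqrt_no_limit:
  assumes t: "t > 0"
  shows "\<not> ((\<lambda>\<delta>. csqrt (Complex (- t) \<delta>)) \<longlongrightarrow> L) (at (0::real))"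
proof
  assume L: "((\<lambda>\<delta>. csqrt (Complex (- t) \<delta>)) \<longlongrightarrow> L) (at 0)"
  have right: "((\<lambda>\<delta>. Im (csqrt (Complex (- t) \<delta>))) \<longlongrightarrow> Im L) (at_right 0)"
   and left: "((\<lambda>\<delta>. Im (csqrt (Complex (- t) \<delta>))) \<longlongrightarrow> Im L) (at_left 0)"
    using tendsto_Im[OF L] by (simp_all add: filterlim_at_split)
  have "Im L \<ge> 0"
    by (rule tendsto_lowerbound[OF right])
      (auto simp: eventually_at_filter intro!: always_eventually mult_nonneg_nonneg add_nonneg_nonneg order_less_imp_le[OF t])
  moreover have "Im L \<le> 0"
    by (rule tendsto_upperbound[OF left])
      (auto simp: eventually_at_filter intro!: always_eventually mult_nonpos_nonneg add_nonneg_nonneg order_less_imp_le[OF t])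
  moreover have "L\<^sup>2 = - t"
  proof (rule tendsto_unique[OF _ tendsto_power[OF L]])
    have "((\<lambda>\<delta>. Complex (- t) \<delta>) \<longlongrightarrow> Complex (-t) 0) (at 0)"
      unfolding Complex_eq by (intro tendsto_intros)
    then show "((\<lambda>\<delta>. (csqrt (Complex (- t) \<delta>))\<^sup>2) \<longlongrightarrow> complex_of_real (- t)) (at 0)"
      by (simp add: complex_of_real_def)
  qed auto
  then have "(Re L)\<^sup>2 - (Im L)\<^sup>2 = - t" by (metis Re_power2 Re_complex_of_real)
  ultimately show False using t by (simp add: power2_eq_square) (smt (verit) mult_nonneg_nonneg zero_le_square)
qed

lemma isCont_holomorphic: "f holomorphic_on S \<Longrightarrow> open S \<Longrightarrow> z \<in> S \<Longrightarrow> isCont f z"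
  by (meson continuous_on_eq_continuous_at holomorphic_on_imp_continuous_on)

text \<open>A limit of \<open>kappa\<close> at a point of the upper cut would, after division by the factor that is continuous
there, be a limit of \<open>csqrt\<close> along a horizontal line crossing its cut.\<close>

lemma kappa_limit_imp_off_cut:
  assumes k: "k > 0" and L: "(kappa (complex_of_real k) \<longlongrightarrow> L) (at z0)" and z0: "z0 \<noteq> of_real k"
  shows "of_real k - z0 \<notin> dn_cut"
proof
  assume cut: "of_real k - z0 \<in> dn_cut"
  define t where "t = Im z0"
  have rz: "Re z0 = k" "t \<ge> 0" using cut by (auto simp: dn_cut_Re_Im t_def)
  have t: "t > 0" using rz z0 by (auto simp: t_def complex_eq_iff less_le)
  have ncut: "of_real k + z0 \<notin> dn_cut" using rz k by (auto simp: dn_cut_Re_Im)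
  then have nz: "sqrt_dn (of_real k + z0) \<noteq> 0" by (auto simp: sqrt_dn_eq_0 dn_cut_iff)
  have line: "filterlim (\<lambda>\<delta>. z0 + complex_of_real \<delta>) (at z0) (at 0)"
    by (rule filterlim_atI) (auto intro!: tendsto_eq_intros simp: eventually_at_filter)
  have c: "((\<lambda>z. sqrt_dn (of_real k + z)) \<longlongrightarrow> sqrt_dn (of_real k + z0)) (at z0)"
  proof -
    have c1: "isCont sqrt_dn (of_real k + z0)"
      by (rule isCont_holomorphic[OF sqrt_dn_holomorphic]) (use ncut closed_dn_cut in auto)
    have "isCont (\<lambda>z. sqrt_dn (of_real k + z)) z0"
      by (rule isCont_o2[where g = sqrt_dn and f = "(+) (of_real k)", OF _ c1]) (intro continuous_intros)
    then show ?thesis by (simp add: isCont_def)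
  qed
  have "((\<lambda>z. kappa k z / sqrt_dn (of_real k + z) / exp (\<i> * pi / 4)) \<longlongrightarrow>
     L / sqrt_dn (of_real k + z0) / exp (\<i> * pi / 4)) (at z0)"
    by (intro tendsto_intros L c nz) auto
  from filterlim_compose[OF this line]
  have "((\<lambda>\<delta>. csqrt (Complex (- t) \<delta>)) \<longlongrightarrow> L / sqrt_dn (of_real k + z0) / exp (\<i> * pi / 4)) (at 0)"
  proof (rule Lim_transform_eventually)
    have "kappa k (z0 + of_real \<delta>) / sqrt_dn (of_real k + (z0 + of_real \<delta>)) / exp (\<i> * pi / 4) = csqrt (Complex (- t) \<delta>)" if "\<delta> > -k" for \<delta>
    proof -
      have "sqrt_dn (of_real k + (z0 + of_real \<delta>)) \<noteq> 0"
        unfolding sqrt_dn_eq_0 using rz k that by (auto simp: complex_eq_iff)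
      moreover have "- \<i> * (of_real k - (z0 + of_real \<delta>)) = Complex (- t) \<delta>"
        using rz by (simp add: complex_eq_iff t_def)
      ultimately show ?thesis unfolding kappa_def sqrt_dn_def[of "of_real k - (z0 + of_real \<delta>)"] by simp
    qed
    moreover have "eventually (\<lambda>\<delta>. \<delta> > - k) (at (0::real))"
      using k by (intro order_tendstoD(1)[OF tendsto_ident_at]) auto
    ultimately show "eventually (\<lambda>\<delta>. kappa k (z0 + of_real \<delta>) / sqrt_dn (of_real k + (z0 + of_real \<delta>)) / exp (\<i> * pi / 4) = csqrt (Complex (- t) \<delta>)) (at 0)"
      by (auto elim: eventually_mono)
  qed
  with csqrt_no_limit[OF t] show False by blast
qed

lemma finite_square_eq: "finite {z::complex. z\<^sup>2 = c}"
proof (rule finite_subset)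
  show "{z. z\<^sup>2 = c} \<subseteq> {csqrt c, - csqrt c}"
  proof
    fix z assume "z \<in> {z. z\<^sup>2 = c}"
    then have "z\<^sup>2 = (csqrt c)\<^sup>2" by simp
    then show "z \<in> {csqrt c, - csqrt c}" unfolding power2_eq_iff by auto
  qed
qed auto

lemma eventually_at_notin_finite: "finite E \<Longrightarrow> eventually (\<lambda>z. z \<notin> E) (at (z0::complex))"
proof -
  assume "finite E"
  then have "open (- (E - {z0}))" by (intro open_Compl finite_imp_closed) auto
  then show ?thesis unfolding eventually_at_topological by (intro exI[of _ "- (E - {z0})"]) auto
qed

text \<open>Off a finite set, \<open>exp f = 1 + \<beta> / \<kappa>\<close> determines \<open>\<kappa> = \<beta> / (exp f - 1)\<close>, so analyticity of \<open>f\<close> forces \<open>\<kappa>\<close> to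
have a limit and rules out its cuts. If \<open>1 + \<beta> / \<kappa>\<close> were on the cut of the logarithm, \<open>Im f\<close> would
attain there its largest possible value \<open>\<pi> + \<pi>/4\<close>, against the open mapping theorem unless \<open>f\<close>, and hence
\<open>\<kappa>\<^sup>2 = k\<^sup>2 - z\<^sup>2\<close>, were locally constant. For \<open>\<beta> = 0\<close> the function vanishes identically and nothing can be
inferred.\<close>

lemma log_p_analytic_imp_off_cuts:
  assumes k: "k > 0" and \<beta>: "\<beta> \<noteq> 0" and an: "log_p k \<beta> analytic_on {z0}"
  shows "z0 \<notin> kappa_cuts (complex_of_real k)" "1 + \<beta> / kappa (complex_of_real k) z0 \<notin> sw_cut"
proof -
  let ?\<kappa> = "kappa (complex_of_real k)"
  define f where "f = log_p k \<beta>"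
  \<comment> \<open>\<open>E\<close> collects the points where \<open>\<kappa> = \<plusminus>\<beta>\<close> or \<open>\<kappa> = 0\<close>. There the argument of the logarithm may vanish or involve
    a division by zero, and \<open>exp f\<close> carries no information.\<close>
  define E where "E = {z. z\<^sup>2 = k\<^sup>2 - \<beta>\<^sup>2} \<union> {of_real k, - of_real k}"
  have E: "eventually (\<lambda>z. z \<notin> E) (at z0)"
    by (rule eventually_at_notin_finite) (auto simp: E_def finite_square_eq)
  obtain r where r: "r > 0" "f holomorphic_on ball z0 r"
    using an unfolding f_def analytic_on_def by auto
  have fc: "(f \<longlongrightarrow> f z0) (at z0)"
    using isCont_holomorphic[OF r(2)] r(1) by (simp add: isCont_def)
  have off: "exp (f z) = 1 + \<beta> / ?\<kappa> z \<and> ?\<kappa> z \<noteq> 0" if "z \<notin> E" for z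
  proof -
    have "(?\<kappa> z)\<^sup>2 \<noteq> 0" "(?\<kappa> z)\<^sup>2 \<noteq> \<beta>\<^sup>2"
      using that unfolding kappa_square E_def by (auto simp: power2_eq_iff algebra_simps)
    then have "?\<kappa> z \<noteq> 0" "?\<kappa> z \<noteq> - \<beta>" by auto
    then have "1 + \<beta> / ?\<kappa> z \<noteq> 0" by (auto simp: field_simps add_eq_0_iff)
    then show ?thesis using \<open>?\<kappa> z \<noteq> 0\<close> by (simp add: f_def log_p_def exp_log_sw)
  qed
  \<comment> \<open>Squaring removes the choice of the root, so this identity extends to \<open>z0\<close> by continuity. It excludes
    the branch points.\<close>
  have "(exp (f z0) - 1)\<^sup>2 * (k\<^sup>2 - z0\<^sup>2) = \<beta>\<^sup>2"
  proof (rule tendsto_unique[where F="at z0"])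
    show "((\<lambda>z. (exp (f z) - 1)\<^sup>2 * (k\<^sup>2 - z\<^sup>2)) \<longlongrightarrow> (exp (f z0) - 1)\<^sup>2 * (k\<^sup>2 - z0\<^sup>2)) (at z0)"
      by (intro tendsto_intros fc)
    show "((\<lambda>z. (exp (f z) - 1)\<^sup>2 * (k\<^sup>2 - z\<^sup>2)) \<longlongrightarrow> \<beta>\<^sup>2) (at z0)"
    proof (rule Lim_transform_eventually[OF tendsto_const], use E in eventually_elim)
      case (elim z)
      then show ?case using off[OF elim]
        by (simp add: kappa_square[of "of_real k" z, symmetric] power_divide)
    qed
  qed auto
  then have n1: "exp (f z0) - 1 \<noteq> 0" "z0 \<noteq> of_real k" "- z0 \<noteq> of_real k"
    using \<beta> by (auto simp: minus_equation_iff[of z0])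
  define L where "L = \<beta> / (exp (f z0) - 1)"
  have kL: "(?\<kappa> \<longlongrightarrow> L) (at z0)"
  proof (rule Lim_transform_eventually)
    show "((\<lambda>z. \<beta> / (exp (f z) - 1)) \<longlongrightarrow> L) (at z0)"
      unfolding L_def by (intro tendsto_intros fc n1)
    show "eventually (\<lambda>z. \<beta> / (exp (f z) - 1) = ?\<kappa> z) (at z0)"
      using E by eventually_elim (use off \<beta> in auto)
  qed
  have "(?\<kappa> \<longlongrightarrow> L) (at (- z0))"
  proof -
    have "filterlim uminus (at z0) (at (- z0))"
      by (rule filterlim_atI) (auto intro!: tendsto_eq_intros always_eventually simp: eventually_at_filter minus_equation_iff[of _ z0])
    from filterlim_compose[OF kL this] show ?thesis by (simp add: kappa_uminus)
  qed
  from kappa_limit_imp_off_cut[OF k kL n1(2)] kappa_limit_imp_off_cut[OF k this n1(3)]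
  show nk: "z0 \<notin> kappa_cuts (of_real k)" by (auto simp: kappa_cuts_def)
  have g: "isCont (\<lambda>z. 1 + \<beta> / ?\<kappa> z) z0"
  proof -
    have "isCont ?\<kappa> z0"
      by (rule isCont_holomorphic[OF kappa_holomorphic]) (use nk closed_kappa_cuts in auto)
    then show ?thesis using kappa_ne_0[OF nk] by (intro continuous_intros)
  qed
  have "exp (f z0) = 1 + \<beta> / ?\<kappa> z0"
  proof (rule tendsto_unique[where F="at z0"])
    show "((\<lambda>z. exp (f z)) \<longlongrightarrow> exp (f z0)) (at z0)" by (intro tendsto_intros fc)
    show "((\<lambda>z. exp (f z)) \<longlongrightarrow> 1 + \<beta> / ?\<kappa> z0) (at z0)"
      by (rule Lim_transform_eventually[OF g[unfolded isCont_def]], use E in eventually_elim)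
        (use off in auto)
  qed auto
  then have g0: "1 + \<beta> / ?\<kappa> z0 \<noteq> 0" by (metis exp_not_eq_zero)
  show "1 + \<beta> / ?\<kappa> z0 \<notin> sw_cut"
  proof
    assume cut: "1 + \<beta> / ?\<kappa> z0 \<in> sw_cut"
    have fz0: "Im (f z0) = pi + pi / 4"
      unfolding f_def log_p_def by (rule Im_log_sw_cut[OF cut g0])
    obtain d where d: "d > 0" "\<And>z. z \<in> ball z0 d \<Longrightarrow> z \<noteq> z0 \<Longrightarrow> z \<notin> E"
      using E unfolding eventually_at by (auto simp: dist_commute)
    define \<rho> where "\<rho> = min r d"
    have \<rho>: "\<rho> > 0" "f holomorphic_on ball z0 \<rho>"
      using r d(1) by (auto simp: \<rho>_def elim: holomorphic_on_subset)
    have g_ne: "1 + \<beta> / ?\<kappa> z \<noteq> 0" if "z \<in> ball z0 \<rho>" for z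
    proof (cases "z = z0")
      case False
      then have "exp (f z) = 1 + \<beta> / ?\<kappa> z" using that d(2)[of z] off[of z] by (auto simp: \<rho>_def)
      then show ?thesis by (metis exp_not_eq_zero)
    qed (use g0 in simp)
    have "f constant_on ball z0 \<rho>"
    proof (rule ccontr)
      assume "\<not> f constant_on ball z0 \<rho>"
      from open_mapping_thm[OF \<rho>(2) open_ball connected_ball open_ball order_refl this]
      have "open (f ` ball z0 \<rho>)" .
      moreover have "f z0 \<in> f ` ball z0 \<rho>" using \<rho>(1) by auto
      ultimately obtain e where e: "e > 0" "ball (f z0) e \<subseteq> f ` ball z0 \<rho>"
        by (meson open_contains_ball)
      have "f z0 + \<i> * of_real (e / 2) \<in> ball (f z0) e"
        using e(1) by (simp add: dist_norm norm_mult)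
      then obtain z where z: "z \<in> ball z0 \<rho>" "f z0 + \<i> * of_real (e / 2) = f z" using e(2) by blast
      have "Im (f z) = pi + pi / 4 + e / 2" unfolding z(2)[symmetric] by (simp add: fz0)
      then show False using Im_log_sw_le[OF g_ne[OF z(1)]] e(1) by (simp add: f_def log_p_def)
    qed
    then obtain c where c: "\<And>z. z \<in> ball z0 \<rho> \<Longrightarrow> f z = c" by (auto simp: constant_on_def)
    have "eventually (\<lambda>z. z \<in> ball z0 \<rho>) (at z0)"
      using \<rho>(1) by (intro eventually_at_in_open') auto
    with E have "eventually (\<lambda>z. z\<^sup>2 = k\<^sup>2 - (\<beta> / (exp c - 1))\<^sup>2) (at z0)"
    proof eventually_elim
      case (elim z)
      have "?\<kappa> z = \<beta> / (exp c - 1)" using off[OF elim(1)] c[OF elim(2)] \<beta> by auto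
      then show ?case using kappa_square[of "of_real k" z] by (simp add: algebra_simps)
    qed
    moreover have "eventually (\<lambda>z. z \<notin> {z. z\<^sup>2 = k\<^sup>2 - (\<beta> / (exp c - 1))\<^sup>2}) (at z0)"
      by (intro eventually_at_notin_finite finite_square_eq)
    ultimately have "eventually (\<lambda>z. False) (at z0)" by eventually_elim auto
    then show False by simp
  qed
qed

section \<open>Decay of the logarithm and convergence of its Cauchy integral\<close>

lemma norm_log_sw_le:
  assumes "norm x \<le> 1 / 2"
  shows "1 + x \<notin> sw_cut" "norm (log_sw (1 + x)) \<le> 2 * norm x"
proof -
  have nc: "z \<notin> sw_cut" "norm z \<ge> 1 / 2" if "z \<in> cball 1 (1 / 2)" for z
  proof -
    have "norm (1 - z) \<le> 1 / 2" using that by (simp add: dist_norm)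
    moreover have "1 - Re z \<le> norm (1 - z)" using complex_Re_le_cmod[of "1 - z"] by simp
    moreover have "Re z \<le> norm z" by (rule complex_Re_le_cmod)
    ultimately have "Re z > 0 \<and> norm z \<ge> 1 / 2" by linarith
    then show "z \<notin> sw_cut" "norm z \<ge> 1 / 2" using sw_cut_Re_nonpos[of z] by auto
  qed
  have x: "1 + x \<in> cball 1 (1 / 2)" using assms by (simp add: dist_norm)
  then show "1 + x \<notin> sw_cut" by (rule nc)
  have "norm (log_sw (1 + x) - log_sw 1) \<le> 2 * norm ((1 + x) - 1)"
  proof (rule field_differentiable_bound[OF convex_cball log_sw_has_field_derivative])
    show "norm (1 / z) \<le> 2" if "z \<in> cball 1 (1 / 2)" for z :: complex
      using nc(2)[OF that] by (cases "z = 0") (auto simp: norm_divide divide_le_eq)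
  qed (use nc x in auto)
  then show "norm (log_sw (1 + x)) \<le> 2 * norm x" by (simp add: log_sw_1)
qed

definition off_cuts :: "real \<Rightarrow> complex \<Rightarrow> complex set" where
  "off_cuts k \<beta> = {z. z \<notin> kappa_cuts (of_real k) \<and> 1 + \<beta> / kappa (of_real k) z \<notin> sw_cut}"

lemma open_off_cuts: "open (off_cuts k \<beta>)"
proof -
  have "off_cuts k \<beta> = - kappa_cuts (of_real k) \<inter> (\<lambda>z. 1 + \<beta> / kappa (of_real k) z) -` (- sw_cut)"
    by (auto simp: off_cuts_def)
  moreover have "continuous_on (- kappa_cuts (of_real k)) (\<lambda>z. 1 + \<beta> / kappa (of_real k) z)"
    by (intro continuous_intros holomorphic_on_imp_continuous_on[OF kappa_holomorphic]) (auto simp: kappa_ne_0)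
  ultimately show ?thesis
    by (auto intro!: continuous_open_preimage simp: open_Compl closed_kappa_cuts closed_sw_cut)
qed

lemma log_p_holomorphic: "log_p k \<beta> holomorphic_on off_cuts k \<beta>"
proof -
  have "(\<lambda>z. 1 + \<beta> / kappa (of_real k) z) holomorphic_on off_cuts k \<beta>"
    by (intro holomorphic_intros holomorphic_on_subset[OF kappa_holomorphic]) (auto simp: off_cuts_def kappa_ne_0)
  from holomorphic_on_compose_gen[OF this log_sw_holomorphic]
  show ?thesis unfolding log_p_def[abs_def] by (auto simp: o_def off_cuts_def)
qed

lemma log_p_far:
  assumes k: "k > 0" and z: "norm z \<ge> 2 * k + 4 * norm \<beta>"
  shows "1 + \<beta> / kappa (of_real k) z \<notin> sw_cut" "norm (log_p k \<beta> z) \<le> 4 * norm \<beta> / norm z"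
    "norm (kappa (of_real k) z + \<beta>) \<ge> norm z / 4"
proof -
  have k2: "norm z \<ge> 2 * \<bar>k\<bar>" and z0: "norm z > 0" using k z norm_ge_zero[of \<beta>] by linarith+
  have \<kappa>: "norm (kappa (of_real k) z) \<ge> norm z / 2" by (rule norm_kappa_ge[OF k2])
  have "norm (\<beta> / kappa (of_real k) z) \<le> norm \<beta> / (norm z / 2)"
    unfolding norm_divide using \<kappa> z0 by (intro divide_left_mono mult_pos_pos) auto
  then have 1: "norm (\<beta> / kappa (of_real k) z) \<le> 2 * norm \<beta> / norm z" by (simp add: mult.commute)
  also have "\<dots> \<le> 1 / 2" using z k z0 by (simp add: field_simps)
  finally have h: "norm (\<beta> / kappa (of_real k) z) \<le> 1 / 2" .
  show "1 + \<beta> / kappa (of_real k) z \<notin> sw_cut" by (rule norm_log_sw_le[OF h])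
  show "norm (log_p k \<beta> z) \<le> 4 * norm \<beta> / norm z"
    using norm_log_sw_le(2)[OF h] 1 by (simp add: log_p_def)
  have "norm (kappa (of_real k) z) \<le> norm (kappa (of_real k) z + \<beta>) + norm \<beta>" by norm
  then show "norm (kappa (of_real k) z + \<beta>) \<ge> norm z / 4" using \<kappa> z k by linarith
qed

lemma log_p_tendsto_0:
  assumes k: "k > 0"
  shows "(log_p k \<beta> \<longlongrightarrow> 0) at_infinity"
proof (rule Lim_null_comparison)
  show "eventually (\<lambda>z. norm (log_p k \<beta> z) \<le> 4 * norm \<beta> / norm z) at_infinity"
    unfolding eventually_at_infinity using log_p_far(2)[OF k] by blast
  show "((\<lambda>z::complex. 4 * norm \<beta> / norm z) \<longlongrightarrow> 0) at_infinity"
    by (intro tendsto_divide_0[OF tendsto_const] filterlim_at_top_imp_at_infinity filterlim_norm_at_top)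
qed

lemma norm_diff_ge_half: "norm z \<ge> 2 * norm a \<Longrightarrow> norm (z - a) \<ge> norm z / 2" for z a :: complex
  using norm_triangle_ineq2[of z a] by linarith

lemma log_p_quotient_far:
  assumes k: "k > 0" and z: "norm z \<ge> 2 * k + 4 * norm \<beta> + 2 * norm \<alpha>"
  shows "norm (log_p k \<beta> z / (z - \<alpha>)) \<le> 8 * norm \<beta> / (norm z)\<^sup>2" "z \<noteq> \<alpha>"
proof -
  have z0: "norm z > 0" using k z norm_ge_zero[of \<beta>] norm_ge_zero[of \<alpha>] by linarith
  have 1: "norm (log_p k \<beta> z) \<le> 4 * norm \<beta> / norm z" by (rule log_p_far[OF k]) (use z norm_ge_zero[of \<alpha>] in linarith)
  have 2: "norm (z - \<alpha>) \<ge> norm z / 2" by (rule norm_diff_ge_half) (use z k norm_ge_zero[of \<beta>] in linarith)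
  show "z \<noteq> \<alpha>" using 2 z0 by auto
  have "norm (log_p k \<beta> z / (z - \<alpha>)) \<le> (4 * norm \<beta> / norm z) / (norm z / 2)"
    unfolding norm_divide using 1 2 z0 by (intro frac_le) auto
  then show "norm (log_p k \<beta> z / (z - \<alpha>)) \<le> 8 * norm \<beta> / (norm z)\<^sup>2"
    by (simp add: power2_eq_square)
qed

lemma far_off_cuts:
  assumes "k > 0" and R: "R \<ge> 2 * k + 4 * norm \<beta>"
  shows "{z. R < \<bar>Re z\<bar>} \<subseteq> off_cuts k \<beta>"
proof
  fix z assume "z \<in> {z. R < \<bar>Re z\<bar>}"
  then have z: "R < \<bar>Re z\<bar>" by simp
  then have "norm z \<ge> 2 * k + 4 * norm \<beta>" using R abs_Re_le_cmod[of z] by linarith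
  moreover have "z \<notin> kappa_cuts (of_real k)"
    using kappa_cuts_Re[of z k] z R assms(1) norm_ge_zero[of \<beta>] by force
  ultimately show "z \<in> off_cuts k \<beta>" using log_p_far(1)[OF assms(1)] by (simp add: off_cuts_def)
qed

lemma line_integral_log_p_tendsto:
  assumes k: "k > 0" and \<eta>: "smooth_line \<eta>" "range \<eta> \<subseteq> off_cuts k \<beta>" "\<alpha> \<notin> range \<eta>"
  shows "((\<lambda>T. integral {-T..T} (\<lambda>s. log_p k \<beta> (\<eta> s) / (\<eta> s - \<alpha>) * vector_derivative \<eta> (at s))) \<longlongrightarrow>
            line_integral \<eta> (\<lambda>z. log_p k \<beta> z / (z - \<alpha>))) at_top"
proof -
  define h where "h z = log_p k \<beta> z / (z - \<alpha>)" for z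
  define R where "R = 2 * k + 4 * norm \<beta> + 2 * norm \<alpha>"
  have R: "R > 0" using k by (simp add: R_def add_pos_nonneg)
  have far: "norm (h z) \<le> 8 * norm \<beta> / (Re z)\<^sup>2" "z \<noteq> \<alpha>" if z: "R < \<bar>Re z\<bar>" for z
  proof -
    have nz: "norm z \<ge> 2 * k + 4 * norm \<beta> + 2 * norm \<alpha>" using z abs_Re_le_cmod[of z] unfolding R_def by linarith
    show "z \<noteq> \<alpha>" by (rule log_p_quotient_far[OF k nz])
    have "norm (h z) \<le> 8 * norm \<beta> / (norm z)\<^sup>2"
      unfolding h_def by (rule log_p_quotient_far[OF k nz])
    also have "\<dots> \<le> 8 * norm \<beta> / (Re z)\<^sup>2"
    proof (intro divide_left_mono mult_pos_pos)
      show "(Re z)\<^sup>2 \<le> (norm z)\<^sup>2" by (simp add: cmod_power2)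
      show "(norm z)\<^sup>2 > 0" "(Re z)\<^sup>2 > 0" using z R by auto
    qed auto
    finally show "norm (h z) \<le> 8 * norm \<beta> / (Re z)\<^sup>2" .
  qed
  have hol: "h holomorphic_on off_cuts k \<beta> - {\<alpha>}"
    unfolding h_def by (intro holomorphic_intros holomorphic_on_subset[OF log_p_holomorphic]) auto
  have sub: "{z. R < \<bar>Re z\<bar>} \<subseteq> off_cuts k \<beta> - {\<alpha>}"
    using far_off_cuts[OF k, of \<beta> R] far(2) by (auto simp: R_def)
  obtain T where T: "T > 0" "\<forall>s\<ge>T. Re (\<eta> s) > R" "\<forall>s\<le>-T. Re (\<eta> s) < - R"
    using smooth_line_tails[OF \<eta>(1)] by blast
  have hc: "continuous_on (range \<eta>) h"
    by (rule holomorphic_on_imp_continuous_on[OF holomorphic_on_subset[OF hol]]) (use \<eta> in auto)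
  have "compact ((\<lambda>s. h (\<eta> s)) ` {-T..T})"
    by (intro compact_continuous_image continuous_on_compose2[OF hc] smooth_line_continuous \<eta>) auto
  then obtain B where B: "\<And>s. s \<in> {-T..T} \<Longrightarrow> norm (h (\<eta> s)) \<le> B"
    using compact_imp_bounded bounded_iff by (metis imageI)
  define C where "C = max (8 * norm \<beta>) B"
  have "\<exists>I. ((\<lambda>s. h (\<eta> s) * vector_derivative \<eta> (at s)) has_integral I) UNIV \<and>
      norm I \<le> C * (integral {-T..T} (\<lambda>s. norm (vector_derivative \<eta> (at s))) + 2 / R) \<and>
      ((\<lambda>T. integral {-T..T} (\<lambda>s. h (\<eta> s) * vector_derivative \<eta> (at s))) \<longlongrightarrow> I) at_top"
  proof (rule improper_line_integral[OF \<eta>(1) R _ _ hc _ T])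
    show "C \<ge> 0" by (simp add: C_def max.coboundedI1)
    show "h holomorphic_on {z. R < \<bar>Re z\<bar>}" by (rule holomorphic_on_subset[OF hol sub])
    show "norm (h z) \<le> C / (Re z)\<^sup>2" if "R < \<bar>Re z\<bar>" for z
      by (rule order_trans[OF far(1)[OF that]]) (auto simp: C_def intro!: divide_right_mono)
    show "norm (h (\<eta> s)) \<le> C" if "\<bar>s\<bar> \<le> T" for s
      unfolding C_def by (rule max.coboundedI2, rule B) (use that in auto)
  qed
  then obtain I where I: "((\<lambda>s. h (\<eta> s) * vector_derivative \<eta> (at s)) has_integral I) UNIV"
     "((\<lambda>T. integral {-T..T} (\<lambda>s. h (\<eta> s) * vector_derivative \<eta> (at s))) \<longlongrightarrow> I) at_top" by blast
  then have "line_integral \<eta> (\<lambda>z. log_p k \<beta> z / (z - \<alpha>)) = I"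
    by (simp add: line_integral_def h_def integral_unique)
  then show "((\<lambda>T. integral {-T..T} (\<lambda>s. log_p k \<beta> (\<eta> s) / (\<eta> s - \<alpha>) * vector_derivative \<eta> (at s))) \<longlongrightarrow>
            line_integral \<eta> (\<lambda>z. log_p k \<beta> z / (z - \<alpha>))) at_top"
    using I(2) by (simp add: h_def)
qed

section \<open>The jump of the Cauchy integral\<close>

lemma smooth_line_shift:
  assumes "smooth_line \<gamma>"
  shows "smooth_line (shift_a \<gamma> t)" "smooth_line (shift_b \<gamma> t)"
    "vector_derivative (shift_a \<gamma> t) (at s) = vector_derivative \<gamma> (at s)"
    "vector_derivative (shift_b \<gamma> t) (at s) = vector_derivative \<gamma> (at s)"
  using smooth_line_add[OF assms, of "\<i> * of_real t"] smooth_line_add[OF assms, of "- \<i> * of_real t"]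
  by (simp_all add: shift_a_def shift_b_def)

lemma log_p_0: "log_p k 0 = (\<lambda>z. 0)"
  by (simp add: log_p_def log_sw_1)

lemma line_integral_0: "line_integral \<gamma> (\<lambda>z. 0) = 0"
  by (simp add: line_integral_def)

lemma admissible_shift_off_cuts:
  assumes "k > 0" "\<beta> \<noteq> 0" "admissible_shift \<gamma> (log_p k \<beta>) \<epsilon>" "\<bar>t\<bar> \<le> \<epsilon>"
  shows "\<gamma> s + \<i> * of_real t \<in> off_cuts k \<beta>"
proof -
  have "log_p k \<beta> analytic_on {\<gamma> s + \<i> * of_real t}"
    using assms(3,4) unfolding admissible_shift_def by (blast intro: analytic_on_subset)
  from log_p_analytic_imp_off_cuts[OF assms(1,2) this] show ?thesis by (simp add: off_cuts_def)
qed

text \<open>The quotient \<open>(f(z) - f(\<alpha>)) / (z - \<alpha>)\<close> has a removable singularity, so its integrals over the two shifted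
contours agree. What remains is \<open>f(\<alpha>)\<close> times the integral of \<open>1 / (z - \<alpha>)\<close> over the contour below minus
that over the contour above, which is the same as moving the pole from below to above the original
line. The decomposition is made for finite arcs: the separate integrals of its two parts need not
converge over the whole line.\<close>

lemma line_integral_jump:
  assumes k: "k > 0" and \<gamma>: "smooth_line \<gamma>" and \<alpha>: "\<alpha> \<in> range \<gamma>"
    and adm: "admissible_shift \<gamma> (log_p k \<beta>) \<epsilon>1" "admissible_shift \<gamma> (log_p k \<beta>) \<epsilon>2"
  shows "line_integral (shift_b \<gamma> \<epsilon>1) (\<lambda>z. log_p k \<beta> z / (z - \<alpha>))
       - line_integral (shift_a \<gamma> \<epsilon>2) (\<lambda>z. log_p k \<beta> z / (z - \<alpha>)) = 2 * pi * \<i> * log_p k \<beta> \<alpha>"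
proof (cases "\<beta> = 0")
  case True
  then show ?thesis by (simp add: log_p_0 line_integral_0)
next
  case \<beta>: False
  define f where "f = log_p k \<beta>"
  have \<epsilon>: "\<epsilon>1 > 0" "\<epsilon>2 > 0" using adm by (auto simp: admissible_shift_def)
  have off: "\<gamma> s + \<i> * of_real t \<in> off_cuts k \<beta>" if "-\<epsilon>1 \<le> t" "t \<le> \<epsilon>2" for s t
    using admissible_shift_off_cuts[OF k \<beta> adm(1), of t] admissible_shift_off_cuts[OF k \<beta> adm(2), of t] that
    by (cases "t \<ge> 0") auto
  have \<alpha>W: "\<alpha> \<in> off_cuts k \<beta>" using off[of 0] \<epsilon> \<alpha> by auto
  have side: "range (shift_b \<gamma> \<epsilon>1) \<subseteq> below (range \<gamma>)" "range (shift_a \<gamma> \<epsilon>2) \<subseteq> above (range \<gamma>)"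
     "range (shift_b \<gamma> \<epsilon>2) \<subseteq> below (range \<gamma>)" "range (shift_a \<gamma> \<epsilon>1) \<subseteq> above (range \<gamma>)"
    using adm \<epsilon> by (auto simp: admissible_shift_def)
  have nb: "\<alpha> \<notin> range (shift_b \<gamma> \<epsilon>1)" "\<alpha> \<notin> range (shift_a \<gamma> \<epsilon>2)"
    using side above_below_range_disjoint[of "range \<gamma>"] \<alpha> by blast+
  \<comment> \<open>The difference quotient with its singularity removed.\<close>
  define \<phi> where "\<phi> z = (if z = \<alpha> then deriv f \<alpha> else (f z - f \<alpha>) / (z - \<alpha>))" for z
  have \<phi>hol: "\<phi> holomorphic_on off_cuts k \<beta>"
    unfolding \<phi>_def f_def
    by (rule pole_lemma[OF log_p_holomorphic]) (use \<alpha>W open_off_cuts in \<open>simp add: interior_open\<close>)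
  have "((\<lambda>z. (f z - f \<alpha>) * (1 / (z - \<alpha>))) \<longlongrightarrow> (0 - f \<alpha>) * 0) at_infinity"
    unfolding f_def by (intro tendsto_intros log_p_tendsto_0 k inverse_diff_tendsto_0)
  moreover have "eventually (\<lambda>z. (f z - f \<alpha>) * (1 / (z - \<alpha>)) = \<phi> z) at_infinity"
    unfolding eventually_at_infinity by (rule exI[of _ "norm \<alpha> + 1"]) (auto simp: \<phi>_def)
  ultimately have \<phi>0: "(\<phi> \<longlongrightarrow> 0) at_infinity" using Lim_transform_eventually by force
  define J where "J \<eta> g T = integral {-T..T} (\<lambda>s. g (\<eta> s) * vector_derivative \<gamma> (at s))"
    for \<eta> :: "real \<Rightarrow> complex" and g :: "complex \<Rightarrow> complex" and T :: real
  have main: "((\<lambda>T. J (shift_a \<gamma> \<epsilon>2) \<phi> T - J (shift_b \<gamma> \<epsilon>1) \<phi> T) \<longlongrightarrow> 0) at_top"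
  proof -
    let ?v = "\<i> * of_real (\<epsilon>1 + \<epsilon>2)"
    have "shift_b \<gamma> \<epsilon>1 s + of_real \<tau> * ?v \<in> off_cuts k \<beta>" if \<tau>: "\<tau> \<in> {0..1}" for s \<tau>
    proof -
      have "0 \<le> \<tau> * (\<epsilon>1 + \<epsilon>2)" "\<tau> * (\<epsilon>1 + \<epsilon>2) \<le> \<epsilon>1 + \<epsilon>2"
        using \<tau> \<epsilon> by (auto simp: mult_left_le_one_le)
      then have "\<gamma> s + \<i> * of_real (\<tau> * (\<epsilon>1 + \<epsilon>2) - \<epsilon>1) \<in> off_cuts k \<beta>"
        by (intro off) auto
      then show ?thesis by (simp add: shift_b_def algebra_simps)
    qed
    from integral_translate_tendsto[OF smooth_line_shift(2)[OF \<gamma>] \<phi>hol open_off_cuts \<phi>0 this]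
    have "((\<lambda>T. integral {- T..T} (\<lambda>s. \<phi> (shift_b \<gamma> \<epsilon>1 s + ?v) * vector_derivative \<gamma> (at s)) -
       integral {- T..T} (\<lambda>s. \<phi> (shift_b \<gamma> \<epsilon>1 s) * vector_derivative \<gamma> (at s))) \<longlongrightarrow> 0) at_top"
      unfolding smooth_line_shift(4)[OF \<gamma>] .
    moreover have "shift_b \<gamma> \<epsilon>1 s + ?v = shift_a \<gamma> \<epsilon>2 s" for s
      by (simp add: shift_a_def shift_b_def algebra_simps)
    ultimately show ?thesis by (simp add: J_def)
  qed
  have split: "J \<eta> (\<lambda>z. f z / (z - \<alpha>)) T = J \<eta> \<phi> T + f \<alpha> * J \<eta> (\<lambda>z. 1 / (z - \<alpha>)) T"
    if \<eta>: "smooth_line \<eta>" "range \<eta> \<subseteq> off_cuts k \<beta>" "\<alpha> \<notin> range \<eta>" for \<eta> T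
  proof -
    note cont = smooth_line_continuous[OF \<eta>(1)] smooth_line_continuous_vector_derivative[OF \<gamma>]
    have "J \<eta> (\<lambda>z. f z / (z - \<alpha>)) T = integral {-T..T} (\<lambda>s. \<phi> (\<eta> s) * vector_derivative \<gamma> (at s)
          + f \<alpha> * (1 / (\<eta> s - \<alpha>) * vector_derivative \<gamma> (at s)))"
      unfolding J_def
    proof (rule integral_cong)
      fix s
      have "\<eta> s \<noteq> \<alpha>" using \<eta>(3) by auto
      then have "f (\<eta> s) / (\<eta> s - \<alpha>) = \<phi> (\<eta> s) + f \<alpha> * (1 / (\<eta> s - \<alpha>))"
        by (simp add: \<phi>_def diff_divide_distrib)
      then show "f (\<eta> s) / (\<eta> s - \<alpha>) * vector_derivative \<gamma> (at s) = \<phi> (\<eta> s) * vector_derivative \<gamma> (at s)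
          + f \<alpha> * (1 / (\<eta> s - \<alpha>) * vector_derivative \<gamma> (at s))"
        by (simp only: distrib_right mult.assoc)
    qed
    also have "\<dots> = J \<eta> \<phi> T + integral {-T..T} (\<lambda>s. f \<alpha> * (1 / (\<eta> s - \<alpha>) * vector_derivative \<gamma> (at s)))"
      unfolding J_def
    proof (rule integral_add)
      show "(\<lambda>s. \<phi> (\<eta> s) * vector_derivative \<gamma> (at s)) integrable_on {- T..T}"
        by (intro integrable_continuous_interval continuous_intros cont
            continuous_on_compose2[OF holomorphic_on_imp_continuous_on[OF \<phi>hol]]) (use \<eta> in auto)
      show "(\<lambda>s. f \<alpha> * (1 / (\<eta> s - \<alpha>) * vector_derivative \<gamma> (at s))) integrable_on {- T..T}"
        by (intro integrable_continuous_interval continuous_intros cont) (use \<eta>(3) in auto)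
    qed
    finally show ?thesis by (simp only: J_def integral_mult_right)
  qed
  have offb: "range (shift_b \<gamma> \<epsilon>1) \<subseteq> off_cuts k \<beta>"
  proof
    fix z assume "z \<in> range (shift_b \<gamma> \<epsilon>1)"
    then obtain s where "z = \<gamma> s + \<i> * of_real (- \<epsilon>1)" by (auto simp: shift_b_def)
    then show "z \<in> off_cuts k \<beta>" using off[of "- \<epsilon>1" s] \<epsilon> by simp
  qed
  have offa: "range (shift_a \<gamma> \<epsilon>2) \<subseteq> off_cuts k \<beta>" using off[of \<epsilon>2] \<epsilon> by (auto simp: shift_a_def)
  have arc: "J (shift_b \<gamma> \<epsilon>1) (\<lambda>z. 1 / (z - \<alpha>)) T = cauchy_arc \<gamma> (\<alpha> + \<i> * of_real \<epsilon>1) T"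
    "J (shift_a \<gamma> \<epsilon>2) (\<lambda>z. 1 / (z - \<alpha>)) T = cauchy_arc \<gamma> (\<alpha> - \<i> * of_real \<epsilon>2) T" for T
    by (simp_all add: J_def cauchy_arc_def shift_a_def shift_b_def algebra_simps)
  have across: "((\<lambda>T. cauchy_arc \<gamma> (\<alpha> + \<i> * of_real \<epsilon>1) T - cauchy_arc \<gamma> (\<alpha> - \<i> * of_real \<epsilon>2) T) \<longlongrightarrow> 2 * pi * \<i>) at_top"
    by (rule cauchy_arc_tendsto_across[OF \<gamma>]) (use side \<alpha> in \<open>auto simp: shift_a_def shift_b_def\<close>)
  have "((\<lambda>T. f \<alpha> * (cauchy_arc \<gamma> (\<alpha> + \<i> * of_real \<epsilon>1) T - cauchy_arc \<gamma> (\<alpha> - \<i> * of_real \<epsilon>2) T)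
      - (J (shift_a \<gamma> \<epsilon>2) \<phi> T - J (shift_b \<gamma> \<epsilon>1) \<phi> T)) \<longlongrightarrow> f \<alpha> * (2 * pi * \<i>) - 0) at_top"
    by (intro tendsto_intros across main)
  then have "((\<lambda>T. J (shift_b \<gamma> \<epsilon>1) (\<lambda>z. f z / (z - \<alpha>)) T - J (shift_a \<gamma> \<epsilon>2) (\<lambda>z. f z / (z - \<alpha>)) T)
      \<longlongrightarrow> f \<alpha> * (2 * pi * \<i>)) at_top"
    unfolding split[OF smooth_line_shift(2)[OF \<gamma>] offb nb(1)] split[OF smooth_line_shift(1)[OF \<gamma>] offa nb(2)] arc
    by (simp add: algebra_simps)
  moreover have "((\<lambda>T. J (shift_b \<gamma> \<epsilon>1) (\<lambda>z. f z / (z - \<alpha>)) T - J (shift_a \<gamma> \<epsilon>2) (\<lambda>z. f z / (z - \<alpha>)) T)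
      \<longlongrightarrow> line_integral (shift_b \<gamma> \<epsilon>1) (\<lambda>z. f z / (z - \<alpha>)) - line_integral (shift_a \<gamma> \<epsilon>2) (\<lambda>z. f z / (z - \<alpha>))) at_top"
    using tendsto_diff[OF line_integral_log_p_tendsto[OF k smooth_line_shift(2)[OF \<gamma>] offb nb(1)]
       line_integral_log_p_tendsto[OF k smooth_line_shift(1)[OF \<gamma>] offa nb(2)]]
    by (simp add: J_def f_def smooth_line_shift[OF \<gamma>])
  ultimately have "line_integral (shift_b \<gamma> \<epsilon>1) (\<lambda>z. f z / (z - \<alpha>))
      - line_integral (shift_a \<gamma> \<epsilon>2) (\<lambda>z. f z / (z - \<alpha>)) = f \<alpha> * (2 * pi * \<i>)"
    by (rule tendsto_unique[OF trivial_limit_at_top_linorder, rotated])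
  then show ?thesis by (simp add: f_def mult.commute)
qed

section \<open>Independence of the shift\<close>

text \<open>The condition under which the integral over \<open>\<gamma> - i\<epsilon>\<close> is used to extend a factor. In contrast to
admissibility it is stable under small changes of \<open>\<beta>\<close>, also near \<open>\<beta> = 0\<close>, where an admissible strip may
meet the cuts of \<open>kappa\<close>.\<close>

definition good_shift :: "real \<Rightarrow> (real \<Rightarrow> complex) \<Rightarrow> complex \<Rightarrow> real \<Rightarrow> bool" where
  "good_shift k \<gamma> \<beta> \<epsilon> \<longleftrightarrow> \<epsilon> > 0 \<and>
     (\<forall>t. 0 < t \<and> t \<le> \<epsilon> \<longrightarrow>
        range (shift_a \<gamma> t) \<subseteq> above (range \<gamma>) \<and> range (shift_b \<gamma> t) \<subseteq> below (range \<gamma>)) \<and>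
     (\<forall>s t. 0 \<le> t \<and> t \<le> \<epsilon> \<longrightarrow> \<gamma> s - \<i> * of_real t \<in> off_cuts k \<beta>)"

lemma UHP_subset_above_shift_b:
  assumes \<gamma>: "smooth_line \<gamma>" and good: "good_shift k \<gamma> \<beta> \<epsilon>"
  shows "UHP \<gamma> \<subseteq> above (range (shift_b \<gamma> \<epsilon>))"
proof -
  have rb: "range (shift_b \<gamma> \<epsilon>) = (\<lambda>z. z + \<i> * of_real (- \<epsilon>)) ` range \<gamma>"
    by (auto simp: shift_b_def image_image)
  have side: "range (shift_a \<gamma> \<epsilon>) \<subseteq> above (range \<gamma>)" "range (shift_b \<gamma> \<epsilon>) \<subseteq> below (range \<gamma>)"
    using good by (auto simp: good_shift_def)
  have on: "range \<gamma> \<subseteq> above (range (shift_b \<gamma> \<epsilon>))"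
  proof
    fix z assume "z \<in> range \<gamma>"
    then have "z + \<i> * of_real \<epsilon> \<in> above (range \<gamma>)" using side(1) by (auto simp: shift_a_def)
    from above_translate[OF this, of "- \<epsilon>"] show "z \<in> above (range (shift_b \<gamma> \<epsilon>))" by (simp add: rb)
  qed
  have "above (range \<gamma>) \<subseteq> above (range (shift_b \<gamma> \<epsilon>))"
  proof (rule above_subset)
    show "connected (above (range \<gamma>))" by (rule above_connected_open[OF \<gamma>])
    show "above (range \<gamma>) \<inter> range (shift_b \<gamma> \<epsilon>) = {}"
      using above_below_disjoint[OF \<gamma>] side by blast
    obtain Y1 where Y1: "Y1 > 0" "above (range \<gamma>) = connected_component_set (- range \<gamma>) (Complex 0 y)"
       "\<forall>s. Re (\<gamma> s) = 0 \<longrightarrow> \<bar>Im (\<gamma> s)\<bar> < y" if "y \<ge> Y1" for y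
      using above_eq_component[OF \<gamma>] by metis
    obtain Y2 where Y2: "Y2 > 0" "above (range (shift_b \<gamma> \<epsilon>)) = connected_component_set (- range (shift_b \<gamma> \<epsilon>)) (Complex 0 y)"
       "\<forall>s. Re (shift_b \<gamma> \<epsilon> s) = 0 \<longrightarrow> \<bar>Im (shift_b \<gamma> \<epsilon> s)\<bar> < y" if "y \<ge> Y2" for y
      using above_eq_component[OF smooth_line_shift(2)[OF \<gamma>]] by metis
    define y where "y = max Y1 Y2"
    have mem: "Complex 0 y \<in> - range \<eta>" if "\<forall>s. Re (\<eta> s) = 0 \<longrightarrow> \<bar>Im (\<eta> s)\<bar> < y" for \<eta> :: "real \<Rightarrow> complex"
      using that by (force simp: complex_eq_iff)
    have "Complex 0 y \<in> above (range \<gamma>)" "Complex 0 y \<in> above (range (shift_b \<gamma> \<epsilon>))"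
      using Y1(2)[of y] Y2(2)[of y] mem[OF Y1(3)[of y]] mem[OF Y2(3)[of y]]
      by (auto simp: y_def connected_component_refl_eq)
    then show "above (range \<gamma>) \<inter> above (range (shift_b \<gamma> \<epsilon>)) \<noteq> {}" by blast
  qed
  with on show ?thesis by (auto simp: UHP_def)
qed

text \<open>No contour between the two shifts passes through \<open>\<alpha>\<close>: seen from the contour with the smaller shift, the
others lie below and \<open>\<alpha>\<close> lies above.\<close>

lemma line_integral_shift_b_mono:
  assumes k: "k > 0" and \<gamma>: "smooth_line \<gamma>" and good: "good_shift k \<gamma> \<beta> \<epsilon>2" and \<epsilon>: "0 < \<epsilon>1" "\<epsilon>1 \<le> \<epsilon>2"
    and \<alpha>: "\<alpha> \<in> above (range (shift_b \<gamma> \<epsilon>1))"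
  shows "line_integral (shift_b \<gamma> \<epsilon>1) (\<lambda>z. log_p k \<beta> z / (z - \<alpha>))
       = line_integral (shift_b \<gamma> \<epsilon>2) (\<lambda>z. log_p k \<beta> z / (z - \<alpha>))"
proof -
  have ne: "\<gamma> s - \<i> * of_real t \<noteq> \<alpha>" if t: "\<epsilon>1 \<le> t" "t \<le> \<epsilon>2" for s t
  proof (cases "t = \<epsilon>1")
    case True
    then show ?thesis using \<alpha> above_below_range_disjoint(1)[of "range (shift_b \<gamma> \<epsilon>1)"] by (auto simp: shift_b_def)
  next
    case False
    then have "range (shift_b \<gamma> (t - \<epsilon>1)) \<subseteq> below (range \<gamma>)" using good t \<epsilon> by (auto simp: good_shift_def)
    then have "\<gamma> s - \<i> * of_real (t - \<epsilon>1) \<in> below (range \<gamma>)" by (auto simp: shift_b_def)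
    from below_translate[OF this, of "- \<epsilon>1"]
    have "\<gamma> s - \<i> * of_real t \<in> below (range (shift_b \<gamma> \<epsilon>1))"
      by (simp add: shift_b_def image_image algebra_simps)
    then show ?thesis using \<alpha> above_below_disjoint[OF smooth_line_shift(2)[OF \<gamma>], of \<epsilon>1] by blast
  qed
  have off: "\<gamma> s - \<i> * of_real t \<in> off_cuts k \<beta>" if "\<epsilon>1 \<le> t" "t \<le> \<epsilon>2" for s t
    using good that \<epsilon> by (auto simp: good_shift_def)
  let ?h = "\<lambda>z. log_p k \<beta> z / (z - \<alpha>)"
  let ?v = "\<i> * of_real (\<epsilon>2 - \<epsilon>1)"
  have "((\<lambda>T. integral {-T..T} (\<lambda>s. ?h (shift_b \<gamma> \<epsilon>2 s + ?v) * vector_derivative (shift_b \<gamma> \<epsilon>2) (at s))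
      - integral {-T..T} (\<lambda>s. ?h (shift_b \<gamma> \<epsilon>2 s) * vector_derivative (shift_b \<gamma> \<epsilon>2) (at s))) \<longlongrightarrow> 0) at_top"
  proof (rule integral_translate_tendsto[OF smooth_line_shift(2)[OF \<gamma>], where h="?h" and W="off_cuts k \<beta> - {\<alpha>}"])
    show "?h holomorphic_on off_cuts k \<beta> - {\<alpha>}"
      by (intro holomorphic_intros holomorphic_on_subset[OF log_p_holomorphic]) auto
    show "open (off_cuts k \<beta> - {\<alpha>})" using open_off_cuts by (intro open_Diff) auto
    have "((\<lambda>z. log_p k \<beta> z * (1 / (z - \<alpha>))) \<longlongrightarrow> 0 * 0) at_infinity"
      by (intro tendsto_intros log_p_tendsto_0 k inverse_diff_tendsto_0)
    then show "(?h \<longlongrightarrow> 0) at_infinity" by simp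
    show "shift_b \<gamma> \<epsilon>2 s + of_real \<tau> * ?v \<in> off_cuts k \<beta> - {\<alpha>}" if \<tau>: "\<tau> \<in> {0..1}" for s \<tau>
    proof -
      define t where "t = \<epsilon>2 - \<tau> * (\<epsilon>2 - \<epsilon>1)"
      have "0 \<le> \<tau> * (\<epsilon>2 - \<epsilon>1)" "\<tau> * (\<epsilon>2 - \<epsilon>1) \<le> \<epsilon>2 - \<epsilon>1"
        using \<tau> \<epsilon> by (auto simp: mult_left_le_one_le)
      then have t: "\<epsilon>1 \<le> t" "t \<le> \<epsilon>2" by (auto simp: t_def)
      have "shift_b \<gamma> \<epsilon>2 s + of_real \<tau> * ?v = \<gamma> s - \<i> * of_real t" by (simp add: t_def shift_b_def algebra_simps)
      then show ?thesis using ne[OF t] off[OF t] by simp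
    qed
  qed
  moreover have "shift_b \<gamma> \<epsilon>2 s + ?v = shift_b \<gamma> \<epsilon>1 s" for s
    by (simp add: shift_b_def algebra_simps)
  ultimately have 1: "((\<lambda>T. integral {-T..T} (\<lambda>s. ?h (shift_b \<gamma> \<epsilon>1 s) * vector_derivative (shift_b \<gamma> \<epsilon>1) (at s))
      - integral {-T..T} (\<lambda>s. ?h (shift_b \<gamma> \<epsilon>2 s) * vector_derivative (shift_b \<gamma> \<epsilon>2) (at s))) \<longlongrightarrow> 0) at_top"
    by (simp add: smooth_line_shift(4)[OF \<gamma>])
  have lim: "((\<lambda>T. integral {-T..T} (\<lambda>s. ?h (shift_b \<gamma> \<epsilon> s) * vector_derivative (shift_b \<gamma> \<epsilon>) (at s)))
      \<longlongrightarrow> line_integral (shift_b \<gamma> \<epsilon>) ?h) at_top" if "\<epsilon>1 \<le> \<epsilon>" "\<epsilon> \<le> \<epsilon>2" for \<epsilon>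
  proof (rule line_integral_log_p_tendsto[OF k smooth_line_shift(2)[OF \<gamma>]])
    show "range (shift_b \<gamma> \<epsilon>) \<subseteq> off_cuts k \<beta>" "\<alpha> \<notin> range (shift_b \<gamma> \<epsilon>)"
      using off[OF that] ne[OF that] by (auto simp: shift_b_def)
  qed
  show ?thesis
    using tendsto_unique[OF trivial_limit_at_top_linorder 1 tendsto_diff[OF lim lim]] \<epsilon> by simp
qed

lemma line_integral_shift_b_unique:
  assumes k: "k > 0" and \<gamma>: "smooth_line \<gamma>" and good: "good_shift k \<gamma> \<beta> \<epsilon>1" "good_shift k \<gamma> \<beta> \<epsilon>2"
    and \<alpha>: "\<alpha> \<in> above (range (shift_b \<gamma> \<epsilon>1))" "\<alpha> \<in> above (range (shift_b \<gamma> \<epsilon>2))"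
  shows "line_integral (shift_b \<gamma> \<epsilon>1) (\<lambda>z. log_p k \<beta> z / (z - \<alpha>))
       = line_integral (shift_b \<gamma> \<epsilon>2) (\<lambda>z. log_p k \<beta> z / (z - \<alpha>))"
proof (cases "\<epsilon>1 \<le> \<epsilon>2")
  case True
  then show ?thesis using line_integral_shift_b_mono[OF k \<gamma> good(2) _ True \<alpha>(1)] good(1) by (simp add: good_shift_def)
next
  case False
  then show ?thesis using line_integral_shift_b_mono[OF k \<gamma> good(1) _ _ \<alpha>(2)] good(2) by (simp add: good_shift_def)
qed

lemma admissible_imp_good_shift:
  assumes k: "k > 0" and \<beta>: "\<beta> \<noteq> 0" and adm: "admissible_shift \<gamma> (log_p k \<beta>) \<epsilon>"
  shows "good_shift k \<gamma> \<beta> \<epsilon>"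
proof -
  have "\<gamma> s - \<i> * of_real t \<in> off_cuts k \<beta>" if "0 \<le> t" "t \<le> \<epsilon>" for s t
    using admissible_shift_off_cuts[OF k \<beta> adm, of "- t" s] that by simp
  then show ?thesis using adm by (auto simp: good_shift_def admissible_shift_def)
qed

text \<open>The value \<open>\<beta> = 0\<close> is special because every strip is a strip of analyticity for the zero function. A
smaller shift has to be chosen, which is possible because the line comes near the cuts of \<open>kappa\<close> only
in its compact part.\<close>

lemma admissible_imp_good_shift_0:
  assumes k: "k > 0" and \<gamma>: "smooth_line \<gamma>" "range \<gamma> \<inter> kappa_cuts (of_real k) = {}"
    and adm: "admissible_shift \<gamma> (log_p k 0) \<epsilon>"
  shows "\<exists>\<epsilon>'. good_shift k \<gamma> 0 \<epsilon>'"
proof -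
  obtain T where T: "T > 0" "\<forall>s\<ge>T. Re (\<gamma> s) > k" "\<forall>s\<le>-T. Re (\<gamma> s) < - k"
    using smooth_line_tails[OF \<gamma>(1)] by blast
  have "compact (\<gamma> ` {-T..T})"
    by (intro compact_continuous_image smooth_line_continuous[OF \<gamma>(1)]) auto
  moreover have "\<gamma> ` {-T..T} \<subseteq> - kappa_cuts (of_real k)" using \<gamma>(2) by auto
  ultimately obtain e where e: "e > 0" "(\<Union>x\<in>\<gamma> ` {-T..T}. ball x e) \<subseteq> - kappa_cuts (of_real k)"
    using compact_subset_open_imp_ball_epsilon_subset[OF _ open_Compl[OF closed_kappa_cuts]] by metis
  define \<epsilon>' where "\<epsilon>' = min \<epsilon> (e / 2)"
  have \<epsilon>': "\<epsilon>' > 0" "\<epsilon>' \<le> \<epsilon>" "\<epsilon>' < e" using e adm by (auto simp: \<epsilon>'_def admissible_shift_def)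
  have "\<gamma> s - \<i> * of_real t \<in> off_cuts k 0" if t: "0 \<le> t" "t \<le> \<epsilon>'" for s t
  proof -
    have "\<gamma> s - \<i> * of_real t \<notin> kappa_cuts (of_real k)"
    proof (cases "s \<in> {-T..T}")
      case True
      have "\<gamma> s - \<i> * of_real t \<in> ball (\<gamma> s) e" using t \<epsilon>' by (simp add: dist_norm norm_mult)
      then show ?thesis using e True by blast
    next
      case False
      then have "\<bar>Re (\<gamma> s)\<bar> > k" using T(2)[rule_format, of s] T(3)[rule_format, of s] k by auto
      then show ?thesis using kappa_cuts_Re[of "\<gamma> s - \<i> * of_real t" k] k by auto
    qed
    then show ?thesis using sw_cut_Re_nonpos[of 1] by (auto simp: off_cuts_def)
  qed
  then show ?thesis using adm \<epsilon>' unfolding good_shift_def admissible_shift_def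
    by (intro exI[of _ \<epsilon>']) (meson order_trans)
qed

section \<open>Differentiability of the Cauchy integral in both variables\<close>

lemma log_p_has_field_derivative:
  assumes "z \<in> off_cuts k \<beta>"
  shows "((\<lambda>\<beta>. log_p k \<beta> z) has_field_derivative 1 / (kappa (of_real k) z + \<beta>)) (at \<beta> within S)"
proof -
  let ?\<kappa> = "kappa (of_real k) z"
  have \<kappa>: "?\<kappa> \<noteq> 0" and nc: "1 + \<beta> / ?\<kappa> \<notin> sw_cut" using assms by (auto simp: off_cuts_def kappa_ne_0)
  have "((\<lambda>\<beta>. 1 + \<beta> / ?\<kappa>) has_field_derivative 1 / ?\<kappa>) (at \<beta> within S)"
    using \<kappa> by (auto intro!: derivative_eq_intros)
  from DERIV_chain2[OF log_sw_has_field_derivative[OF nc] this]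
  show ?thesis unfolding log_p_def
    by (rule DERIV_cong) (use \<kappa> in \<open>simp add: field_simps\<close>)
qed

text \<open>On a compact set \<open>1 + \<beta>0 / kappa\<close> has positive distance from the cut of the logarithm, and \<open>kappa\<close> is bounded
away from \<open>0\<close>. As \<open>0\<close> belongs to the cut, this also bounds \<open>kappa + \<beta>\<close> from below.\<close>

lemma off_cuts_stable_compact:
  assumes P: "compact P" "P \<subseteq> off_cuts k \<beta>0"
  obtains r c where "r > 0" "c > 0"
    "\<And>\<beta> z. \<beta> \<in> ball \<beta>0 r \<Longrightarrow> z \<in> P \<Longrightarrow> z \<in> off_cuts k \<beta> \<and> c \<le> norm (kappa (of_real k) z + \<beta>)"
proof -
  let ?\<kappa> = "kappa (of_real k)"
  have \<kappa>c: "continuous_on P ?\<kappa>"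
    by (rule holomorphic_on_imp_continuous_on[OF holomorphic_on_subset[OF kappa_holomorphic]])
      (use P in \<open>auto simp: off_cuts_def\<close>)
  have \<kappa>0: "?\<kappa> z \<noteq> 0" if "z \<in> P" for z using P that by (auto simp: off_cuts_def kappa_ne_0)
  have "compact (?\<kappa> ` P)" "?\<kappa> ` P \<subseteq> - {0}" "open (- {0::complex})"
    using P \<kappa>c \<kappa>0 by (auto intro: compact_continuous_image)
  then obtain c0 where c0: "c0 > 0" "(\<Union>x\<in>?\<kappa> ` P. ball x c0) \<subseteq> - {0}"
    using compact_subset_open_imp_ball_epsilon_subset by metis
  have c0': "c0 \<le> norm (?\<kappa> z)" if "z \<in> P" for z
  proof (rule ccontr)
    assume "\<not> c0 \<le> norm (?\<kappa> z)"
    then have "0 \<in> ball (?\<kappa> z) c0" by simp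
    then show False using c0(2) that by blast
  qed
  define y where "y z = 1 + \<beta>0 / ?\<kappa> z" for z
  have "compact (y ` P)" unfolding y_def
    by (intro compact_continuous_image continuous_intros \<kappa>c P(1)) (auto simp: \<kappa>0)
  moreover have "y ` P \<subseteq> - sw_cut" using P by (auto simp: y_def off_cuts_def)
  ultimately obtain e where e: "e > 0" "(\<Union>x\<in>y ` P. ball x e) \<subseteq> - sw_cut"
    using compact_subset_open_imp_ball_epsilon_subset[OF _ open_Compl[OF closed_sw_cut]] by metis
  show ?thesis
  proof (rule that[of "e * c0 / 2" "c0 * (e / 2)"])
    fix \<beta> z assume \<beta>: "\<beta> \<in> ball \<beta>0 (e * c0 / 2)" and z: "z \<in> P"
    have "dist (y z) (1 + \<beta> / ?\<kappa> z) = norm (\<beta>0 - \<beta>) / norm (?\<kappa> z)"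
      by (simp add: y_def dist_norm norm_divide[symmetric] diff_divide_distrib)
    also have "\<dots> \<le> norm (\<beta>0 - \<beta>) / c0"
      using c0 c0'[OF z] by (intro divide_left_mono mult_pos_pos) auto
    also have "\<dots> < e / 2" using \<beta> c0(1) by (simp add: dist_norm field_simps)
    finally have d: "dist (y z) (1 + \<beta> / ?\<kappa> z) < e / 2" .
    then have "1 + \<beta> / ?\<kappa> z \<in> ball (y z) e" using e(1) by simp
    then have off: "1 + \<beta> / ?\<kappa> z \<notin> sw_cut" using e z by blast
    have "0 \<notin> ball (y z) e" using e z sw_cut_0 by blast
    then have "norm (y z) \<ge> e" by simp
    moreover have "norm (y z) \<le> norm (1 + \<beta> / ?\<kappa> z) + dist (y z) (1 + \<beta> / ?\<kappa> z)"
      unfolding dist_norm by norm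
    ultimately have "norm (1 + \<beta> / ?\<kappa> z) \<ge> e / 2" using d by linarith
    then have "c0 * (e / 2) \<le> norm (?\<kappa> z) * norm (1 + \<beta> / ?\<kappa> z)"
      using c0(1) e(1) c0'[OF z] by (intro mult_mono) auto
    also have "\<dots> = norm (?\<kappa> z + \<beta>)" using \<kappa>0[OF z] by (simp add: norm_mult[symmetric] distrib_left)
    finally show "z \<in> off_cuts k \<beta> \<and> c0 * (e / 2) \<le> norm (?\<kappa> z + \<beta>)"
      using off z P(2) by (auto simp: off_cuts_def)
  qed (use e c0 in auto)
qed

lemma good_shift_open:
  assumes k: "k > 0" and \<gamma>: "smooth_line \<gamma>" and good: "good_shift k \<gamma> \<beta>0 \<epsilon>"
  obtains r where "r > 0" "\<And>\<beta>. \<beta> \<in> ball \<beta>0 r \<Longrightarrow> good_shift k \<gamma> \<beta> \<epsilon>"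
proof -
  define R where "R = 2 * k + 4 * (norm \<beta>0 + 1)"
  obtain T where T: "T > 0" "\<forall>s\<ge>T. Re (\<gamma> s) > R" "\<forall>s\<le>-T. Re (\<gamma> s) < - R"
    using smooth_line_tails[OF \<gamma>] by blast
  define P where "P = (\<lambda>(s, t). \<gamma> s - \<i> * of_real t) ` ({-T..T} \<times> {0..\<epsilon>})"
  have "compact P" unfolding P_def split_beta
    by (intro compact_continuous_image compact_Times continuous_intros
         continuous_on_compose2[OF smooth_line_continuous[OF \<gamma>, of UNIV]]) auto
  moreover have "P \<subseteq> off_cuts k \<beta>0" using good by (auto simp: P_def good_shift_def)
  ultimately obtain r c where r: "r > 0" "\<And>\<beta> z. \<beta> \<in> ball \<beta>0 r \<Longrightarrow> z \<in> P \<Longrightarrow> z \<in> off_cuts k \<beta>"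
    using off_cuts_stable_compact by metis
  show ?thesis
  proof (rule that[of "min r 1"])
    fix \<beta> assume \<beta>: "\<beta> \<in> ball \<beta>0 (min r 1)"
    have "norm \<beta> \<le> norm \<beta>0 + dist \<beta>0 \<beta>" unfolding dist_norm by norm
    then have n\<beta>: "norm \<beta> \<le> norm \<beta>0 + 1" using \<beta> by simp
    have "\<gamma> s - \<i> * of_real t \<in> off_cuts k \<beta>" if t: "0 \<le> t" "t \<le> \<epsilon>" for s t
    proof (cases "s \<in> {-T..T}")
      case True
      then have "\<gamma> s - \<i> * of_real t \<in> P" using t by (force simp: P_def)
      then show ?thesis using r \<beta> by auto
    next
      case False
      then have "\<bar>Re (\<gamma> s)\<bar> > R" using T(2)[rule_format, of s] T(3)[rule_format, of s] by auto
      then show ?thesis using far_off_cuts[OF k, of \<beta> R] n\<beta> by (auto simp: R_def)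
    qed
    then show "good_shift k \<gamma> \<beta> \<epsilon>" using good by (auto simp: good_shift_def)
  qed (use r in auto)
qed

text \<open>The weight \<open>1 + \<bar>z\<bar>\<close> makes one set of estimates serve both the compact part of the line and the region
of large real part, where holomorphic integrands are controlled through their primitives.\<close>

lemma log_p_uniform_bounds:
  assumes k: "k > 0" and \<eta>: "smooth_line \<eta>" "range \<eta> \<subseteq> off_cuts k \<beta>0" "\<alpha>0 \<notin> range \<eta>"
  obtains r c M R where "r > 0" "c > 0" "M \<ge> 0" "R > 0"
    "\<And>\<beta> \<alpha> z. \<beta> \<in> ball \<beta>0 r \<Longrightarrow> \<alpha> \<in> ball \<alpha>0 r \<Longrightarrow> z \<in> range \<eta> \<union> {z. R < \<bar>Re z\<bar>} \<Longrightarrow>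
       z \<in> off_cuts k \<beta> \<and> c * (1 + norm z) \<le> norm (kappa (of_real k) z + \<beta>) \<and>
       c * (1 + norm z) \<le> norm (z - \<alpha>) \<and> norm (log_p k \<beta> z) \<le> M / (1 + norm z)"
proof -
  let ?\<kappa> = "kappa (of_real k)"
  \<comment> \<open>The summand \<open>6\<close> leaves room for parameters at distance up to \<open>1\<close> from \<open>\<beta>0\<close> and \<open>\<alpha>0\<close>.\<close>
  define R where "R = 2 * k + 4 * norm \<beta>0 + 2 * norm \<alpha>0 + 6"
  have "R \<ge> 1" using k norm_ge_zero[of \<beta>0] norm_ge_zero[of \<alpha>0] unfolding R_def by linarith
  then have R: "R > 0" "R \<ge> 1" by auto
  obtain T where T: "T > 0" "\<forall>s\<ge>T. Re (\<eta> s) > R" "\<forall>s\<le>-T. Re (\<eta> s) < - R"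
    using smooth_line_tails[OF \<eta>(1)] by blast
  define P where "P = \<eta> ` {-T..T}"
  have P: "compact P" "P \<subseteq> off_cuts k \<beta>0" "P \<subseteq> - {\<alpha>0}"
    using \<eta> by (auto simp: P_def intro!: compact_continuous_image smooth_line_continuous)
  obtain r1 c1 where r1: "r1 > 0" "c1 > 0"
    "\<And>\<beta> z. \<beta> \<in> ball \<beta>0 r1 \<Longrightarrow> z \<in> P \<Longrightarrow> z \<in> off_cuts k \<beta> \<and> c1 \<le> norm (?\<kappa> z + \<beta>)"
    using off_cuts_stable_compact[OF P(1,2)] by metis
  obtain d where d: "d > 0" "(\<Union>x\<in>P. ball x d) \<subseteq> - {\<alpha>0}"
    using compact_subset_open_imp_ball_epsilon_subset[OF P(1) _ P(3)] by (metis open_delete open_UNIV Compl_eq_Diff_UNIV)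
  obtain B where B: "B \<ge> 0" "\<And>z. z \<in> P \<Longrightarrow> norm z \<le> B"
    using compact_imp_bounded[OF P(1)] by (metis bounded_pos less_imp_le)
  have "compact (log_p k \<beta>0 ` P)"
    by (intro compact_continuous_image P(1) holomorphic_on_imp_continuous_on holomorphic_on_subset[OF log_p_holomorphic P(2)])
  then obtain M0 where M0: "M0 \<ge> 0" "\<And>z. z \<in> P \<Longrightarrow> norm (log_p k \<beta>0 z) \<le> M0"
    using compact_imp_bounded by (metis bounded_pos less_imp_le imageI)
  define r where "r = Min {1, r1, d / 2}"
  have r: "r > 0" "r \<le> 1" "r \<le> r1" "r \<le> d / 2" using r1 d by (auto simp: r_def)
  define c where "c = Min {1 / 8, c1 / (1 + B), d / 2 / (1 + B)}"
  have c: "c > 0" "c \<le> 1 / 8" "c \<le> c1 / (1 + B)" "c \<le> d / 2 / (1 + B)"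
  proof -
    show "c > 0" using r1 d B by (auto simp: c_def intro!: divide_pos_pos add_pos_nonneg)
    show "c \<le> 1 / 8" "c \<le> c1 / (1 + B)" "c \<le> d / 2 / (1 + B)"
      unfolding c_def by (rule Min_le; simp)+
  qed
  define M where "M = max (8 * (norm \<beta>0 + 1)) ((M0 + 1 / c1) * (1 + B))"
  have near: "z \<in> off_cuts k \<beta> \<and> c * (1 + norm z) \<le> norm (?\<kappa> z + \<beta>) \<and>
       c * (1 + norm z) \<le> norm (z - \<alpha>) \<and> norm (log_p k \<beta> z) \<le> M / (1 + norm z)"
    if \<beta>: "\<beta> \<in> ball \<beta>0 r" and \<alpha>: "\<alpha> \<in> ball \<alpha>0 r" and z: "z \<in> P" for \<beta> \<alpha> z
  proof (intro conjI)
    have b: "ball \<beta>0 r \<subseteq> ball \<beta>0 r1" using r by auto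
    show "z \<in> off_cuts k \<beta>" using r1(3) b \<beta> z by blast
    have w: "1 + norm z > 0" "1 + norm z \<le> 1 + B" using B(2)[OF z] by (auto simp: add_pos_nonneg)
    have le: "c * (1 + norm z) \<le> x" if "c \<le> x / (1 + B)" for x
    proof -
      have "c * (1 + norm z) \<le> c * (1 + B)" using w c by (intro mult_left_mono) auto
      also have "\<dots> \<le> x" using that B by (simp add: field_simps)
      finally show ?thesis .
    qed
    have "c * (1 + norm z) \<le> c1" by (rule le[OF c(3)])
    also have "c1 \<le> norm (?\<kappa> z + \<beta>)" using r1(3) b \<beta> z by blast
    finally show "c * (1 + norm z) \<le> norm (?\<kappa> z + \<beta>)" .
    have "c * (1 + norm z) \<le> d / 2" by (rule le[OF c(4)])
    also have "d / 2 \<le> norm (z - \<alpha>)"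
    proof -
      have "\<alpha>0 \<notin> ball z d" using d z by blast
      then have "d \<le> dist z \<alpha>0" by simp
      moreover have "dist z \<alpha>0 \<le> dist z \<alpha> + dist \<alpha>0 \<alpha>" by (rule dist_triangle2)
      ultimately show ?thesis using \<alpha> r(4) by (simp add: dist_norm)
    qed
    finally show "c * (1 + norm z) \<le> norm (z - \<alpha>)" .
    have "norm (log_p k \<beta> z - log_p k \<beta>0 z) \<le> 1 / c1 * norm (\<beta> - \<beta>0)"
    proof (rule field_differentiable_bound[where S="ball \<beta>0 r" and f'="\<lambda>\<beta>. 1 / (?\<kappa> z + \<beta>)"])
      show "((\<lambda>\<beta>. log_p k \<beta> z) has_field_derivative 1 / (?\<kappa> z + \<beta>)) (at \<beta> within ball \<beta>0 r)"
        if "\<beta> \<in> ball \<beta>0 r" for \<beta>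
        using r1(3)[of \<beta> z] b that z by (intro log_p_has_field_derivative) auto
      show "norm (1 / (?\<kappa> z + \<beta>)) \<le> 1 / c1" if "\<beta> \<in> ball \<beta>0 r" for \<beta>
        using r1(3)[of \<beta> z] b that z r1(2) by (auto simp: norm_divide intro!: frac_le)
    qed (use \<beta> r in auto)
    also have "\<dots> \<le> 1 / c1 * 1" using \<beta> r r1(2) by (intro mult_left_mono) (auto simp: dist_norm norm_minus_commute)
    finally have "norm (log_p k \<beta> z) \<le> M0 + 1 / c1" using M0(2)[OF z] norm_triangle_sub[of "log_p k \<beta> z" "log_p k \<beta>0 z"] by simp
    then have "norm (log_p k \<beta> z) * (1 + norm z) \<le> (M0 + 1 / c1) * (1 + B)"
      using w M0(1) r1(2) by (intro mult_mono) auto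
    also have "\<dots> \<le> M" by (simp add: M_def)
    finally show "norm (log_p k \<beta> z) \<le> M / (1 + norm z)" using w by (simp add: field_simps)
  qed
  have far: "z \<in> off_cuts k \<beta> \<and> c * (1 + norm z) \<le> norm (?\<kappa> z + \<beta>) \<and>
       c * (1 + norm z) \<le> norm (z - \<alpha>) \<and> norm (log_p k \<beta> z) \<le> M / (1 + norm z)"
    if \<beta>: "\<beta> \<in> ball \<beta>0 r" and \<alpha>: "\<alpha> \<in> ball \<alpha>0 r" and z: "R < \<bar>Re z\<bar>" for \<beta> \<alpha> z
  proof (intro conjI)
    have "norm \<beta> \<le> norm \<beta>0 + dist \<beta>0 \<beta>" "norm \<alpha> \<le> norm \<alpha>0 + dist \<alpha>0 \<alpha>" unfolding dist_norm by norm+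
    then have n: "norm \<beta> \<le> norm \<beta>0 + 1" "norm \<alpha> \<le> norm \<alpha>0 + 1" using \<alpha> \<beta> r by auto
    have Rz: "R \<le> norm z" using z abs_Re_le_cmod[of z] by linarith
    have z\<beta>: "norm z \<ge> 2 * k + 4 * norm \<beta>" using Rz n norm_ge_zero[of \<alpha>0] unfolding R_def by linarith
    have z\<alpha>: "norm z \<ge> 2 * norm \<alpha>" using Rz n k norm_ge_zero[of \<beta>0] unfolding R_def by linarith
    have z1: "norm z \<ge> 1" using Rz R by linarith
    show "z \<in> off_cuts k \<beta>" using far_off_cuts[OF k, of \<beta> R] n z norm_ge_zero[of \<alpha>0] unfolding R_def by fastforce
    have cw: "c * (1 + norm z) \<le> norm z / 4"
    proof -
      have "c * (1 + norm z) \<le> (1 / 8) * (1 + norm z)" using c by (intro mult_right_mono) auto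
      also have "\<dots> \<le> norm z / 4" using z1 by simp
      finally show ?thesis .
    qed
    show "c * (1 + norm z) \<le> norm (?\<kappa> z + \<beta>)" using cw log_p_far(3)[OF k z\<beta>] by linarith
    show "c * (1 + norm z) \<le> norm (z - \<alpha>)" using cw norm_diff_ge_half[OF z\<alpha>] z1 by linarith
    have "norm (log_p k \<beta> z) \<le> 4 * norm \<beta> / norm z" by (rule log_p_far(2)[OF k z\<beta>])
    also have "\<dots> = 8 * norm \<beta> / (2 * norm z)" by simp
    also have "\<dots> \<le> M / (1 + norm z)"
      using n z1 by (intro frac_le) (auto simp: M_def max.coboundedI1 add_nonneg_nonneg)
    finally show "norm (log_p k \<beta> z) \<le> M / (1 + norm z)" .
  qed
  show ?thesis
  proof (rule that[OF r(1) c(1) _ R(1)])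
    show "M \<ge> 0" by (simp add: M_def max.coboundedI1)
    fix \<beta> \<alpha> z assume \<beta>: "\<beta> \<in> ball \<beta>0 r" and \<alpha>: "\<alpha> \<in> ball \<alpha>0 r" and z: "z \<in> range \<eta> \<union> {z. R < \<bar>Re z\<bar>}"
    have "z \<in> P \<or> R < \<bar>Re z\<bar>"
    proof (cases "R < \<bar>Re z\<bar>")
      case False
      then obtain s where s: "z = \<eta> s" using z by blast
      then have "s \<in> {-T..T}" using False T(2)[rule_format, of s] T(3)[rule_format, of s] by force
      then show ?thesis using s by (simp add: P_def)
    qed auto
    then show "z \<in> off_cuts k \<beta> \<and> c * (1 + norm z) \<le> norm (?\<kappa> z + \<beta>) \<and>
       c * (1 + norm z) \<le> norm (z - \<alpha>) \<and> norm (log_p k \<beta> z) \<le> M / (1 + norm z)"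
      using near[OF \<beta> \<alpha>] far[OF \<beta> \<alpha>] by blast
  qed
qed

text \<open>One constant \<open>L\<close> serves for all integrands, so that a remainder of second order in the parameters has
an integral of second order.\<close>

lemma line_integral_bound:
  assumes \<eta>: "smooth_line \<eta>" and R: "R > 0"
  obtains L where "L \<ge> 0" "\<And>h C. h holomorphic_on {z. R < \<bar>Re z\<bar>} \<Longrightarrow> continuous_on (range \<eta>) h \<Longrightarrow>
     (\<And>z. z \<in> range \<eta> \<union> {z. R < \<bar>Re z\<bar>} \<Longrightarrow> norm (h z) \<le> C / (1 + norm z)\<^sup>2) \<Longrightarrow>
     (\<lambda>s. h (\<eta> s) * vector_derivative \<eta> (at s)) integrable_on UNIV \<and> norm (line_integral \<eta> h) \<le> L * C"
proof -
  obtain T where T: "T > 0" "\<forall>s\<ge>T. Re (\<eta> s) > R" "\<forall>s\<le>-T. Re (\<eta> s) < - R"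
    using smooth_line_tails[OF \<eta>(1)] by blast
  define L where "L = integral {-T..T} (\<lambda>s. norm (vector_derivative \<eta> (at s))) + 2 / R"
  have "integral {-T..T} (\<lambda>s. norm (vector_derivative \<eta> (at s))) \<ge> 0"
    by (rule integral_nonneg)
      (auto intro!: integrable_continuous_interval continuous_intros smooth_line_continuous_vector_derivative[OF \<eta>])
  then have L: "L \<ge> 0" using R by (simp add: L_def)
  show ?thesis
  proof (rule that[OF L])
    fix h C
    assume hol: "h holomorphic_on {z. R < \<bar>Re z\<bar>}" and cont: "continuous_on (range \<eta>) h"
     and bd: "\<And>z. z \<in> range \<eta> \<union> {z. R < \<bar>Re z\<bar>} \<Longrightarrow> norm (h z) \<le> C / (1 + norm z)\<^sup>2"
    have "0 \<le> C / (1 + norm (\<eta> 0))\<^sup>2" using bd[of "\<eta> 0"] norm_ge_zero order_trans by blast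
    moreover have "(1 + norm (\<eta> 0))\<^sup>2 > 0" by (intro zero_less_power add_pos_nonneg) auto
    ultimately have C: "C \<ge> 0" by (simp add: zero_le_divide_iff)
    have "\<exists>I. ((\<lambda>s. h (\<eta> s) * vector_derivative \<eta> (at s)) has_integral I) UNIV \<and>
      norm I \<le> C * (integral {-T..T} (\<lambda>s. norm (vector_derivative \<eta> (at s))) + 2 / R) \<and>
      ((\<lambda>T. integral {-T..T} (\<lambda>s. h (\<eta> s) * vector_derivative \<eta> (at s))) \<longlongrightarrow> I) at_top"
    proof (rule improper_line_integral[OF \<eta> R C hol cont _ T])
      show "norm (h z) \<le> C / (Re z)\<^sup>2" if z: "R < \<bar>Re z\<bar>" for z
      proof -
        have "norm (h z) \<le> C / (1 + norm z)\<^sup>2" using z by (intro bd) auto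
        also have "\<dots> \<le> C / (Re z)\<^sup>2"
        proof (rule divide_left_mono[OF _ C])
          have "\<bar>Re z\<bar> \<le> 1 + norm z" using abs_Re_le_cmod[of z] by linarith
          then show "(Re z)\<^sup>2 \<le> (1 + norm z)\<^sup>2" by (metis abs_ge_zero power2_abs power_mono)
          have "Re z \<noteq> 0" "1 + norm z \<noteq> 0" using z R norm_ge_zero[of z] by (auto simp del: norm_ge_zero)
          then show "0 < (1 + norm z)\<^sup>2 * (Re z)\<^sup>2" by simp
        qed
        finally show ?thesis .
      qed
      show "norm (h (\<eta> s)) \<le> C" if "\<bar>s\<bar> \<le> T" for s
      proof -
        have "norm (h (\<eta> s)) \<le> C / (1 + norm (\<eta> s))\<^sup>2" by (intro bd) auto
        also have "\<dots> \<le> C / 1"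
        proof (rule divide_left_mono[OF _ C])
          show "1 \<le> (1 + norm (\<eta> s))\<^sup>2" by (intro one_le_power) auto
          then show "0 < (1 + norm (\<eta> s))\<^sup>2 * 1" by linarith
        qed
        finally show ?thesis by simp
      qed
    qed
    then show "(\<lambda>s. h (\<eta> s) * vector_derivative \<eta> (at s)) integrable_on UNIV \<and> norm (line_integral \<eta> h) \<le> L * C"
      by (auto simp: line_integral_def L_def integrable_on_def integral_unique mult.commute)
  qed
qed

text \<open>Here \<open>u0\<close> and \<open>u1\<close> are the values of the logarithm at two parameters, \<open>h1 / q\<close> is its linear increment, and
\<open>w\<close> is the weight. The remainder of the product of \<open>u\<close> and \<open>v = 1 / (z - \<alpha>)\<close> is split into the remainder
of \<open>u\<close>, the mixed term and the remainder of \<open>v\<close>, each of which is \<open>O(n\<^sup>2 / w\<^sup>2)\<close>.\<close>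

lemma quotient_taylor_bound:
  fixes u0 u1 q z \<alpha>0 h1 h2 :: complex
  assumes w: "w \<ge> 1" and c: "c > 0" and n: "norm h1 \<le> n" "norm h2 \<le> n" "M \<ge> 0"
    and q: "c * w \<le> norm q" and z: "c * w \<le> norm (z - \<alpha>0)" "c * w \<le> norm (z - (\<alpha>0 + h2))"
    and u0: "norm u0 \<le> M / w" and u1: "norm (u1 - u0 - h1 / q) \<le> n\<^sup>2 / (c * w)\<^sup>2"
  shows "norm (u1 / (z - (\<alpha>0 + h2)) - u0 / (z - \<alpha>0) - h1 * (1 / q / (z - \<alpha>0)) - h2 * (u0 / (z - \<alpha>0)\<^sup>2))
     \<le> ((2 + M) / c ^ 3) * n\<^sup>2 / w\<^sup>2"
proof -
  define v where "v = 1 / (z - \<alpha>0)"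
  define v' where "v' = 1 / (z - (\<alpha>0 + h2))"
  have cw: "c * w > 0" using w c by simp
  have n0: "n \<ge> 0" using n(1) norm_ge_zero order_trans by blast
  have nz: "z - \<alpha>0 \<noteq> 0" "z - (\<alpha>0 + h2) \<noteq> 0" "q \<noteq> 0" using z q cw by auto
  have d: "v' - v = h2 * v * v'" using nz by (simp add: v_def v'_def field_simps)
  have d2: "v' - v - h2 * v\<^sup>2 = h2\<^sup>2 * v\<^sup>2 * v'"
  proof -
    have "v' - v - h2 * v\<^sup>2 = h2 * v * (v' - v)" using d by (simp add: power2_eq_square algebra_simps)
    then show ?thesis using d by (simp add: power2_eq_square mult_ac)
  qed
  have nv: "norm v \<le> 1 / (c * w)" "norm v' \<le> 1 / (c * w)" "norm (h1 / q) \<le> n / (c * w)"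
    using z q n cw by (auto simp: v_def v'_def norm_divide n0 intro!: frac_le)
  have "u1 / (z - (\<alpha>0 + h2)) - u0 / (z - \<alpha>0) - h1 * (1 / q / (z - \<alpha>0)) - h2 * (u0 / (z - \<alpha>0)\<^sup>2)
     = u1 * v' - u0 * v - (h1 / q) * v - h2 * (u0 * v\<^sup>2)"
    by (simp add: v_def v'_def power_divide)
  also have "\<dots> = (u1 - u0 - h1 / q) * v' + (h1 / q) * (v' - v) + u0 * (v' - v - h2 * v\<^sup>2)"
    by (simp add: algebra_simps add_divide_distrib diff_divide_distrib)
  also have "norm \<dots> \<le> norm ((u1 - u0 - h1 / q) * v') + norm ((h1 / q) * (v' - v)) + norm (u0 * (v' - v - h2 * v\<^sup>2))"
    by norm
  also have "\<dots> \<le> n\<^sup>2 / (c * w)\<^sup>2 * (1 / (c * w)) + n / (c * w) * (n * (1 / (c * w)) * (1 / (c * w)))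
      + M / w * (n\<^sup>2 * (1 / (c * w))\<^sup>2 * (1 / (c * w)))"
    unfolding d2 unfolding d norm_mult norm_power
    using cw n0 n w by (intro add_mono mult_mono u1 nv u0 power_mono mult_nonneg_nonneg) auto
  also have "\<dots> = n\<^sup>2 / c ^ 3 * ((1 / w ^ 3) + (1 / w ^ 3) + M * (1 / w ^ 4))"
    using c w by (simp add: field_simps power2_eq_square power3_eq_cube power4_eq_xxxx)
  also have "\<dots> \<le> n\<^sup>2 / c ^ 3 * ((1 / w ^ 2) + (1 / w ^ 2) + M * (1 / w ^ 2))"
  proof (intro mult_left_mono add_mono)
    have "w ^ 2 \<le> w ^ 3" "w ^ 2 \<le> w ^ 4" using w by (auto intro!: power_increasing)
    then show "1 / w ^ 3 \<le> 1 / w ^ 2" "1 / w ^ 3 \<le> 1 / w ^ 2" "1 / w ^ 4 \<le> 1 / w ^ 2"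
      using w by (auto intro!: divide_left_mono)
  qed (use n c in auto)
  also have "\<dots> = ((2 + M) / c ^ 3) * n\<^sup>2 / w\<^sup>2" using c w by (simp add: field_simps)
  finally show ?thesis .
qed

definition cdiff2 :: "(complex \<times> complex \<Rightarrow> complex) \<Rightarrow> complex \<times> complex \<Rightarrow> bool" where
  "cdiff2 f p \<longleftrightarrow> (\<exists>a b. (f has_derivative (\<lambda>h. a * fst h + b * snd h)) (at p))"

lemma cdiff2_mult: "cdiff2 f p \<Longrightarrow> cdiff2 g p \<Longrightarrow> cdiff2 (\<lambda>p. f p * g p) p"
proof -
  assume "cdiff2 f p" "cdiff2 g p"
  then obtain a b c d where f: "(f has_derivative (\<lambda>h. a * fst h + b * snd h)) (at p)"
     and g: "(g has_derivative (\<lambda>h. c * fst h + d * snd h)) (at p)" by (auto simp: cdiff2_def)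
  show ?thesis unfolding cdiff2_def
    by (rule exI[of _ "f p * c + a * g p"], rule exI[of _ "f p * d + b * g p"])
      (rule has_derivative_eq_rhs[OF has_derivative_mult[OF f g]], auto simp: algebra_simps)
qed

lemma cdiff2_compose:
  assumes "cdiff2 f p" "(g has_field_derivative D) (at (f p))"
  shows "cdiff2 (\<lambda>p. g (f p)) p"
proof -
  obtain a b where f: "(f has_derivative (\<lambda>h. a * fst h + b * snd h)) (at p)"
    using assms by (auto simp: cdiff2_def)
  have "((\<lambda>p. g (f p)) has_derivative (\<lambda>h. D * (a * fst h + b * snd h))) (at p)"
    using has_derivative_compose[OF f assms(2)[unfolded has_field_derivative_def]] by simp
  then show ?thesis unfolding cdiff2_def
    by (intro exI[of _ "D * a"] exI[of _ "D * b"]) (simp add: algebra_simps)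
qed

lemma cdiff2_snd: "cdiff2 snd p"
  unfolding cdiff2_def
  by (rule exI[of _ 0], rule exI[of _ 1]) (auto intro!: derivative_eq_intros)

lemma cdiff2_quadratic_bound:
  assumes r: "r > 0" and bd: "\<And>x. norm x < r \<Longrightarrow> norm (f (p + x) - f p - (a * fst x + b * snd x)) \<le> C * (norm x)\<^sup>2"
  shows "cdiff2 f p"
proof -
  have bl: "bounded_linear (\<lambda>h. a * fst h + b * snd h)"
    by (intro bounded_linear_add bounded_linear_mult_right[THEN bounded_linear_compose] bounded_linear_fst bounded_linear_snd)
  have "(f has_derivative (\<lambda>h. a * fst h + b * snd h)) (at p)"
    unfolding has_derivative_iff_norm
  proof (intro conjI bl)
    show "((\<lambda>y. norm (f y - f p - (a * fst (y - p) + b * snd (y - p))) / norm (y - p)) \<longlongrightarrow> 0) (at p)"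
    proof (rule Lim_null_comparison)
      have "eventually (\<lambda>y. y \<in> ball p r \<and> y \<noteq> p) (at p)"
        using r eventually_at_in_open[of "ball p r" p] by simp
      then show "eventually (\<lambda>y. norm (norm (f y - f p - (a * fst (y - p) + b * snd (y - p))) / norm (y - p)) \<le> C * norm (y - p)) (at p)"
      proof eventually_elim
        case (elim y)
        have "norm (f y - f p - (a * fst (y - p) + b * snd (y - p))) \<le> C * (norm (y - p))\<^sup>2"
          using bd[of "y - p"] elim by (simp add: dist_norm norm_minus_commute)
        then show ?case using elim by (simp add: divide_le_eq power2_eq_square mult_ac)
      qed
      have "((\<lambda>y. C * norm (y - p)) \<longlongrightarrow> C * norm (p - p)) (at p)" by (intro tendsto_intros)
      then show "((\<lambda>y. C * norm (y - p)) \<longlongrightarrow> 0) (at p)" by simp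
    qed
  qed
  then show ?thesis unfolding cdiff2_def by blast
qed

text \<open>Differentiation under the integral sign by hand: since the improper integral need not converge
absolutely, the first-order remainder of the integrand is estimated as a holomorphic function with
an \<open>O(\<bar>h\<bar>\<^sup>2 / z\<^sup>2)\<close> bound, to which \<open>line_integral_bound\<close> applies.\<close>

lemma cdiff2_line_integral:
  assumes k: "k > 0" and \<eta>: "smooth_line \<eta>" "range \<eta> \<subseteq> off_cuts k \<beta>0" "\<alpha>0 \<notin> range \<eta>"
  shows "cdiff2 (\<lambda>p. line_integral \<eta> (\<lambda>z. log_p k (fst p) z / (z - snd p))) (\<beta>0, \<alpha>0)"
proof -
  let ?\<kappa> = "kappa (of_real k)"
  obtain r c M R where r: "r > 0" and c: "c > 0" and M: "M \<ge> 0" and R: "R > 0"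
    and bounds: "\<And>\<beta> \<alpha> z. \<beta> \<in> ball \<beta>0 r \<Longrightarrow> \<alpha> \<in> ball \<alpha>0 r \<Longrightarrow> z \<in> range \<eta> \<union> {z. R < \<bar>Re z\<bar>} \<Longrightarrow>
       z \<in> off_cuts k \<beta> \<and> c * (1 + norm z) \<le> norm (?\<kappa> z + \<beta>) \<and>
       c * (1 + norm z) \<le> norm (z - \<alpha>) \<and> norm (log_p k \<beta> z) \<le> M / (1 + norm z)"
    using log_p_uniform_bounds[OF k \<eta>] by blast
  obtain L where L: "L \<ge> 0" and Lb: "\<And>h C. h holomorphic_on {z. R < \<bar>Re z\<bar>} \<Longrightarrow> continuous_on (range \<eta>) h \<Longrightarrow>
     (\<And>z. z \<in> range \<eta> \<union> {z. R < \<bar>Re z\<bar>} \<Longrightarrow> norm (h z) \<le> C / (1 + norm z)\<^sup>2) \<Longrightarrow>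
     (\<lambda>s. h (\<eta> s) * vector_derivative \<eta> (at s)) integrable_on UNIV \<and> norm (line_integral \<eta> h) \<le> L * C"
    using line_integral_bound[OF \<eta>(1) R] by blast
  let ?Z = "range \<eta> \<union> {z. R < \<bar>Re z\<bar>}"
  have w: "1 + norm z \<ge> 1" "c * (1 + norm z) > 0" for z :: complex using c by (auto simp: add_pos_nonneg)
  have ne: "z \<in> off_cuts k \<beta>" "?\<kappa> z + \<beta> \<noteq> 0" "z \<noteq> \<alpha>"
    if "\<beta> \<in> ball \<beta>0 r" "\<alpha> \<in> ball \<alpha>0 r" "z \<in> ?Z" for \<beta> \<alpha> z
  proof -
    show "z \<in> off_cuts k \<beta>" using bounds[OF that] by blast
    have "0 < norm (?\<kappa> z + \<beta>)" "0 < norm (z - \<alpha>)" using bounds[OF that] w(2)[of z] by linarith+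
    then show "?\<kappa> z + \<beta> \<noteq> 0" "z \<noteq> \<alpha>" by auto
  qed
  have p0: "\<beta>0 \<in> ball \<beta>0 r" "\<alpha>0 \<in> ball \<alpha>0 r" using r by auto
  have klog: "log_p k \<beta> holomorphic_on Z'" if "\<beta> \<in> ball \<beta>0 r" "Z' \<subseteq> ?Z" for \<beta> Z'
    by (rule holomorphic_on_subset[OF log_p_holomorphic]) (use ne(1)[OF that(1) p0(2)] that(2) in blast)
  have khol: "?\<kappa> holomorphic_on Z'" if "Z' \<subseteq> ?Z" for Z'
    by (rule holomorphic_on_subset[OF kappa_holomorphic])
      (use ne(1)[OF p0 subsetD[OF that]] in \<open>auto simp: off_cuts_def\<close>)
  define fu where "fu = (\<lambda>p z. log_p k (fst p) z / (z - snd p))"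
  define fa where "fa = (\<lambda>z. 1 / (?\<kappa> z + \<beta>0) / (z - \<alpha>0))"
  define fb where "fb = (\<lambda>z. log_p k \<beta>0 z / (z - \<alpha>0)\<^sup>2)"
  have hfu: "fu (\<beta>, \<alpha>) holomorphic_on Z'"
    if \<beta>: "\<beta> \<in> ball \<beta>0 r" and \<alpha>: "\<alpha> \<in> ball \<alpha>0 r" and Z': "Z' \<subseteq> ?Z" for \<beta> \<alpha> Z'
  proof -
    have "z - \<alpha> \<noteq> 0" if "z \<in> Z'" for z
      using ne(3)[OF \<beta> \<alpha> subsetD[OF Z' that]] by simp
    then show ?thesis unfolding fu_def fst_conv snd_conv
      by (intro holomorphic_on_divide klog[OF \<beta> Z'] holomorphic_intros)
  qed
  have n0: "z - \<alpha>0 \<noteq> 0" "?\<kappa> z + \<beta>0 \<noteq> 0" if "Z' \<subseteq> ?Z" "z \<in> Z'" for z Z'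
    using ne(2,3)[OF p0 subsetD[OF that]] by simp_all
  have hfa: "fa holomorphic_on Z'" if Z': "Z' \<subseteq> ?Z" for Z'
    unfolding fa_def
    by (intro holomorphic_on_divide holomorphic_on_add khol[OF Z'] holomorphic_on_diff holomorphic_on_const
        holomorphic_on_ident n0[OF Z'])
  have hfb: "fb holomorphic_on Z'" if Z': "Z' \<subseteq> ?Z" for Z'
    unfolding fb_def
    by (intro holomorphic_on_divide klog[OF p0(1) Z'] holomorphic_on_power holomorphic_on_diff
        holomorphic_on_const holomorphic_on_ident) (simp add: n0(1)[OF Z', simplified])
  have sub: "{z. R < \<bar>Re z\<bar>} \<subseteq> ?Z" "range \<eta> \<subseteq> ?Z" by auto
  have ifu: "(\<lambda>s. fu (\<beta>, \<alpha>) (\<eta> s) * vector_derivative \<eta> (at s)) integrable_on UNIV"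
    if \<beta>: "\<beta> \<in> ball \<beta>0 r" and \<alpha>: "\<alpha> \<in> ball \<alpha>0 r" for \<beta> \<alpha>
  proof (rule Lb[THEN conjunct1])
    show "norm (fu (\<beta>, \<alpha>) z) \<le> M / c / (1 + norm z)\<^sup>2" if z: "z \<in> ?Z" for z
    proof -
      have "norm (fu (\<beta>, \<alpha>) z) \<le> M / (1 + norm z) / (c * (1 + norm z))"
        unfolding fu_def norm_divide fst_conv snd_conv
        using bounds[OF \<beta> \<alpha> z] w[of z] M by (intro frac_le) auto
      then show ?thesis by (simp add: power2_eq_square mult_ac)
    qed
  qed (intro hfu[OF \<beta> \<alpha>] holomorphic_on_imp_continuous_on sub)+
  have ifa: "(\<lambda>s. fa (\<eta> s) * vector_derivative \<eta> (at s)) integrable_on UNIV"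
  proof (rule Lb[THEN conjunct1])
    show "norm (fa z) \<le> (1 / c\<^sup>2) / (1 + norm z)\<^sup>2" if z: "z \<in> ?Z" for z
    proof -
      have "norm (fa z) \<le> 1 / (c * (1 + norm z)) / (c * (1 + norm z))"
        unfolding fa_def norm_divide
        using bounds[OF p0 z] w[of z] by (intro frac_le) auto
      then show ?thesis by (simp add: power2_eq_square mult_ac)
    qed
  qed (intro hfa holomorphic_on_imp_continuous_on sub)+
  have ifb: "(\<lambda>s. fb (\<eta> s) * vector_derivative \<eta> (at s)) integrable_on UNIV"
  proof (rule Lb[THEN conjunct1])
    show "norm (fb z) \<le> M / c\<^sup>2 / (1 + norm z)\<^sup>2" if z: "z \<in> ?Z" for z
    proof -
      have "norm (log_p k \<beta>0 z) \<le> M / 1"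
        using bounds[OF p0 z] w[of z] M by (meson divide_left_mono order_trans zero_less_one mult_pos_pos less_le_trans)
      then have "norm (fb z) \<le> M / (c * (1 + norm z))\<^sup>2"
        unfolding fb_def norm_divide norm_power
        using bounds[OF p0 z] w[of z] M by (intro frac_le power_mono) auto
      then show ?thesis by (simp add: power_mult_distrib)
    qed
  qed (intro hfb holomorphic_on_imp_continuous_on sub)+
  show ?thesis
  proof (rule cdiff2_quadratic_bound[OF r, where a="line_integral \<eta> fa" and b="line_integral \<eta> fb" and C="L * ((2 + M) / c ^ 3)"])
    fix x :: "complex \<times> complex" assume x: "norm x < r"
    obtain h1 h2 where x_eq: "x = (h1, h2)" by (cases x)
    have n: "norm h1 \<le> norm x" "norm h2 \<le> norm x"
      using norm_fst_le[of h1 h2] norm_snd_le[of h2 h1] by (auto simp: x_eq)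
    have b: "\<beta>0 + h1 \<in> ball \<beta>0 r" "\<alpha>0 + h2 \<in> ball \<alpha>0 r" using n x by (auto simp: dist_norm)
    define rem where "rem z = fu (\<beta>0 + h1, \<alpha>0 + h2) z - fu (\<beta>0, \<alpha>0) z - h1 * fa z - h2 * fb z" for z
    have lin: "line_integral \<eta> rem = line_integral \<eta> (fu (\<beta>0 + h1, \<alpha>0 + h2)) - line_integral \<eta> (fu (\<beta>0, \<alpha>0))
        - h1 * line_integral \<eta> fa - h2 * line_integral \<eta> fb"
    proof -
      let ?d = "\<lambda>s. vector_derivative \<eta> (at s)"
      have ih: "(\<lambda>s. h1 * (fa (\<eta> s) * ?d s)) integrable_on UNIV" "(\<lambda>s. h2 * (fb (\<eta> s) * ?d s)) integrable_on UNIV"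
        using ifa ifb by (auto intro: integrable_on_mult_right)
      have "line_integral \<eta> rem = integral UNIV (\<lambda>s. fu (\<beta>0 + h1, \<alpha>0 + h2) (\<eta> s) * ?d s - fu (\<beta>0, \<alpha>0) (\<eta> s) * ?d s
          - h1 * (fa (\<eta> s) * ?d s) - h2 * (fb (\<eta> s) * ?d s))"
        unfolding line_integral_def rem_def by (simp add: algebra_simps)
      also have "\<dots> = line_integral \<eta> (fu (\<beta>0 + h1, \<alpha>0 + h2)) - line_integral \<eta> (fu (\<beta>0, \<alpha>0))
        - h1 * line_integral \<eta> fa - h2 * line_integral \<eta> fb"
        unfolding line_integral_def
        using ifu[OF b] ifu[OF p0] ih by (simp add: integral_diff integrable_diff)
      finally show ?thesis .
    qed
    have "norm (line_integral \<eta> rem) \<le> L * (((2 + M) / c ^ 3) * (norm x)\<^sup>2)"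
    proof (rule Lb[THEN conjunct2])
      show "rem holomorphic_on {z. R < \<bar>Re z\<bar>}"
        unfolding rem_def by (intro holomorphic_intros hfu hfa hfb b p0 sub)
      show "continuous_on (range \<eta>) rem"
        unfolding rem_def
        by (intro continuous_intros holomorphic_on_imp_continuous_on hfu hfa hfb b p0 sub)
      show "norm (rem z) \<le> ((2 + M) / c ^ 3) * (norm x)\<^sup>2 / (1 + norm z)\<^sup>2" if z: "z \<in> ?Z" for z
        unfolding rem_def fu_def fa_def fb_def fst_conv snd_conv
      proof (rule quotient_taylor_bound[OF w(1) c n M])
        define q where "q = ?\<kappa> z + \<beta>0"
        show "c * (1 + norm z) \<le> norm (?\<kappa> z + \<beta>0)" "c * (1 + norm z) \<le> norm (z - \<alpha>0)"
             "norm (log_p k \<beta>0 z) \<le> M / (1 + norm z)"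
          using bounds[OF p0 z] by auto
        show "c * (1 + norm z) \<le> norm (z - (\<alpha>0 + h2))" using bounds[OF b z] by auto
        have seg: "closed_segment \<beta>0 (\<beta>0 + h1) \<subseteq> ball \<beta>0 r"
          using b p0 by (intro closed_segment_subset) auto
        have "norm ((log_p k (\<beta>0 + h1) z - (\<beta>0 + h1) / q) - (log_p k \<beta>0 z - \<beta>0 / q))
            \<le> norm x / (c * (1 + norm z))\<^sup>2 * norm (\<beta>0 + h1 - \<beta>0)"
        proof (rule field_differentiable_bound[where S="closed_segment \<beta>0 (\<beta>0 + h1)"
              and f="\<lambda>\<beta>. log_p k \<beta> z - \<beta> / q" and f'="\<lambda>\<beta>. 1 / (?\<kappa> z + \<beta>) - 1 / q"])
          fix \<beta> assume \<beta>: "\<beta> \<in> closed_segment \<beta>0 (\<beta>0 + h1)"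
          then have \<beta>b: "\<beta> \<in> ball \<beta>0 r" using seg by blast
          have q0: "q \<noteq> 0" using ne(2)[OF p0 z] by (simp add: q_def)
          show "((\<lambda>\<beta>. log_p k \<beta> z - \<beta> / q) has_field_derivative 1 / (?\<kappa> z + \<beta>) - 1 / q)
             (at \<beta> within closed_segment \<beta>0 (\<beta>0 + h1))"
            using log_p_has_field_derivative[OF ne(1)[OF \<beta>b p0(2) z]] q0
            by (auto intro!: derivative_eq_intros)
          have "1 / (?\<kappa> z + \<beta>) - 1 / q = (\<beta>0 - \<beta>) / ((?\<kappa> z + \<beta>) * q)"
            using ne(2)[OF \<beta>b p0(2) z] q0 by (simp add: q_def field_simps)
          also have "norm \<dots> \<le> norm x / ((c * (1 + norm z)) * (c * (1 + norm z)))"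
            unfolding norm_divide norm_mult
          proof (intro frac_le mult_mono mult_pos_pos)
            have "dist \<beta>0 \<beta> \<le> dist \<beta>0 (\<beta>0 + h1)" using segment_bound1[OF \<beta>] by (simp add: dist_norm norm_minus_commute)
            then show "norm (\<beta>0 - \<beta>) \<le> norm x" using n(1) by (simp add: dist_norm)
            show "c * (1 + norm z) \<le> norm (?\<kappa> z + \<beta>)" using bounds[OF \<beta>b p0(2) z] by blast
            show "c * (1 + norm z) \<le> norm q" using bounds[OF p0 z] by (simp add: q_def)
          qed (use w[of z] c in \<open>auto simp: add_pos_nonneg\<close>)
          finally show "norm (1 / (?\<kappa> z + \<beta>) - 1 / q) \<le> norm x / (c * (1 + norm z))\<^sup>2"
            by (simp add: power2_eq_square)
        qed auto
        also have "\<dots> \<le> norm x / (c * (1 + norm z))\<^sup>2 * norm x"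
          using n(1) by (intro mult_left_mono) auto
        finally show "norm (log_p k (\<beta>0 + h1) z - log_p k \<beta>0 z - h1 / (?\<kappa> z + \<beta>0)) \<le> (norm x)\<^sup>2 / (c * (1 + norm z))\<^sup>2"
          by (simp add: q_def add_divide_distrib power2_eq_square algebra_simps)
      qed
    qed
    then show "norm (line_integral \<eta> (\<lambda>z. log_p k (fst ((\<beta>0, \<alpha>0) + x)) z / (z - snd ((\<beta>0, \<alpha>0) + x)))
         - line_integral \<eta> (\<lambda>z. log_p k (fst (\<beta>0, \<alpha>0)) z / (z - snd (\<beta>0, \<alpha>0)))
         - (line_integral \<eta> fa * fst x + line_integral \<eta> fb * snd x)) \<le> L * ((2 + M) / c ^ 3) * (norm x)\<^sup>2"
      unfolding lin by (simp add: x_eq fu_def algebra_simps)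
  qed
qed

section \<open>Analyticity of the four factors\<close>

lemma cdiff2_transform:
  assumes "cdiff2 f p" "open N" "p \<in> N" "\<And>q. q \<in> N \<Longrightarrow> f q = g q"
  shows "cdiff2 g p"
  using assms has_derivative_transform_within_open unfolding cdiff2_def by blast

lemma zero_in_dn_cut: "0 \<in> dn_cut"
  by (simp add: dn_cut_Re_Im)

lemma ray_below:
  assumes "w \<in> below A" "\<And>t. t \<ge> 0 \<Longrightarrow> w - \<i> * of_real t \<notin> A" "t \<ge> 0"
  shows "w - \<i> * of_real t \<in> below A"
proof -
  let ?C = "(\<lambda>t. w - \<i> * of_real t) ` {0..}"
  have "?C \<subseteq> below A"
  proof (rule below_subset)
    show "connected ?C" by (intro connected_continuous_image continuous_intros) auto
    have "w \<in> ?C" by (rule image_eqI[of _ _ 0]) auto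
    then show "?C \<inter> below A \<noteq> {}" using assms(1) by blast
  qed (use assms in auto)
  then show ?thesis using assms(3) by auto
qed

lemma UHP_below_disjoint:
  assumes "smooth_line \<gamma>"
  shows "UHP \<gamma> \<inter> below (range \<gamma>) = {}"
  using above_below_disjoint[OF assms] above_below_range_disjoint[of "range \<gamma>"]
  by (auto simp: UHP_def)

text \<open>The cut consists of the points vertically below \<open>- w\<close>. That ray starts below the line and does not meet
it.\<close>

lemma UHP_off_dn_cut:
  assumes \<gamma>: "smooth_line \<gamma>" and w: "- w \<in> below (range \<gamma>)" "range \<gamma> \<inter> kappa_cuts w = {}" and z: "z \<in> UHP \<gamma>"
  shows "w + z \<notin> dn_cut"
proof
  assume "w + z \<in> dn_cut"
  then obtain t where t: "t \<ge> 0" "w + z = - \<i> * of_real t" by (auto simp: dn_cut_def)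
  then have z_eq: "z = - w - \<i> * of_real t" by (simp add: algebra_simps eq_neg_iff_add_eq_0)
  have "- w - \<i> * of_real t \<in> below (range \<gamma>)"
  proof (rule ray_below[OF w(1) _ t(1)])
    fix u :: real assume "u \<ge> 0"
    then have "w + (- w - \<i> * of_real u) \<in> dn_cut" by (auto simp: dn_cut_def)
    then have "- w - \<i> * of_real u \<in> kappa_cuts w" unfolding kappa_cuts_def by blast
    then show "- w - \<i> * of_real u \<notin> range \<gamma>" using w(2) by blast
  qed
  then show False using z UHP_below_disjoint[OF \<gamma>] by (auto simp: z_eq)
qed

lemma LHP_off_dn_cut:
  assumes \<gamma>: "smooth_line \<gamma>" and w: "w \<in> above (range \<gamma>)" "range \<gamma> \<inter> kappa_cuts w = {}" and z: "z \<in> LHP \<gamma>"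
  shows "w - z \<notin> dn_cut"
proof -
  have "w + - z \<notin> dn_cut"
  proof (rule UHP_off_dn_cut[OF smooth_line_reflect(1)[OF \<gamma>]])
    show "- w \<in> below (range (\<lambda>s. - \<gamma> (- s)))" using w(1) by (simp add: range_uminus below_uminus)
    show "range (\<lambda>s. - \<gamma> (- s)) \<inter> kappa_cuts w = {}"
      using w(2) by (auto simp: range_uminus kappa_cuts_uminus)
    show "- z \<in> UHP (\<lambda>s. - \<gamma> (- s))" using z by (simp add: LHP_uminus)
  qed
  then show ?thesis by simp
qed

lemma prefactor_has_field_derivative:
  assumes "w + \<alpha> \<notin> dn_cut"
  shows "\<exists>D. ((\<lambda>\<alpha>. 1 / sqrt_dn (sqrt_dn (w + \<alpha>))) has_field_derivative D) (at \<alpha>)"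
proof -
  let ?W = "{\<alpha>. w + \<alpha> \<notin> dn_cut}"
  have "open ?W"
  proof -
    have "?W = (\<lambda>\<alpha>. w + \<alpha>) -` (- dn_cut)" by auto
    then show ?thesis by (auto intro!: open_vimage continuous_intros simp: open_Compl closed_dn_cut)
  qed
  have nz: "w + \<alpha> \<noteq> 0" if "w + \<alpha> \<notin> dn_cut" for \<alpha>
    using that zero_in_dn_cut by metis
  then have nz': "sqrt_dn (w + \<alpha>) \<noteq> 0" if "w + \<alpha> \<notin> dn_cut" for \<alpha> using that by (simp add: sqrt_dn_eq_0)
  have "(\<lambda>\<alpha>. 1 / sqrt_dn (sqrt_dn (w + \<alpha>))) holomorphic_on ?W"
    by (intro holomorphic_intros holomorphic_on_sqrt_dn) (auto simp: sqrt_dn_notin_dn_cut sqrt_dn_eq_0 nz)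
  then show ?thesis using assms \<open>open ?W\<close> holomorphic_on_imp_differentiable_at[of _ ?W \<alpha>]
    by (auto simp: field_differentiable_def)
qed

text \<open>The extension is defined at \<open>(\<beta>, \<alpha>)\<close> by the integral over \<open>\<gamma> - i\<epsilon>\<close> for any \<open>\<epsilon>\<close> that is good for \<open>\<beta>\<close> and for
which \<open>\<alpha>\<close> is above that contour. The value does not depend on \<open>\<epsilon>\<close>, so the local definitions agree and no
gluing argument on intersections of neighbourhoods is required. For \<open>\<beta> = 0\<close> the shift prescribed in the
factor may fail to be good, but then both integrals vanish.\<close>

lemma K_pp_analytic:
  assumes k: "k > 0" and \<gamma>: "smooth_line \<gamma>" and cuts: "range \<gamma> \<inter> kappa_cuts (of_real k) = {}"
    and below: "- of_real k \<in> below (range \<gamma>)"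
    and adm: "\<And>\<beta> \<alpha>. \<beta> \<in> S \<Longrightarrow> \<alpha> \<in> UHP \<gamma> \<Longrightarrow> admissible_shift \<gamma> (log_p k \<beta>) (\<epsilon> (\<beta>, \<alpha>))"
  shows "analytic2_on (K_pp k \<gamma> \<epsilon>) (S \<times> UHP \<gamma>)"
proof -
  define good where "good p e \<longleftrightarrow> good_shift k \<gamma> (fst p) e \<and> snd p \<in> above (range (shift_b \<gamma> e))"
    for p :: "complex \<times> complex" and e
  define J where "J e p = line_integral (shift_b \<gamma> e) (\<lambda>z. log_p k (fst p) z / (z - snd p))"
    for p :: "complex \<times> complex" and e
  define I where "I p = J (SOME e. good p e) p" for p
  define U where "U = {p. (\<exists>e. good p e) \<and> of_real k + snd p \<notin> dn_cut}"
  define F where "F p = 1 / sqrt_dn (sqrt_dn (of_real k + snd p)) * exp (- 1 / (4 * \<i> * pi) * I p)" for p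
  have I_eq: "I p = J e p" if "good p e" for p e
  proof -
    have "good p (SOME e. good p e)" using that by (rule someI)
    then show ?thesis using that unfolding I_def J_def good_def
      by (intro line_integral_shift_b_unique[OF k \<gamma>]) auto
  qed
  have good_open: "\<exists>N. open N \<and> p \<in> N \<and> (\<forall>q\<in>N. good q e)" if "good p e" for p e
  proof -
    have "good_shift k \<gamma> (fst p) e" using that by (simp add: good_def)
    then obtain r where r: "r > 0" "\<And>\<beta>. \<beta> \<in> ball (fst p) r \<Longrightarrow> good_shift k \<gamma> \<beta> e"
      using good_shift_open[OF k \<gamma>] by blast
    show ?thesis
      by (rule exI[of _ "ball (fst p) r \<times> above (range (shift_b \<gamma> e))"])
        (use r that above_connected_open(2)[OF smooth_line_shift(2)[OF \<gamma>]] in \<open>auto simp: good_def mem_Times_iff intro!: open_Times\<close>)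
  qed
  have "open U"
  proof -
    have "U = {p. \<exists>e. good p e} \<inter> (\<lambda>p. of_real k + snd p) -` (- dn_cut)" by (auto simp: U_def)
    moreover have "open {p. \<exists>e. good p e}"
    proof (subst open_subopen, rule ballI)
      fix p assume "p \<in> {p. \<exists>e. good p e}"
      then obtain e where "good p e" by blast
      from good_open[OF this] show "\<exists>N. open N \<and> p \<in> N \<and> N \<subseteq> {p. \<exists>e. good p e}" by blast
    qed
    moreover have "open ((\<lambda>p::complex \<times> complex. of_real k + snd p) -` (- dn_cut))"
      by (intro open_vimage continuous_intros) (simp add: open_Compl closed_dn_cut)
    ultimately show ?thesis by auto
  qed
  have "cdiff2 F p" if p: "p \<in> U" for p
  proof -
    obtain e where e: "good p e" using p by (auto simp: U_def)
    obtain N where N: "open N" "p \<in> N" "\<And>q. q \<in> N \<Longrightarrow> good q e" using good_open[OF e] by blast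
    have "cdiff2 (J e) (fst p, snd p)"
      unfolding J_def
    proof (rule cdiff2_line_integral[OF k smooth_line_shift(2)[OF \<gamma>]])
      show "range (shift_b \<gamma> e) \<subseteq> off_cuts k (fst p)" using e by (auto simp: good_def good_shift_def shift_b_def)
      show "snd p \<notin> range (shift_b \<gamma> e)"
        using e above_below_range_disjoint(1)[of "range (shift_b \<gamma> e)"] by (auto simp: good_def)
    qed
    then have "cdiff2 (J e) p" by simp
    then have cI: "cdiff2 I p" by (rule cdiff2_transform[OF _ N(1,2)]) (rule I_eq[OF N(3), symmetric])
    have "((\<lambda>z. exp (- 1 / (4 * \<i> * pi) * z)) has_field_derivative
        (- 1 / (4 * \<i> * pi)) * exp (- 1 / (4 * \<i> * pi) * I p)) (at (I p))"
      by (auto intro!: derivative_eq_intros)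
    note cexp = cdiff2_compose[OF cI this]
    obtain D where "((\<lambda>\<alpha>. 1 / sqrt_dn (sqrt_dn (of_real k + \<alpha>))) has_field_derivative D) (at (snd p))"
      using prefactor_has_field_derivative[of "of_real k" "snd p"] p by (auto simp: U_def)
    note cpre = cdiff2_compose[OF cdiff2_snd this]
    show ?thesis unfolding F_def by (rule cdiff2_mult[OF cpre cexp])
  qed
  then have "holomorphic2_on F U" using \<open>open U\<close> by (simp add: holomorphic2_on_def cdiff2_def)
  moreover have "p \<in> U \<and> F p = K_pp k \<gamma> \<epsilon> p" if p: "p \<in> S \<times> UHP \<gamma>" for p
  proof -
    obtain \<beta> \<alpha> where p_eq: "p = (\<beta>, \<alpha>)" by (cases p)
    have \<beta>: "\<beta> \<in> S" and \<alpha>: "\<alpha> \<in> UHP \<gamma>" using p by (auto simp: p_eq)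
    note ad = adm[OF \<beta> \<alpha>]
    have good_intro: "good p e" if "good_shift k \<gamma> \<beta> e" for e
      using that \<alpha> UHP_subset_above_shift_b[OF \<gamma> that] by (auto simp: good_def p_eq)
    have "\<exists>e. good p e"
      using good_intro admissible_imp_good_shift[OF k _ ad] admissible_imp_good_shift_0[OF k \<gamma> cuts] ad by blast
    then have "p \<in> U" using UHP_off_dn_cut[OF \<gamma> below cuts \<alpha>] by (simp add: U_def p_eq)
    moreover have "I p = J (\<epsilon> p) p"
    proof (cases "\<beta> = 0")
      case True
      then show ?thesis by (simp add: I_def J_def p_eq log_p_0 line_integral_0)
    next
      case False
      then show ?thesis using I_eq[OF good_intro[OF admissible_imp_good_shift[OF k False ad]]] by (simp add: p_eq)
    qed
    ultimately show ?thesis by (simp add: F_def K_pp_def J_def p_eq)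
  qed
  ultimately show ?thesis unfolding analytic2_on_def by blast
qed

lemma analytic2_on_rescale:
  assumes "analytic2_on f S" and g: "\<And>a b. (a, b) \<in> T \<Longrightarrow> (\<sigma> * a, \<tau> * b) \<in> S \<and> g (a, b) = f (\<sigma> * a, \<tau> * b)"
  shows "analytic2_on g T"
proof -
  obtain U F where U: "S \<subseteq> U" "open U" "\<And>p. p \<in> U \<Longrightarrow> cdiff2 F p" "\<And>p. p \<in> S \<Longrightarrow> F p = f p"
    using assms(1) unfolding analytic2_on_def holomorphic2_on_def cdiff2_def by blast
  define l where "l p = (\<sigma> * fst p, \<tau> * snd p)" for p :: "complex \<times> complex"
  have "continuous_on UNIV l" unfolding l_def by (intro continuous_intros)
  then have op: "open (l -` U)" using U(2) by (intro open_vimage)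
  have "\<exists>a b. ((\<lambda>p. F (l p)) has_derivative (\<lambda>h. a * fst h + b * snd h)) (at p)" if "p \<in> l -` U" for p
  proof -
    obtain a b where F: "(F has_derivative (\<lambda>h. a * fst h + b * snd h)) (at (l p))"
      using U(3)[of "l p"] \<open>p \<in> l -` U\<close> by (auto simp: cdiff2_def)
    have "(l has_derivative (\<lambda>h. (\<sigma> * fst h, \<tau> * snd h))) (at p)"
      unfolding l_def by (auto intro!: derivative_eq_intros)
    from has_derivative_compose[OF this F] show ?thesis
      by (intro exI[of _ "a * \<sigma>"] exI[of _ "b * \<tau>"]) (simp add: mult.assoc)
  qed
  then have "holomorphic2_on (\<lambda>p. F (l p)) (l -` U)" using op by (simp add: holomorphic2_on_def)
  moreover have "l p \<in> S \<and> g p = f (l p)" if "p \<in> T" for p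
    using g[of "fst p" "snd p"] that by (simp add: l_def)
  then have "T \<subseteq> l -` U" "\<forall>p\<in>T. F (l p) = g p" using U(1,4) by auto
  ultimately show ?thesis unfolding analytic2_on_def by blast
qed

lemma log_m_eq: "log_m k \<beta> = log_p k (- \<beta>)"
  by (simp add: log_m_def log_p_def)

lemma integral_UNIV_reflect:
  fixes f :: "real \<Rightarrow> complex"
  shows "integral UNIV (\<lambda>s. f (- s)) = integral UNIV f"
proof -
  have *: "((\<lambda>s. g (- s)) has_integral i) UNIV" if "(g has_integral i) UNIV" for g :: "real \<Rightarrow> complex" and i
    unfolding has_integral_alt'
  proof (intro conjI allI impI)
    have g: "g integrable_on cbox a b" for a b using that by (auto simp: has_integral_alt'[of g])
    show "(\<lambda>x. if x \<in> UNIV then g (- x) else 0) integrable_on cbox a b" for a b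
      using Henstock_Kurzweil_Integration.integrable_reflect[of g "- a" "- b"] g by simp
    fix e :: real assume "e > 0"
    moreover have "\<forall>e>0. \<exists>B>0. \<forall>a b. ball 0 B \<subseteq> cbox a b \<longrightarrow> norm (integral (cbox a b) g - i) < e"
      using that unfolding has_integral_alt'[of g] by simp
    ultimately obtain B where B: "B > 0" "\<And>a b. ball 0 B \<subseteq> cbox a b \<Longrightarrow> norm (integral (cbox a b) g - i) < e"
      by blast
    have "norm (integral (cbox a b) (\<lambda>x. g (- x)) - i) < e" if "ball 0 B \<subseteq> cbox a b" for a b
    proof -
      have "x \<in> cbox (- b) (- a)" if "x \<in> ball 0 B" for x
        using subsetD[OF \<open>ball 0 B \<subseteq> cbox a b\<close>, of "- x"] that by auto
      then have "norm (integral (cbox (- b) (- a)) g - i) < e" by (intro B(2)) blast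
      then show ?thesis using Henstock_Kurzweil_Integration.integral_reflect[of "- a" "- b" g] by simp
    qed
    then show "\<exists>B>0. \<forall>a b. ball 0 B \<subseteq> cbox a b \<longrightarrow>
         norm (integral (cbox a b) (\<lambda>x. if x \<in> UNIV then g (- x) else 0) - i) < e"
      using B(1) by auto
  qed
  have iff: "((\<lambda>s. f (- s)) has_integral i) UNIV \<longleftrightarrow> (f has_integral i) UNIV" for i
    using *[of f i] *[of "\<lambda>s. f (- s)" i] by auto
  then show ?thesis unfolding integral_def integrable_on_def by simp
qed

text \<open>Under \<open>z \<mapsto> - z\<close> the upper shift of the line becomes the lower shift of the reflected line, again oriented
from left to right, and \<open>log_p\<close> is even.\<close>

lemma line_integral_shift_reflect:
  assumes \<gamma>: "smooth_line \<gamma>"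
  shows "line_integral (shift_b (\<lambda>s. - \<gamma> (- s)) \<epsilon>) (\<lambda>z. log_p k \<beta> z / (z - (- \<alpha>)))
       = - line_integral (shift_a \<gamma> \<epsilon>) (\<lambda>z. log_p k \<beta> z / (z - \<alpha>))"
proof -
  have vd: "vector_derivative (shift_b (\<lambda>s. - \<gamma> (- s)) \<epsilon>) (at s) = vector_derivative \<gamma> (at (- s))" for s
    using smooth_line_shift(4)[OF smooth_line_reflect(1)[OF \<gamma>]] smooth_line_reflect(2)[OF \<gamma>] by simp
  have sh: "shift_b (\<lambda>s. - \<gamma> (- s)) \<epsilon> s = - shift_a \<gamma> \<epsilon> (- s)" for s
    by (simp add: shift_a_def shift_b_def)
  have dv: "x / (- y - - \<alpha>) = - (x / (y - \<alpha>))" for x y :: complex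
    by (metis minus_diff_eq minus_diff_minus minus_divide_right)
  have "line_integral (shift_b (\<lambda>s. - \<gamma> (- s)) \<epsilon>) (\<lambda>z. log_p k \<beta> z / (z - (- \<alpha>)))
      = integral UNIV (\<lambda>s. (\<lambda>s. - (log_p k \<beta> (shift_a \<gamma> \<epsilon> s) / (shift_a \<gamma> \<epsilon> s - \<alpha>) * vector_derivative \<gamma> (at s))) (- s))"
    unfolding line_integral_def vd sh log_p_uminus dv by simp
  also have "\<dots> = - line_integral (shift_a \<gamma> \<epsilon>) (\<lambda>z. log_p k \<beta> z / (z - \<alpha>))"
    unfolding integral_UNIV_reflect[of "\<lambda>s. - (log_p k \<beta> (shift_a \<gamma> \<epsilon> s) / (shift_a \<gamma> \<epsilon> s - \<alpha>) * vector_derivative \<gamma> (at s))"]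
      line_integral_def smooth_line_shift(3)[OF \<gamma>] by simp
  finally show ?thesis .
qed

lemma range_shift_reflect:
  "range (shift_a (\<lambda>s. - \<gamma> (- s)) t) = uminus ` range (shift_b \<gamma> t)"
  "range (shift_b (\<lambda>s. - \<gamma> (- s)) t) = uminus ` range (shift_a \<gamma> t)"
proof -
  have "shift_a (\<lambda>s. - \<gamma> (- s)) t = (\<lambda>s. - shift_b \<gamma> t (- s))" "shift_b (\<lambda>s. - \<gamma> (- s)) t = (\<lambda>s. - shift_a \<gamma> t (- s))"
    by (simp_all add: shift_a_def shift_b_def fun_eq_iff)
  then show "range (shift_a (\<lambda>s. - \<gamma> (- s)) t) = uminus ` range (shift_b \<gamma> t)"
    "range (shift_b (\<lambda>s. - \<gamma> (- s)) t) = uminus ` range (shift_a \<gamma> t)"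
    by (simp_all only: range_uminus)
qed

lemma admissible_shift_reflect:
  assumes "admissible_shift \<gamma> (log_p k \<beta>) \<epsilon>"
  shows "admissible_shift (\<lambda>s. - \<gamma> (- s)) (log_p k \<beta>) \<epsilon>"
  unfolding admissible_shift_def
proof (intro conjI allI impI)
  show "\<epsilon> > 0" using assms by (simp add: admissible_shift_def)
  fix t assume "0 < t \<and> t \<le> \<epsilon>"
  then have "range (shift_a \<gamma> t) \<subseteq> above (range \<gamma>)" "range (shift_b \<gamma> t) \<subseteq> below (range \<gamma>)"
    using assms by (auto simp: admissible_shift_def)
  then show "range (shift_a (\<lambda>s. - \<gamma> (- s)) t) \<subseteq> above (range (\<lambda>s. - \<gamma> (- s)))"
    "range (shift_b (\<lambda>s. - \<gamma> (- s)) t) \<subseteq> below (range (\<lambda>s. - \<gamma> (- s)))"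
    unfolding range_shift_reflect range_uminus above_uminus below_uminus by (simp_all add: image_mono)
next
  let ?Z = "{\<gamma> s + \<i> * of_real t | s t. \<bar>t\<bar> \<le> \<epsilon>}"
  have "log_p k \<beta> \<circ> uminus analytic_on {- \<gamma> (- s) + \<i> * of_real t | s t. \<bar>t\<bar> \<le> \<epsilon>}"
  proof (rule analytic_on_compose_gen)
    show "log_p k \<beta> analytic_on ?Z" using assms by (simp add: admissible_shift_def)
    fix z assume "z \<in> {- \<gamma> (- s) + \<i> * of_real t | s t. \<bar>t\<bar> \<le> \<epsilon>}"
    then obtain s t where "z = - \<gamma> (- s) + \<i> * of_real t" "\<bar>t\<bar> \<le> \<epsilon>" by blast
    then have "- z = \<gamma> (- s) + \<i> * of_real (- t) \<and> \<bar>- t\<bar> \<le> \<epsilon>" by simp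
    then show "- z \<in> ?Z" by blast
  qed (auto intro: analytic_intros)
  moreover have "log_p k \<beta> \<circ> uminus = log_p k \<beta>" by (simp add: fun_eq_iff log_p_uminus)
  ultimately show "log_p k \<beta> analytic_on {- \<gamma> (- s) + \<i> * of_real t | s t. \<bar>t\<bar> \<le> \<epsilon>}" by simp
qed

lemma K_pm_eq:
  assumes "smooth_line \<gamma>"
  shows "K_pm k \<gamma> \<epsilon> (\<beta>, \<alpha>) = K_pp k (\<lambda>s. - \<gamma> (- s)) (\<lambda>(\<beta>, \<alpha>). \<epsilon> (\<beta>, - \<alpha>)) (\<beta>, - \<alpha>)"
proof -
  have "- 1 / (4 * \<i> * pi) * - x = 1 / (4 * \<i> * pi) * x" for x :: complex by simp
  then show ?thesis
    using line_integral_shift_reflect[OF assms, of "\<epsilon> (\<beta>, \<alpha>)" k \<beta> \<alpha>] by (simp add: K_pm_def K_pp_def)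
qed

lemma K_mp_eq: "K_mp k \<gamma> \<epsilon> (\<beta>, \<alpha>) = K_pp k \<gamma> (\<lambda>(\<beta>, \<alpha>). \<epsilon> (- \<beta>, \<alpha>)) (- \<beta>, \<alpha>)"
  by (simp add: K_mp_def K_pp_def log_m_eq)

lemma K_mm_eq: "K_mm k \<gamma> \<epsilon> (\<beta>, \<alpha>) = K_pm k \<gamma> (\<lambda>(\<beta>, \<alpha>). \<epsilon> (- \<beta>, \<alpha>)) (- \<beta>, \<alpha>)"
  by (simp add: K_mm_def K_pm_def log_m_eq)

lemma K_pm_analytic:
  assumes k: "k > 0" and \<gamma>: "smooth_line \<gamma>" and cuts: "range \<gamma> \<inter> kappa_cuts (of_real k) = {}"
    and above: "of_real k \<in> above (range \<gamma>)"
    and adm: "\<And>\<beta> \<alpha>. \<beta> \<in> S \<Longrightarrow> \<alpha> \<in> LHP \<gamma> \<Longrightarrow> admissible_shift \<gamma> (log_p k \<beta>) (\<epsilon> (\<beta>, \<alpha>))"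
  shows "analytic2_on (K_pm k \<gamma> \<epsilon>) (S \<times> LHP \<gamma>)"
proof (rule analytic2_on_rescale[where \<sigma>=1 and \<tau>="- 1"])
  let ?\<gamma> = "\<lambda>s. - \<gamma> (- s)"
  show "analytic2_on (K_pp k ?\<gamma> (\<lambda>(\<beta>, \<alpha>). \<epsilon> (\<beta>, - \<alpha>))) (S \<times> UHP ?\<gamma>)"
  proof (rule K_pp_analytic[OF k smooth_line_reflect(1)[OF \<gamma>]])
    show "range ?\<gamma> \<inter> kappa_cuts (of_real k) = {}"
      using cuts by (auto simp: range_uminus kappa_cuts_uminus)
    show "- of_real k \<in> below (range ?\<gamma>)" using above by (simp add: range_uminus below_uminus)
    show "admissible_shift ?\<gamma> (log_p k \<beta>) (case (\<beta>, \<alpha>) of (\<beta>, \<alpha>) \<Rightarrow> \<epsilon> (\<beta>, - \<alpha>))"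
      if "\<beta> \<in> S" "\<alpha> \<in> UHP ?\<gamma>" for \<beta> \<alpha>
      using that by (auto simp: LHP_uminus intro!: admissible_shift_reflect adm)
  qed
  show "(1 * a, - 1 * b) \<in> S \<times> UHP ?\<gamma> \<and> K_pm k \<gamma> \<epsilon> (a, b) = K_pp k ?\<gamma> (\<lambda>(\<beta>, \<alpha>). \<epsilon> (\<beta>, - \<alpha>)) (1 * a, - 1 * b)"
    if "(a, b) \<in> S \<times> LHP \<gamma>" for a b
    using that K_pm_eq[OF \<gamma>] by (auto simp: LHP_uminus)
qed

section \<open>The product formula\<close>

lemma square_one_const:
  fixes g :: "complex \<Rightarrow> complex"
  assumes "connected S" "continuous_on S g" "\<And>x. x \<in> S \<Longrightarrow> (g x)\<^sup>2 = 1" "x0 \<in> S" "g x0 = 1" "x \<in> S"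
  shows "g x = 1"
proof -
  have "g ` S \<subseteq> {1, - 1}" using assms(3) by (auto simp: power2_eq_1_iff)
  then have "finite (g ` S)" by (rule finite_subset) simp
  from continuous_finite_range_constant[OF assms(1,2) this] show ?thesis
    using assms by (auto simp: constant_on_def)
qed

text \<open>Both sides are square roots of \<open>kappa k \<alpha>\<close> that are continuous along the line, and they agree at \<open>\<alpha> = 0\<close>,
where \<open>kappa k 0 = k\<close>.\<close>

lemma sqrt_dn_kappa:
  assumes \<gamma>: "smooth_line \<gamma>" "0 \<in> range \<gamma>" and cuts: "range \<gamma> \<inter> kappa_cuts (of_real k) = {}"
    and \<kappa>: "\<And>\<alpha>. \<alpha> \<in> range \<gamma> \<Longrightarrow> kappa (of_real k) \<alpha> \<notin> dn_cut" and \<alpha>: "\<alpha> \<in> range \<gamma>"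
  shows "sqrt_dn (kappa (of_real k) \<alpha>) = sqrt_dn (sqrt_dn (of_real k + \<alpha>)) * sqrt_dn (sqrt_dn (of_real k - \<alpha>))"
proof -
  let ?k = "complex_of_real k"
  define q where "q \<alpha> = sqrt_dn (sqrt_dn (?k + \<alpha>)) * sqrt_dn (sqrt_dn (?k - \<alpha>))" for \<alpha>
  have off: "?k + \<alpha> \<notin> dn_cut" "?k - \<alpha> \<notin> dn_cut" "?k + \<alpha> \<noteq> 0" "?k - \<alpha> \<noteq> 0" if "\<alpha> \<in> range \<gamma>" for \<alpha>
  proof -
    show a: "?k + \<alpha> \<notin> dn_cut" "?k - \<alpha> \<notin> dn_cut" using that cuts by (auto simp: kappa_cuts_def)
    show "?k + \<alpha> \<noteq> 0" "?k - \<alpha> \<noteq> 0" using a by (auto simp: dn_cut_iff)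
  qed
  have q0: "q \<alpha> \<noteq> 0" if "\<alpha> \<in> range \<gamma>" for \<alpha> using off[OF that] by (simp add: q_def sqrt_dn_eq_0)
  have q2: "(q \<alpha>)\<^sup>2 = kappa ?k \<alpha>" for \<alpha>
    by (simp add: q_def power_mult_distrib sqrt_dn_square kappa_def mult.commute)
  define g where "g \<alpha> = sqrt_dn (kappa ?k \<alpha>) / q \<alpha>" for \<alpha>
  have "g \<alpha> = 1"
  proof (rule square_one_const[of "range \<gamma>" g 0 \<alpha>])
    show "connected (range \<gamma>)"
      by (intro connected_continuous_image smooth_line_continuous[OF \<gamma>(1)]) auto
    show "continuous_on (range \<gamma>) g"
      unfolding g_def
    proof (rule continuous_on_divide)
      show "continuous_on (range \<gamma>) (\<lambda>\<alpha>. sqrt_dn (kappa ?k \<alpha>))"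
        by (intro holomorphic_on_imp_continuous_on holomorphic_on_sqrt_dn \<kappa>
           holomorphic_on_subset[OF kappa_holomorphic]) (use cuts in auto)
      show "continuous_on (range \<gamma>) q"
        unfolding q_def
        by (intro holomorphic_on_imp_continuous_on holomorphic_on_mult holomorphic_on_sqrt_dn
            holomorphic_on_add holomorphic_on_diff holomorphic_on_const holomorphic_on_ident off)
          (use off in \<open>auto simp: sqrt_dn_notin_dn_cut\<close>)
    qed (use q0 in auto)
    show "(g x)\<^sup>2 = 1" if "x \<in> range \<gamma>" for x
    proof -
      have "kappa ?k x \<noteq> 0" using q0[OF that] q2[of x] by auto
      then show ?thesis by (simp add: g_def power_divide sqrt_dn_square q2)
    qed
    have "kappa ?k 0 = ?k" by (simp add: kappa_def sqrt_dn_square flip: power2_eq_square)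
    moreover have "q 0 = sqrt_dn ?k" by (simp add: q_def sqrt_dn_square flip: power2_eq_square)
    ultimately show "g 0 = 1" using q0[OF \<gamma>(2)] by (simp add: g_def)
  qed (use \<gamma> \<alpha> in auto)
  then show ?thesis using q0[OF \<alpha>] by (simp add: g_def q_def)
qed

text \<open>Both sides are square roots of \<open>1 / (w + \<beta>)\<close>, continuous in \<open>\<beta>\<close>, and they agree at \<open>\<beta> = 0\<close>.\<close>

lemma one_over_sqrt_dn_factor:
  assumes S: "connected S" "0 \<in> S" "\<beta> \<in> S"
    and off: "\<And>\<beta>. \<beta> \<in> S \<Longrightarrow> w + \<beta> \<notin> dn_cut" "\<And>\<beta>. \<beta> \<in> S \<Longrightarrow> 1 + \<beta> / w \<notin> sw_cut"
  shows "1 / sqrt_dn (w + \<beta>) = 1 / sqrt_dn w * exp (- log_sw (1 + \<beta> / w) / 2)"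
proof -
  have w: "w \<noteq> 0" and wb: "\<And>\<beta>. \<beta> \<in> S \<Longrightarrow> w + \<beta> \<noteq> 0"
    using off(1)[OF S(2)] off(1) zero_in_dn_cut by (auto, metis)
  define g where "g \<beta> = sqrt_dn (w + \<beta>) / sqrt_dn w * exp (- log_sw (1 + \<beta> / w) / 2)" for \<beta>
  have "g \<beta> = 1"
  proof (rule square_one_const[OF S(1) _ _ S(2) _ S(3)])
    show "continuous_on S g"
    proof -
      have "continuous_on S (\<lambda>\<beta>. sqrt_dn (w + \<beta>))"
        by (intro holomorphic_on_imp_continuous_on holomorphic_on_sqrt_dn holomorphic_intros off)
      moreover have "continuous_on S (\<lambda>\<beta>. log_sw (1 + \<beta> / w))"
        by (rule continuous_on_compose2[OF holomorphic_on_imp_continuous_on[OF log_sw_holomorphic]])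
          (use w off in \<open>auto intro!: continuous_intros\<close>)
      ultimately show ?thesis unfolding g_def using w
        by (intro continuous_intros) (auto simp: sqrt_dn_eq_0)
    qed
    show "(g x)\<^sup>2 = 1" if x: "x \<in> S" for x
    proof -
      have nz: "1 + x / w \<noteq> 0" using off(2)[OF x] sw_cut_0 by metis
      have "(exp (- log_sw (1 + x / w) / 2))\<^sup>2 = exp (- log_sw (1 + x / w))"
        by (simp add: exp_double[symmetric])
      also have "\<dots> = 1 / (1 + x / w)" by (simp add: exp_minus exp_log_sw[OF nz] inverse_eq_divide)
      finally have "(g x)\<^sup>2 = (w + x) / w * (1 / (1 + x / w))"
        by (simp add: g_def power_mult_distrib power_divide sqrt_dn_square)
      also have "w + x = w * (1 + x / w)" using w by (simp add: distrib_left)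
      finally show ?thesis using w nz by simp
    qed
    show "g 0 = 1" using w by (simp add: g_def log_sw_1 sqrt_dn_eq_0)
  qed
  then show ?thesis using wb[OF S(3)] w by (simp add: g_def field_simps sqrt_dn_eq_0)
qed

lemma connected_UHP:
  assumes \<gamma>: "smooth_line \<gamma>" and a: "\<epsilon> > 0" "\<And>t. 0 < t \<Longrightarrow> t \<le> \<epsilon> \<Longrightarrow> range (shift_a \<gamma> t) \<subseteq> above (range \<gamma>)"
  shows "connected (UHP \<gamma>)"
proof (rule connected_intermediate_closure[OF above_connected_open(1)[OF \<gamma>]])
  show "above (range \<gamma>) \<subseteq> UHP \<gamma>" by (simp add: UHP_def)
  have "\<gamma> s \<in> closure (above (range \<gamma>))" for s
    unfolding closure_approachable
  proof (intro allI impI)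
    fix e :: real assume e: "e > 0"
    define t where "t = min \<epsilon> (e / 2)"
    have t: "0 < t" "t \<le> \<epsilon>" "t < e" using e a(1) by (auto simp: t_def)
    have "shift_a \<gamma> t s \<in> above (range \<gamma>)" using a(2)[OF t(1,2)] by blast
    moreover have "dist (shift_a \<gamma> t s) (\<gamma> s) < e" using t by (simp add: shift_a_def dist_norm norm_mult)
    ultimately show "\<exists>y\<in>above (range \<gamma>). dist y (\<gamma> s) < e" by blast
  qed
  then show "UHP \<gamma> \<subseteq> closure (above (range \<gamma>))" using closure_subset by (auto simp: UHP_def)
qed

text \<open>The set \<open>S\<close> is there to carry the sign from \<open>\<beta> = 0\<close>: it is the upper side of the line for the factors of
\<open>K_po\<close>, and the negative of the lower side for those of \<open>K_mo\<close>.\<close>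

lemma K_pp_K_pm_product:
  assumes k: "k > 0" and \<gamma>: "smooth_line \<gamma>" "0 \<in> range \<gamma>" and cuts: "range \<gamma> \<inter> kappa_cuts (of_real k) = {}"
    and \<kappa>: "\<And>\<alpha>. \<alpha> \<in> range \<gamma> \<Longrightarrow> kappa (of_real k) \<alpha> \<notin> dn_cut"
    and S: "connected S" "0 \<in> S" "\<beta> \<in> S" and \<alpha>: "\<alpha> \<in> range \<gamma>"
    and off: "\<And>\<beta>. \<beta> \<in> S \<Longrightarrow> kappa (of_real k) \<alpha> + \<beta> \<notin> dn_cut"
    and adm: "\<And>\<beta>. \<beta> \<in> S \<Longrightarrow> admissible_shift \<gamma> (log_p k \<beta>) (\<epsilon>1 (\<beta>, \<alpha>))"
      "\<And>\<beta>. \<beta> \<in> S \<Longrightarrow> admissible_shift \<gamma> (log_p k \<beta>) (\<epsilon>2 (\<beta>, \<alpha>))"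
  shows "K_pp k \<gamma> \<epsilon>1 (\<beta>, \<alpha>) * K_pm k \<gamma> \<epsilon>2 (\<beta>, \<alpha>) = 1 / sqrt_dn (kappa (of_real k) \<alpha> + \<beta>)"
proof -
  let ?\<kappa> = "kappa (of_real k) \<alpha>"
  have sw: "1 + \<beta> / ?\<kappa> \<notin> sw_cut" if "\<beta> \<in> S" for \<beta>
  proof (cases "\<beta> = 0")
    case True
    then show ?thesis using sw_cut_Re_nonpos[of 1] by auto
  next
    case False
    obtain s where s: "\<alpha> = \<gamma> s" using \<alpha> by blast
    have "\<bar>0\<bar> \<le> \<epsilon>1 (\<beta>, \<alpha>)" using adm(1)[OF that] by (simp add: admissible_shift_def)
    from admissible_shift_off_cuts[OF k False adm(1)[OF that] this, of s]
    show ?thesis by (simp add: off_cuts_def s)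
  qed
  define Ib where "Ib = line_integral (shift_b \<gamma> (\<epsilon>1 (\<beta>, \<alpha>))) (\<lambda>z. log_p k \<beta> z / (z - \<alpha>))"
  define Ia where "Ia = line_integral (shift_a \<gamma> (\<epsilon>2 (\<beta>, \<alpha>))) (\<lambda>z. log_p k \<beta> z / (z - \<alpha>))"
  have jump: "Ib - Ia = 2 * pi * \<i> * log_p k \<beta> \<alpha>"
    unfolding Ib_def Ia_def by (rule line_integral_jump[OF k \<gamma>(1) \<alpha> adm[OF S(3)]])
  have "- 1 / (4 * \<i> * pi) * Ib + 1 / (4 * \<i> * pi) * Ia = - (Ib - Ia) / (4 * \<i> * pi)"
    by (simp add: diff_divide_distrib)
  also have "\<dots> = - log_p k \<beta> \<alpha> / 2" unfolding jump by simp
  finally have e: "exp (- 1 / (4 * \<i> * pi) * Ib) * exp (1 / (4 * \<i> * pi) * Ia) = exp (- log_p k \<beta> \<alpha> / 2)"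
    by (simp only: exp_add[symmetric])
  have "K_pp k \<gamma> \<epsilon>1 (\<beta>, \<alpha>) * K_pm k \<gamma> \<epsilon>2 (\<beta>, \<alpha>) =
     1 / (sqrt_dn (sqrt_dn (of_real k + \<alpha>)) * sqrt_dn (sqrt_dn (of_real k - \<alpha>)))
      * (exp (- 1 / (4 * \<i> * pi) * Ib) * exp (1 / (4 * \<i> * pi) * Ia))"
    by (simp add: K_pp_def K_pm_def Ib_def Ia_def)
  also have "\<dots> = 1 / sqrt_dn ?\<kappa> * exp (- log_sw (1 + \<beta> / ?\<kappa>) / 2)"
    unfolding e by (simp add: sqrt_dn_kappa[OF \<gamma> cuts \<kappa> \<alpha>] log_p_def)
  also have "\<dots> = 1 / sqrt_dn (?\<kappa> + \<beta>)"
    by (rule one_over_sqrt_dn_factor[OF S off sw, symmetric])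
  finally show ?thesis .
qed

theorem mainTheorem2:
  fixes k :: real and \<gamma> :: "real \<Rightarrow> complex"
    and \<epsilon>pp \<epsilon>pm \<epsilon>mp \<epsilon>mm :: "complex \<times> complex \<Rightarrow> real"
  assumes "k > 0"
    and "good_contour k \<gamma>"
    and "\<And>\<alpha>1 \<alpha>2. (\<alpha>1, \<alpha>2) \<in> UHP \<gamma> \<times> UHP \<gamma> \<Longrightarrow> admissible_shift \<gamma> (log_p k \<alpha>1) (\<epsilon>pp (\<alpha>1, \<alpha>2))"
    and "\<And>\<alpha>1 \<alpha>2. (\<alpha>1, \<alpha>2) \<in> UHP \<gamma> \<times> LHP \<gamma> \<Longrightarrow> admissible_shift \<gamma> (log_p k \<alpha>1) (\<epsilon>pm (\<alpha>1, \<alpha>2))"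
    and "\<And>\<alpha>1 \<alpha>2. (\<alpha>1, \<alpha>2) \<in> LHP \<gamma> \<times> UHP \<gamma> \<Longrightarrow> admissible_shift \<gamma> (log_m k \<alpha>1) (\<epsilon>mp (\<alpha>1, \<alpha>2))"
    and "\<And>\<alpha>1 \<alpha>2. (\<alpha>1, \<alpha>2) \<in> LHP \<gamma> \<times> LHP \<gamma> \<Longrightarrow> admissible_shift \<gamma> (log_m k \<alpha>1) (\<epsilon>mm (\<alpha>1, \<alpha>2))"
  shows "analytic2_on (K_pp k \<gamma> \<epsilon>pp) (UHP \<gamma> \<times> UHP \<gamma>) \<and>
         analytic2_on (K_pm k \<gamma> \<epsilon>pm) (UHP \<gamma> \<times> LHP \<gamma>) \<and>
         analytic2_on (K_mp k \<gamma> \<epsilon>mp) (LHP \<gamma> \<times> UHP \<gamma>) \<and>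
         analytic2_on (K_mm k \<gamma> \<epsilon>mm) (LHP \<gamma> \<times> LHP \<gamma>) \<and>
         (\<forall>p \<in> LHP \<gamma> \<times> range \<gamma>. K_mo k p = K_mp k \<gamma> \<epsilon>mp p * K_mm k \<gamma> \<epsilon>mm p) \<and>
         (\<forall>p \<in> UHP \<gamma> \<times> range \<gamma>. K_po k p = K_pp k \<gamma> \<epsilon>pp p * K_pm k \<gamma> \<epsilon>pm p) \<and>
         (\<forall>p \<in> range \<gamma> \<times> range \<gamma>.
            K k p = K_pp k \<gamma> \<epsilon>pp p * K_pm k \<gamma> \<epsilon>pm p * K_mp k \<gamma> \<epsilon>mp p * K_mm k \<gamma> \<epsilon>mm p)"
proof -
  note k = assms(1) and good = assms(2)
  have \<gamma>: "smooth_line \<gamma>" "0 \<in> range \<gamma>" and sides: "- of_real k \<in> below (range \<gamma>)" "of_real k \<in> above (range \<gamma>)"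
    using good by (auto simp: good_contour_def)
  have cuts: "range \<gamma> \<inter> kappa_cuts (of_real k) = {}" using good \<gamma>(2) unfolding good_contour_def by blast
  have inner: "range \<gamma> \<inter> kappa_cuts (kappa (of_real k) \<alpha>) = {}" "- kappa (of_real k) \<alpha> \<in> below (range \<gamma>)"
      "kappa (of_real k) \<alpha> \<in> above (range \<gamma>)" if "\<alpha> \<in> range \<gamma>" for \<alpha>
    using good that unfolding good_contour_def by blast+
  have \<kappa>: "kappa (of_real k) \<alpha> \<notin> dn_cut" if "\<alpha> \<in> range \<gamma>" for \<alpha>
    using inner(1)[OF that] \<gamma>(2) by (auto simp: kappa_cuts_def)
  have sub: "range \<gamma> \<subseteq> UHP \<gamma>" "range \<gamma> \<subseteq> LHP \<gamma>" by (auto simp: UHP_def LHP_def)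
  have neg: "- \<beta> \<in> uminus ` LHP \<gamma> \<longleftrightarrow> \<beta> \<in> LHP \<gamma>" for \<beta> by (rule inj_image_mem_iff[OF inj_uminus])
  define \<delta>mp where "\<delta>mp = (\<lambda>(\<beta>, \<alpha>). \<epsilon>mp (- \<beta>, \<alpha>))"
  define \<delta>mm where "\<delta>mm = (\<lambda>(\<beta>, \<alpha>). \<epsilon>mm (- \<beta>, \<alpha>))"
  have adp: "admissible_shift \<gamma> (log_p k \<beta>) (\<epsilon>pp (\<beta>, \<alpha>))" if "\<beta> \<in> UHP \<gamma>" "\<alpha> \<in> UHP \<gamma>" for \<beta> \<alpha>
    using assms(3)[of \<beta> \<alpha>] that by simp
  have adm: "admissible_shift \<gamma> (log_p k \<beta>) (\<epsilon>pm (\<beta>, \<alpha>))" if "\<beta> \<in> UHP \<gamma>" "\<alpha> \<in> LHP \<gamma>" for \<beta> \<alpha>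
    using assms(4)[of \<beta> \<alpha>] that by simp
  have admp: "admissible_shift \<gamma> (log_p k \<beta>) (\<delta>mp (\<beta>, \<alpha>))" if "\<beta> \<in> uminus ` LHP \<gamma>" "\<alpha> \<in> UHP \<gamma>" for \<beta> \<alpha>
    using assms(5)[of "- \<beta>" \<alpha>] that by (auto simp: \<delta>mp_def log_m_eq)
  have admm: "admissible_shift \<gamma> (log_p k \<beta>) (\<delta>mm (\<beta>, \<alpha>))" if "\<beta> \<in> uminus ` LHP \<gamma>" "\<alpha> \<in> LHP \<gamma>" for \<beta> \<alpha>
    using assms(6)[of "- \<beta>" \<alpha>] that by (auto simp: \<delta>mm_def log_m_eq)
  have connU: "connected (UHP \<gamma>)"
  proof -
    have "admissible_shift \<gamma> (log_p k 0) (\<epsilon>pp (0, 0))" using adp \<gamma>(2) sub by blast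
    then show ?thesis unfolding admissible_shift_def by (intro connected_UHP[OF \<gamma>(1), of "\<epsilon>pp (0, 0)"]) auto
  qed
  have connL: "connected (uminus ` LHP \<gamma>)"
  proof -
    have "admissible_shift \<gamma> (log_p k 0) (\<epsilon>pp (0, 0))" using adp \<gamma>(2) sub by blast
    from admissible_shift_reflect[OF this] show ?thesis
      unfolding LHP_uminus(2)[symmetric] admissible_shift_def
      by (intro connected_UHP[OF smooth_line_reflect(1)[OF \<gamma>(1)], of "\<epsilon>pp (0, 0)"]) auto
  qed
  have A1: "analytic2_on (K_pp k \<gamma> \<epsilon>pp) (UHP \<gamma> \<times> UHP \<gamma>)"
    by (rule K_pp_analytic[OF k \<gamma>(1) cuts sides(1) adp])
  have A2: "analytic2_on (K_pm k \<gamma> \<epsilon>pm) (UHP \<gamma> \<times> LHP \<gamma>)"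
    by (rule K_pm_analytic[OF k \<gamma>(1) cuts sides(2) adm])
  have A3: "analytic2_on (K_mp k \<gamma> \<epsilon>mp) (LHP \<gamma> \<times> UHP \<gamma>)"
    by (rule analytic2_on_rescale[OF K_pp_analytic[OF k \<gamma>(1) cuts sides(1) admp], where \<sigma>="- 1" and \<tau>=1])
      (auto simp: K_mp_eq \<delta>mp_def)
  have A4: "analytic2_on (K_mm k \<gamma> \<epsilon>mm) (LHP \<gamma> \<times> LHP \<gamma>)"
    by (rule analytic2_on_rescale[OF K_pm_analytic[OF k \<gamma>(1) cuts sides(2) admm], where \<sigma>="- 1" and \<tau>=1])
      (auto simp: K_mm_eq \<delta>mm_def)
  have P1: "K_po k (\<beta>, \<alpha>) = K_pp k \<gamma> \<epsilon>pp (\<beta>, \<alpha>) * K_pm k \<gamma> \<epsilon>pm (\<beta>, \<alpha>)"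
    if \<beta>: "\<beta> \<in> UHP \<gamma>" and \<alpha>: "\<alpha> \<in> range \<gamma>" for \<beta> \<alpha>
  proof -
    have "K_pp k \<gamma> \<epsilon>pp (\<beta>, \<alpha>) * K_pm k \<gamma> \<epsilon>pm (\<beta>, \<alpha>) = 1 / sqrt_dn (kappa (of_real k) \<alpha> + \<beta>)"
    proof (rule K_pp_K_pm_product[OF k \<gamma> cuts \<kappa> connU _ \<beta> \<alpha>])
      show "kappa (of_real k) \<alpha> + \<beta> \<notin> dn_cut" if "\<beta> \<in> UHP \<gamma>" for \<beta>
        by (rule UHP_off_dn_cut[OF \<gamma>(1) inner(2,1)[OF \<alpha>] that])
    qed (use adp adm sub \<gamma>(2) \<alpha> in auto)
    then show ?thesis by (simp add: K_po_def)
  qed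
  have P2: "K_mo k (\<beta>, \<alpha>) = K_mp k \<gamma> \<epsilon>mp (\<beta>, \<alpha>) * K_mm k \<gamma> \<epsilon>mm (\<beta>, \<alpha>)"
    if \<beta>: "\<beta> \<in> LHP \<gamma>" and \<alpha>: "\<alpha> \<in> range \<gamma>" for \<beta> \<alpha>
  proof -
    have "K_pp k \<gamma> \<delta>mp (- \<beta>, \<alpha>) * K_pm k \<gamma> \<delta>mm (- \<beta>, \<alpha>) = 1 / sqrt_dn (kappa (of_real k) \<alpha> + - \<beta>)"
    proof (rule K_pp_K_pm_product[OF k \<gamma> cuts \<kappa> connL _ _ \<alpha>])
      show "kappa (of_real k) \<alpha> + \<beta> \<notin> dn_cut" if "\<beta> \<in> uminus ` LHP \<gamma>" for \<beta>
        using that LHP_off_dn_cut[OF \<gamma>(1) inner(3,1)[OF \<alpha>]] by auto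
      show "0 \<in> uminus ` LHP \<gamma>" using neg[of 0] \<gamma>(2) sub by auto
    qed (use admp admm sub \<beta> \<alpha> in auto)
    then show ?thesis by (simp add: K_mo_def K_mp_eq K_mm_eq \<delta>mp_def \<delta>mm_def)
  qed
  have P3: "K k (\<beta>, \<alpha>) = K_pp k \<gamma> \<epsilon>pp (\<beta>, \<alpha>) * K_pm k \<gamma> \<epsilon>pm (\<beta>, \<alpha>) * K_mp k \<gamma> \<epsilon>mp (\<beta>, \<alpha>) * K_mm k \<gamma> \<epsilon>mm (\<beta>, \<alpha>)"
    if "\<beta> \<in> range \<gamma>" "\<alpha> \<in> range \<gamma>" for \<beta> \<alpha>
  proof -
    have "K k (\<beta>, \<alpha>) = K_po k (\<beta>, \<alpha>) * K_mo k (\<beta>, \<alpha>)"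
      by (simp add: K_def K_po_def K_mo_def kappa_def[of "kappa (of_real k) \<alpha>"] mult.commute)
    moreover have "\<beta> \<in> UHP \<gamma>" "\<beta> \<in> LHP \<gamma>" using that sub by blast+
    ultimately show ?thesis using P1[OF _ that(2)] P2[OF _ that(2)] by (simp only: mult.assoc)
  qed
  show ?thesis using A1 A2 A3 A4 P1 P2 P3 by auto
qed

end
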